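(* Let $B\subset\Lambda$ be a noise-type Boolean algebra. If $B$ is complete, i.e. $\inf X\in B$ and $\sup X\in B$ for every $X\subset B$ (infimum and supremum taken in $\Lambda$), then $B$ is classical.
   Context: Let $(\Omega,\mathcal F,P)$ be a probability space with $H=L_2(\Omega,\mathcal F,P)$ (real-valued functions) separable. Every $\sigma$-field is assumed to contain all null sets. $\Lambda$ is the set of all sub-$\sigma$-fields of $\mathcal F$, partially ordered by inclusion; it is a complete lattice with $x\wedge y=x\cap y$, $x\vee y=\sigma(x,y)$ (the least $\sigma$-field containing $x$ and $y$), $\inf X=\bigcap_{x\in X}x$, $\sup X=\sigma(\bigcup_{x\in X}x)$ for $X\subset\Lambda$; its greatest element is $1_\Lambda=\mathcal F$ and its least element $0_\Lambda$ is the trivial $\sigma$-field (null sets and their complements). A noise-type Boolean algebra is a subset $B\subset\Lambda$ that is a sublattice (closed under $\wedge,\vee$), is distributive ($x\wedge(y\vee z)=(x\wedge y)\vee(x\wedge z)$ for $x,y,z\in B$), contains $0_\Lambda$ and $1_\Lambda$, is such that every $x\in B$ has a (necessarily unique) complement $x'\in B$ ($x\wedge x'=0_\Lambda$, $x\vee x'=1_\Lambda$), and such that for every $x\in B$ the $\sigma$-fields $x$ and $x'$ are independent. The first chaos space $H^{(1)}(B)$ is the closed linear subspace of $H$ consisting of all $f\in H$ such that $f=\mathbb E(f\mid x)+\mathbb E(f\mid x')$ for all $x\in B$. $B$ is called classical if the $\sigma$-field generated by all functions in $H^{(1)}(B)$ is the whole $\mathcal F$. *)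

theory Defs
  imports "HOL-Probability.Probability"
begin

section \<open>The lattice of sub-\<open>\<sigma>\<close>-fields\<close>

text \<open>A sub-\<open>\<sigma>\<close>-field of a probability space \<open>M\<close> is represented by its collection of
  measurable sets.  Null sets are the measurable sets of measure zero; \<open>M\<close> itself need not be a
  complete measure space (if it is, \<^term>\<open>null_sets M\<close> contains all negligible sets).\<close>

definition sub_fields :: "'a measure \<Rightarrow> 'a set set set" where
  "sub_fields M = {x. sigma_algebra (space M) x \<and> null_sets M \<subseteq> x \<and> x \<subseteq> sets M}"

definition gen_field :: "'a measure \<Rightarrow> 'a set set \<Rightarrow> 'a set set" where
  "gen_field M G = sigma_sets (space M) (G \<union> null_sets M)"

definition field_bot :: "'a measure \<Rightarrow> 'a set set" where
  "field_bot M = null_sets M \<union> (\<lambda>N. space M - N) ` null_sets M"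

definition field_top :: "'a measure \<Rightarrow> 'a set set" where
  "field_top M = sets M"

definition field_join :: "'a measure \<Rightarrow> 'a set set \<Rightarrow> 'a set set \<Rightarrow> 'a set set" where
  "field_join M x y = gen_field M (x \<union> y)"

text \<open>The intersection with \<^term>\<open>sets M\<close> only matters for the empty family, whose infimum is the
  greatest element; similarly \<^const>\<open>gen_field\<close> makes the supremum of the empty family the
  least element.\<close>

definition field_Inf :: "'a measure \<Rightarrow> 'a set set set \<Rightarrow> 'a set set" where
  "field_Inf M X = sets M \<inter> \<Inter>X"

definition field_Sup :: "'a measure \<Rightarrow> 'a set set set \<Rightarrow> 'a set set" where
  "field_Sup M X = gen_field M (\<Union>X)"

lemma gen_field_least:
  assumes "y \<in> sub_fields M" "G \<subseteq> y"
  shows "gen_field M G \<subseteq> y"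
  unfolding gen_field_def
  by (rule sigma_algebra.sigma_sets_subset) (use assms in \<open>simp_all add: sub_fields_def\<close>)

lemma gen_field_superset: "G \<subseteq> gen_field M G"
  unfolding gen_field_def by auto

lemma gen_field_in_sub_fields:
  assumes "G \<subseteq> sets M"
  shows "gen_field M G \<in> sub_fields M"
proof -
  have G: "G \<union> null_sets M \<subseteq> sets M"
    using assms by (auto intro: null_setsD2)
  then have "G \<union> null_sets M \<subseteq> Pow (space M)"
    using sets.space_closed[of M] by (rule subset_trans)
  then have "sigma_algebra (space M) (gen_field M G)"
    unfolding gen_field_def by (rule sigma_algebra_sigma_sets)
  moreover have "gen_field M G \<subseteq> sets M"
    unfolding gen_field_def using G by (rule sets.sigma_sets_subset)
  moreover have "null_sets M \<subseteq> gen_field M G"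
    unfolding gen_field_def by auto
  ultimately show ?thesis
    by (simp add: sub_fields_def)
qed

lemma field_Sup_is_supremum:
  assumes "X \<subseteq> sub_fields M"
  shows "field_Sup M X \<in> sub_fields M"
    and "x \<in> X \<Longrightarrow> x \<subseteq> field_Sup M X"
    and "y \<in> sub_fields M \<Longrightarrow> (\<And>x. x \<in> X \<Longrightarrow> x \<subseteq> y) \<Longrightarrow> field_Sup M X \<subseteq> y"
proof -
  have "\<Union>X \<subseteq> sets M"
    using assms by (auto simp: sub_fields_def)
  then show "field_Sup M X \<in> sub_fields M"
    unfolding field_Sup_def by (rule gen_field_in_sub_fields)
  show "x \<in> X \<Longrightarrow> x \<subseteq> field_Sup M X"
    unfolding field_Sup_def using gen_field_superset[of "\<Union>X" M] by blast
  show "y \<in> sub_fields M \<Longrightarrow> (\<And>x. x \<in> X \<Longrightarrow> x \<subseteq> y) \<Longrightarrow> field_Sup M X \<subseteq> y"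
    unfolding field_Sup_def by (rule gen_field_least) auto
qed

lemma field_Inf_is_infimum:
  assumes "X \<subseteq> sub_fields M"
  shows "field_Inf M X \<in> sub_fields M"
    and "x \<in> X \<Longrightarrow> field_Inf M X \<subseteq> x"
    and "y \<in> sub_fields M \<Longrightarrow> (\<And>x. x \<in> X \<Longrightarrow> y \<subseteq> x) \<Longrightarrow> y \<subseteq> field_Inf M X"
proof -
  have sa: "sigma_algebra (space M) x" if "x \<in> insert (sets M) X" for x
    using that assms sets.sigma_algebra_axioms[of M] by (auto simp: sub_fields_def)
  have "sigma_algebra (space M) (field_Inf M X)"
    unfolding sigma_algebra_iff2
  proof (intro conjI ballI allI impI)
    show "field_Inf M X \<subseteq> Pow (space M)"
      using sets.space_closed[of M] by (auto simp: field_Inf_def)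
    show "{} \<in> field_Inf M X"
      using sa by (auto simp: field_Inf_def sigma_algebra_iff2)
    show "space M - s \<in> field_Inf M X" if "s \<in> field_Inf M X" for s
      using that sa by (auto simp: field_Inf_def sigma_algebra_iff2)
    show "\<Union>(range A) \<in> field_Inf M X" if "range A \<subseteq> field_Inf M X" for A :: "nat \<Rightarrow> _"
    proof -
      have "\<Union>(range A) \<in> x" if x: "x \<in> insert (sets M) X" for x
      proof -
        have "range A \<subseteq> x"
          using x \<open>range A \<subseteq> field_Inf M X\<close> by (auto simp: field_Inf_def)
        then show ?thesis
          using sa[OF x] by (simp add: sigma_algebra_iff2)
      qed
      then show ?thesis
        by (simp add: field_Inf_def)
    qed
  qed
  moreover have "null_sets M \<subseteq> field_Inf M X"
    using assms by (fastforce simp: sub_fields_def field_Inf_def)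
  ultimately show "field_Inf M X \<in> sub_fields M"
    by (simp add: sub_fields_def field_Inf_def)
  show "x \<in> X \<Longrightarrow> field_Inf M X \<subseteq> x"
    by (auto simp: field_Inf_def)
  show "y \<in> sub_fields M \<Longrightarrow> (\<And>x. x \<in> X \<Longrightarrow> y \<subseteq> x) \<Longrightarrow> y \<subseteq> field_Inf M X"
    by (auto simp: field_Inf_def sub_fields_def)
qed


section \<open>Noise-type Boolean algebras\<close>

definition field_compl :: "'a measure \<Rightarrow> 'a set set set \<Rightarrow> 'a set set \<Rightarrow> 'a set set \<Rightarrow> bool" where
  "field_compl M B x x' \<longleftrightarrow>
     x' \<in> B \<and> x \<inter> x' = field_bot M \<and> field_join M x x' = field_top M"

definition noise_type_boolean_algebra :: "'a measure \<Rightarrow> 'a set set set \<Rightarrow> bool" where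
  "noise_type_boolean_algebra M B \<longleftrightarrow>
     B \<subseteq> sub_fields M \<and>
     (\<forall>x\<in>B. \<forall>y\<in>B. x \<inter> y \<in> B \<and> field_join M x y \<in> B) \<and>
     (\<forall>x\<in>B. \<forall>y\<in>B. \<forall>z\<in>B. x \<inter> field_join M y z = field_join M (x \<inter> y) (x \<inter> z)) \<and>
     field_bot M \<in> B \<and> field_top M \<in> B \<and>
     (\<forall>x\<in>B. \<exists>x'. field_compl M B x x') \<and>
     (\<forall>x\<in>B. \<forall>x'. field_compl M B x x' \<longrightarrow> prob_space.indep_set M x x')"

definition complete_in_sub_fields :: "'a measure \<Rightarrow> 'a set set set \<Rightarrow> bool" where
  "complete_in_sub_fields M B \<longleftrightarrow> (\<forall>X. X \<subseteq> B \<longrightarrow> field_Inf M X \<in> B \<and> field_Sup M X \<in> B)"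

text \<open>Complements are unique, so quantifying over all \<open>x'\<close> with \<^term>\<open>field_compl M B x x'\<close>
  is speaking about the complement of \<open>x\<close>.\<close>

lemma field_compl_unique:
  assumes B: "noise_type_boolean_algebra M B" and x: "x \<in> B"
    and y: "field_compl M B x y" and z: "field_compl M B x z"
  shows "y = z"
proof -
  have *: "v \<subseteq> w" if v: "field_compl M B x v" and w: "field_compl M B x w" for v w
  proof -
    have "v \<in> B" "w \<in> B"
      using v w by (auto simp: field_compl_def)
    moreover have "v \<in> sub_fields M" "w \<in> sub_fields M"
      using B calculation by (auto simp: noise_type_boolean_algebra_def)
    ultimately have "v = v \<inter> field_join M x w"
      using w by (auto simp: field_compl_def field_top_def sub_fields_def)
    also have "\<dots> = field_join M (v \<inter> x) (v \<inter> w)"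
      using B x \<open>v \<in> B\<close> \<open>w \<in> B\<close> by (auto simp: noise_type_boolean_algebra_def)
    also have "v \<inter> x = x \<inter> w"
      using v w by (auto simp: field_compl_def)
    also have "field_join M (x \<inter> w) (v \<inter> w) \<subseteq> w"
      unfolding field_join_def by (rule gen_field_least[OF \<open>w \<in> sub_fields M\<close>]) auto
    finally show ?thesis .
  qed
  show ?thesis
    using *[OF y z] *[OF z y] by blast
qed


section \<open>Square-integrable functions and the first chaos\<close>

text \<open>Elements of \<open>L\<^sub>2\<close> are represented by functions; equality in \<open>L\<^sub>2\<close> is equality
  almost everywhere.\<close>

definition L2_functions :: "'a measure \<Rightarrow> ('a \<Rightarrow> real) set" where
  "L2_functions M = {f \<in> borel_measurable M. integrable M (\<lambda>\<omega>. (f \<omega>)\<^sup>2)}"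

definition L2_dist :: "'a measure \<Rightarrow> ('a \<Rightarrow> real) \<Rightarrow> ('a \<Rightarrow> real) \<Rightarrow> real" where
  "L2_dist M f g = sqrt (\<integral>\<omega>. (f \<omega> - g \<omega>)\<^sup>2 \<partial>M)"

definition L2_separable :: "'a measure \<Rightarrow> bool" where
  "L2_separable M \<longleftrightarrow>
     (\<exists>D. countable D \<and> D \<subseteq> L2_functions M \<and>
          (\<forall>f\<in>L2_functions M. \<forall>\<epsilon>>0. \<exists>g\<in>D. L2_dist M f g < \<epsilon>))"

definition cond_exp_on :: "'a measure \<Rightarrow> 'a set set \<Rightarrow> ('a \<Rightarrow> real) \<Rightarrow> 'a \<Rightarrow> real" where
  "cond_exp_on M x f = real_cond_exp M (sigma (space M) x) f"

definition first_chaos :: "'a measure \<Rightarrow> 'a set set set \<Rightarrow> ('a \<Rightarrow> real) set" where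
  "first_chaos M B =
     {f \<in> L2_functions M.
        \<forall>x\<in>B. \<forall>x'. field_compl M B x x' \<longrightarrow>
          (AE \<omega> in M. f \<omega> = cond_exp_on M x f \<omega> + cond_exp_on M x' f \<omega>)}"

definition classical :: "'a measure \<Rightarrow> 'a set set set \<Rightarrow> bool" where
  "classical M B \<longleftrightarrow>
     gen_field M {f -` A \<inter> space M | f A. f \<in> first_chaos M B \<and> A \<in> sets borel} = sets M"

end

theory Submission
  imports Defs
begin

text \<open>
  Write \<open>Q\<^sub>x f\<close> for the conditional expectation of \<open>f\<close> given \<open>x\<close>, and \<open>x'\<close> for the complement
  of \<open>x\<close>.  On \<open>B\<close> these projections commute, \<open>Q\<^sub>x Q\<^sub>y = Q\<^bsub>x \<inter> y\<^esub>\<close> (\<open>E_comm\<close>), so they can be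
  diagonalized together.  A point \<open>s\<close> of the joint spectrum behaves like a set that is or is not
  contained in \<open>x\<close>; a function \<open>f\<close> spreads a mass of \<open>\<parallel>f\<parallel>\<^sup>2\<close> over these points, and
  \<open>\<parallel>Q\<^sub>x f\<parallel>\<^sup>2\<close> is the mass of the points contained in \<open>x\<close>.  The spectrum is never constructed: each
  finite partition of unity \<open>c \<subseteq> B\<close> has a finite version of it, the orthogonal decomposition of \<open>f\<close>
  into parts that depend on exactly the cells in \<open>A\<close>, where \<open>A \<subseteq> c\<close> (\<open>decomposition_exists\<close>).  The
  number of cells that \<open>s\<close> meets grows under refinement towards a number \<open>K(s)\<close>, possibly infinite.
  The first chaos is the part with \<open>K = 1\<close>.  Let \<open>G\<close> be the field that it generates.

  The part with \<open>K < \<infinity>\<close> is \<open>G\<close>-measurable.  If the mean number of cells met by the spectrum of \<open>g\<close>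
  stays bounded under refinement, then for a fine enough partition no further refinement changes it
  much, so most of the spectrum has at most one point in each cell \<open>x\<close>
  (\<open>sum_at_most_one_residual\<close>).  Passing to the limit over refinements, a function with at most
  one point in \<open>x\<close> becomes, once everything outside \<open>x\<close> is fixed, a first chaos function
  plus a constant, hence it is measurable with respect to the chaos inside \<open>x\<close> and all of \<open>x'\<close>
  (\<open>relative_chaos\<close>).  The squared errors made in different cells at most add up (\<open>defect_join\<close>), and
  so \<open>g\<close> is \<open>G\<close>-measurable (\<open>bounded_kappa_classical\<close>).

  Completeness excludes \<open>K = \<infinity>\<close>.  Let \<open>f\<close> be orthogonal to all \<open>G\<close>-measurable functions.  Join a
  random subset of the cells, each cell taken with probability \<open>\<epsilon>\<close>, to an element \<open>r\<close>; the mean of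
  \<open>Q\<^bsub>r'\<^esub>\<close> multiplies a spectral part by \<open>(1 - \<epsilon>)\<^sup>K\<close>.  The limit of these operators maps \<open>f\<close> to a
  function with bounded mean number of cells, which is \<open>G\<close>-measurable and thus orthogonal to \<open>f\<close>
  (\<open>noise_op_vanishes\<close>): the spectrum of \<open>f\<close> has \<open>K = \<infinity>\<close> and meets \<open>r\<close> almost surely, however small
  \<open>\<epsilon>\<close> is.  Hence (\<open>small_element_exists\<close>) there are \<open>r\<^sub>1, r\<^sub>2, \<dots>\<close> in \<open>B\<close> such that the conditional expectation
  of \<open>f\<close> given the complement of \<open>r\<^sub>m\<close> tends to \<open>0\<close>, although the \<open>r\<^sub>m\<close> are so small that the supremum
  \<open>w\<^sub>n\<close> of all \<open>r\<^sub>m\<close> with \<open>m \<ge> n\<close> decreases to the trivial field; \<open>L\<^sub>2\<close> being separable, countably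
  many functions suffice to test this.  Because \<open>B\<close> is complete, the \<open>w\<^sub>n\<close> and their infimum belong to
  \<open>B\<close>, and therefore the complements of the \<open>w\<^sub>n\<close> increase to the whole \<open>\<sigma>\<close>-field.  But \<open>f\<close> has
  conditional expectation \<open>0\<close> given each of these, so \<open>f = 0\<close> (\<open>infinite_spectrum_trivial\<close>).
\<close>

section \<open>Sums over subsets\<close>

text \<open>The subsets with and without \<open>a\<close> cancel in pairs.\<close>

lemma alternating_sum_zero:
  fixes h :: "'b set \<Rightarrow> real"
  assumes A: "finite A" "a \<in> A" and h: "\<And>D. D \<subseteq> A \<Longrightarrow> h (insert a D) = h D"
  shows "(\<Sum>D\<in>Pow A. (-1) ^ (card A + card D) * h D) = 0"
proof -
  define A' where "A' = A - {a}"
  have A': "A = insert a A'" "a \<notin> A'" "finite A'" using A by (auto simp: A'_def)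
  have "(\<Sum>D\<in>Pow A. (-1) ^ (card A + card D) * h D) =
     (\<Sum>D\<in>Pow A'. (-1) ^ (card A + card D) * h D) + (\<Sum>D\<in>insert a ` Pow A'. (-1) ^ (card A + card D) * h D)"
    unfolding A'(1) Pow_insert by (rule sum.union_disjoint) (use A' in auto)
  also have "(\<Sum>D\<in>insert a ` Pow A'. (-1) ^ (card A + card D) * h D) =
     (\<Sum>D\<in>Pow A'. (-1) ^ (card A + card (insert a D)) * h (insert a D))"
    by (rule sum.reindex_cong[OF _ refl refl]) (use A' in \<open>auto simp: inj_on_def\<close>)
  also have "\<dots> = (\<Sum>D\<in>Pow A'. - ((-1) ^ (card A + card D) * h D))"
  proof (rule sum.cong[OF refl])
    fix D assume D: "D \<in> Pow A'"
    then have "finite D" "a \<notin> D" "D \<subseteq> A" using A' by (auto intro: finite_subset)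
    then show "(-1) ^ (card A + card (insert a D)) * h (insert a D) = - ((-1) ^ (card A + card D) * h D)"
      using h by simp
  qed
  finally show ?thesis by (simp add: sum_negf)
qed

text \<open>The probability that a random subset of \<open>b\<close>, containing each element independently with
  probability \<open>\<epsilon>\<close>, equals \<open>D\<close>.\<close>

definition choice_weight :: "real \<Rightarrow> 'b set \<Rightarrow> 'b set \<Rightarrow> real" where
  "choice_weight \<epsilon> b D = \<epsilon> ^ card D * (1 - \<epsilon>) ^ card (b - D)"

lemma choice_weight_nonneg: "0 \<le> \<epsilon> \<Longrightarrow> \<epsilon> \<le> 1 \<Longrightarrow> 0 \<le> choice_weight \<epsilon> b D"
  by (simp add: choice_weight_def)

text \<open>The elements of \<open>A\<close> are left out independently of each other; expanding
  \<open>(0 + (1 - \<epsilon>))\<^bsup>card A\<^esup> (\<epsilon> + (1 - \<epsilon>))\<^bsup>card (b - A)\<^esup>\<close> sums exactly over the subsets that avoid \<open>A\<close>.\<close>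

lemma choice_avoid:
  assumes b: "finite b" and A: "A \<subseteq> b"
  shows "(\<Sum>D\<in>Pow b. choice_weight \<epsilon> b D * of_bool (D \<inter> A = {})) = (1 - \<epsilon>) ^ card A"
proof -
  define f where "f y = (if y \<in> A then 0 else \<epsilon>)" for y
  have "(\<Prod>y\<in>b. f y + (1 - \<epsilon>)) = (\<Sum>D\<in>Pow b. prod f D * (\<Prod>y\<in>b - D. 1 - \<epsilon>))"
    by (rule prod_add[OF b])
  also have "\<dots> = (\<Sum>D\<in>Pow b. choice_weight \<epsilon> b D * of_bool (D \<inter> A = {}))"
  proof (rule sum.cong[OF refl])
    fix D assume "D \<in> Pow b"
    then have fin: "finite D" using b finite_subset by auto
    show "prod f D * (\<Prod>y\<in>b - D. 1 - \<epsilon>) = choice_weight \<epsilon> b D * of_bool (D \<inter> A = {})"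
    proof (cases "D \<inter> A = {}")
      case True
      then have "prod f D = (\<Prod>y\<in>D. \<epsilon>)" by (intro prod.cong) (auto simp: f_def)
      then show ?thesis using True by (simp add: choice_weight_def)
    next
      case False
      then have "\<exists>y\<in>D. f y = 0" by (auto simp: f_def)
      then have "prod f D = 0" using fin by (simp add: prod_zero)
      then show ?thesis using False by simp
    qed
  qed
  also have "(\<Prod>y\<in>b. f y + (1 - \<epsilon>)) = (\<Prod>y\<in>b. if y \<in> A then 1 - \<epsilon> else 1)"
    by (rule prod.cong) (auto simp: f_def)
  also have "\<dots> = (1 - \<epsilon>) ^ card A"
    using b A by (simp add: prod.If_cases Int_absorb1)
  finally show ?thesis by simp
qed

lemma choice_total: "finite b \<Longrightarrow> (\<Sum>D\<in>Pow b. choice_weight \<epsilon> b D) = 1"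
  using choice_avoid[of b "{}" \<epsilon>] by simp

lemma choice_contains:
  assumes b: "finite b" and a: "a \<in> b"
  shows "(\<Sum>D\<in>Pow b. choice_weight \<epsilon> b D * of_bool (a \<in> D)) = \<epsilon>"
proof -
  have "(\<Sum>D\<in>Pow b. choice_weight \<epsilon> b D * of_bool (a \<in> D)) =
    (\<Sum>D\<in>Pow b. choice_weight \<epsilon> b D) - (\<Sum>D\<in>Pow b. choice_weight \<epsilon> b D * of_bool (D \<inter> {a} = {}))"
    unfolding sum_subtractf[symmetric] by (rule sum.cong) auto
  then show ?thesis using choice_avoid[OF b, of "{a}" \<epsilon>] a choice_total[OF b] by simp
qed

lemma empty_or_singleton_or_larger:
  assumes "finite N"
  shows "N = {} \<or> (\<exists>v. N = {v}) \<or> 1 < card N"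
proof -
  consider "card N = 0" | "card N = 1" | "1 < card N" by linarith
  then show ?thesis using assms by cases (auto simp: card_1_singleton_iff)
qed

text \<open>The geometric series dominates \<open>n p\<^sup>n\<close>.  This keeps the mean number of occupied cells bounded
  after the factor \<open>p\<^sup>n\<close> has been applied.\<close>

lemma power_times_exponent_le:
  fixes p :: real
  assumes p: "0 \<le> p" "p < 1"
  shows "real n * (p ^ n)\<^sup>2 \<le> 1 / (1 - p)"
proof -
  have pn: "0 \<le> p ^ n" "p ^ n \<le> 1" using p by (auto simp: power_le_one)
  have "real n * (p ^ n)\<^sup>2 \<le> real n * p ^ n"
    using pn by (intro mult_left_mono) (auto simp: power2_eq_square mult_left_le)
  also have "\<dots> = (\<Sum>j<n. p ^ n)" by simp
  also have "\<dots> \<le> (\<Sum>j<n. p ^ j)" using p by (intro sum_mono power_decreasing) auto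
  also have "\<dots> = (1 - p ^ n) / (1 - p)" using p by (simp add: sum_gp_strict)
  also have "\<dots> \<le> 1 / (1 - p)" using p pn by (intro divide_right_mono) auto
  finally show ?thesis .
qed

section \<open>Square-integrable functions\<close>

context prob_space
begin

definition ip :: "('a \<Rightarrow> real) \<Rightarrow> ('a \<Rightarrow> real) \<Rightarrow> real" where
  "ip f g = (\<integral>\<omega>. f \<omega> * g \<omega> \<partial>M)"

abbreviation sqn :: "('a \<Rightarrow> real) \<Rightarrow> real" where
  "sqn f \<equiv> ip f f"

abbreviation L2 :: "('a \<Rightarrow> real) set" where
  "L2 \<equiv> L2_functions M"

lemma L2_measurable [measurable_dest]: "f \<in> L2 \<Longrightarrow> f \<in> borel_measurable M"
  by (simp add: L2_functions_def)

lemma L2_square: "f \<in> L2 \<Longrightarrow> integrable M (\<lambda>\<omega>. (f \<omega>)\<^sup>2)"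
  by (simp add: L2_functions_def)

lemma L2_integrable: "f \<in> L2 \<Longrightarrow> integrable M f"
  by (auto simp: L2_functions_def intro: square_integrable_imp_integrable)

lemma L2_mult_integrable:
  assumes "f \<in> L2" "g \<in> L2"
  shows "integrable M (\<lambda>\<omega>. f \<omega> * g \<omega>)"
proof (rule Bochner_Integration.integrable_bound)
  show "integrable M (\<lambda>\<omega>. (f \<omega>)\<^sup>2 + (g \<omega>)\<^sup>2)"
    using assms by (auto simp: L2_functions_def)
  show "(\<lambda>\<omega>. f \<omega> * g \<omega>) \<in> borel_measurable M"
    using assms by (auto simp: L2_functions_def)
  have "\<bar>a * b\<bar> \<le> a\<^sup>2 + b\<^sup>2" for a b :: real
  proof -
    have "2 * (\<bar>a\<bar> * \<bar>b\<bar>) \<le> a\<^sup>2 + b\<^sup>2"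
      using sum_squares_bound[of "\<bar>a\<bar>" "\<bar>b\<bar>"] by (simp add: mult.assoc)
    moreover have "0 \<le> \<bar>a\<bar> * \<bar>b\<bar>" by simp
    ultimately show ?thesis unfolding abs_mult by linarith
  qed
  then show "AE \<omega> in M. norm (f \<omega> * g \<omega>) \<le> norm ((f \<omega>)\<^sup>2 + (g \<omega>)\<^sup>2)"
    by simp
qed

lemma L2_add:
  assumes "f \<in> L2" "g \<in> L2"
  shows "(\<lambda>\<omega>. f \<omega> + g \<omega>) \<in> L2"
proof -
  have "integrable M (\<lambda>\<omega>. (f \<omega>)\<^sup>2 + (g \<omega>)\<^sup>2 + 2 * (f \<omega> * g \<omega>))"
    using L2_mult_integrable[OF assms] assms by (auto simp: L2_functions_def)
  then have "integrable M (\<lambda>\<omega>. (f \<omega> + g \<omega>)\<^sup>2)"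
    by (simp add: power2_sum mult.assoc)
  then show ?thesis
    using assms by (auto simp: L2_functions_def)
qed

lemma L2_scale: "f \<in> L2 \<Longrightarrow> (\<lambda>\<omega>. c * f \<omega>) \<in> L2"
  by (auto simp: L2_functions_def power_mult_distrib)

lemma L2_diff:
  assumes "f \<in> L2" "g \<in> L2"
  shows "(\<lambda>\<omega>. f \<omega> - g \<omega>) \<in> L2"
  using L2_add[OF assms(1) L2_scale[OF assms(2), of "- 1"]] by simp

lemma L2_const: "(\<lambda>_. c) \<in> L2"
  by (auto simp: L2_functions_def)

lemma L2_sum: "(\<And>i. i \<in> I \<Longrightarrow> f i \<in> L2) \<Longrightarrow> (\<lambda>\<omega>. \<Sum>i\<in>I. f i \<omega>) \<in> L2"
proof (induction I rule: infinite_finite_induct)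
  case (insert i I)
  then show ?case using L2_add[of "f i" "\<lambda>\<omega>. \<Sum>i\<in>I. f i \<omega>"] by auto
qed (auto simp: L2_const)

lemma L2_indicator: "A \<in> sets M \<Longrightarrow> indicator A \<in> L2"
  unfolding L2_functions_def
  by (auto intro!: integrable_const_bound[where B=1] simp: indicator_def)

lemma L2_restrict:
  assumes "f \<in> L2" "A \<in> sets M"
  shows "(\<lambda>\<omega>. indicator A \<omega> * f \<omega>) \<in> L2"
proof -
  have "integrable M (\<lambda>\<omega>. indicator A \<omega> * (f \<omega>)\<^sup>2)"
    using integrable_real_mult_indicator[OF assms(2) L2_square[OF assms(1)]] by (simp add: mult.commute)
  also have "(\<lambda>\<omega>. indicator A \<omega> * (f \<omega>)\<^sup>2) = (\<lambda>\<omega>. (indicator A \<omega> * f \<omega>)\<^sup>2)"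
    by (auto simp: indicator_def fun_eq_iff)
  finally show ?thesis using assms by (auto simp: L2_functions_def)
qed

lemmas L2_intros = L2_add L2_scale L2_diff L2_const L2_sum L2_indicator L2_restrict

lemma ip_commute: "ip f g = ip g f"
  by (simp add: ip_def mult.commute)

lemma ip_add_left: "f \<in> L2 \<Longrightarrow> g \<in> L2 \<Longrightarrow> h \<in> L2 \<Longrightarrow> ip (\<lambda>\<omega>. f \<omega> + g \<omega>) h = ip f h + ip g h"
  by (simp add: ip_def distrib_right L2_mult_integrable)

lemma ip_diff_left: "f \<in> L2 \<Longrightarrow> g \<in> L2 \<Longrightarrow> h \<in> L2 \<Longrightarrow> ip (\<lambda>\<omega>. f \<omega> - g \<omega>) h = ip f h - ip g h"
  by (simp add: ip_def left_diff_distrib L2_mult_integrable)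

lemma ip_scale_left: "ip (\<lambda>\<omega>. c * f \<omega>) h = c * ip f h"
  by (simp add: ip_def mult.assoc)

lemma ip_sum_left:
  "(\<And>i. i \<in> I \<Longrightarrow> f i \<in> L2) \<Longrightarrow> h \<in> L2 \<Longrightarrow> ip (\<lambda>\<omega>. \<Sum>i\<in>I. f i \<omega>) h = (\<Sum>i\<in>I. ip (f i) h)"
  by (simp add: ip_def sum_distrib_right L2_mult_integrable)

lemma ip_add_right: "f \<in> L2 \<Longrightarrow> g \<in> L2 \<Longrightarrow> h \<in> L2 \<Longrightarrow> ip h (\<lambda>\<omega>. f \<omega> + g \<omega>) = ip h f + ip h g"
  using ip_add_left by (simp add: ip_commute)

lemma ip_diff_right: "f \<in> L2 \<Longrightarrow> g \<in> L2 \<Longrightarrow> h \<in> L2 \<Longrightarrow> ip h (\<lambda>\<omega>. f \<omega> - g \<omega>) = ip h f - ip h g"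
  using ip_diff_left by (simp add: ip_commute)

lemma ip_scale_right: "ip h (\<lambda>\<omega>. c * f \<omega>) = c * ip h f"
  using ip_scale_left by (simp add: ip_commute)

lemma ip_sum_right:
  "(\<And>i. i \<in> I \<Longrightarrow> f i \<in> L2) \<Longrightarrow> h \<in> L2 \<Longrightarrow> ip h (\<lambda>\<omega>. \<Sum>i\<in>I. f i \<omega>) = (\<Sum>i\<in>I. ip h (f i))"
  by (simp add: ip_def sum_distrib_left L2_mult_integrable)

lemma ip_cong_AE:
  assumes "AE \<omega> in M. f \<omega> = f' \<omega>" "AE \<omega> in M. g \<omega> = g' \<omega>"
    and "f \<in> L2" "f' \<in> L2" "g \<in> L2" "g' \<in> L2"
  shows "ip f g = ip f' g'"
  unfolding ip_def
proof (rule integral_cong_AE)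
  show "AE \<omega> in M. f \<omega> * g \<omega> = f' \<omega> * g' \<omega>"
    using assms(1,2) by eventually_elim simp
qed (use assms in \<open>auto intro!: borel_measurable_times L2_measurable\<close>)

lemma sqn_nonneg: "0 \<le> sqn f"
  by (simp add: ip_def)

lemma sqn_eq_0_iff: "f \<in> L2 \<Longrightarrow> sqn f = 0 \<longleftrightarrow> (AE \<omega> in M. f \<omega> = 0)"
  unfolding ip_def
  by (subst integral_nonneg_eq_0_iff_AE) (auto intro: L2_mult_integrable)

lemma sqn_diff: "f \<in> L2 \<Longrightarrow> g \<in> L2 \<Longrightarrow> sqn (\<lambda>\<omega>. f \<omega> - g \<omega>) = sqn f - 2 * ip f g + sqn g"
  by (simp add: ip_diff_left ip_diff_right L2_diff ip_commute[of g f])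

lemma sqn_add: "f \<in> L2 \<Longrightarrow> g \<in> L2 \<Longrightarrow> sqn (\<lambda>\<omega>. f \<omega> + g \<omega>) = sqn f + 2 * ip f g + sqn g"
  by (simp add: ip_add_left ip_add_right L2_add ip_commute[of g f])

text \<open>A triangle inequality for squared norms.  The loss of a factor \<open>2\<close> is harmless, since the
  bounds obtained in this way only have to be finite or arbitrarily small.\<close>

lemma sqn_add_le: "f \<in> L2 \<Longrightarrow> g \<in> L2 \<Longrightarrow> sqn (\<lambda>\<omega>. f \<omega> + g \<omega>) \<le> 2 * sqn f + 2 * sqn g"
  using sqn_nonneg[of "\<lambda>\<omega>. f \<omega> - g \<omega>"] sqn_add[of f g] sqn_diff[of f g] by linarith

lemma sqn_diff_le: "f \<in> L2 \<Longrightarrow> g \<in> L2 \<Longrightarrow> sqn (\<lambda>\<omega>. f \<omega> - g \<omega>) \<le> 2 * sqn f + 2 * sqn g"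
  using sqn_nonneg[of "\<lambda>\<omega>. f \<omega> + g \<omega>"] sqn_add[of f g] sqn_diff[of f g] by linarith

lemma sqn_diff_commute: "sqn (\<lambda>\<omega>. f \<omega> - g \<omega>) = sqn (\<lambda>\<omega>. g \<omega> - f \<omega>)"
  unfolding ip_def by (rule Bochner_Integration.integral_cong) (auto simp: algebra_simps)

lemma sqn_triangle:
  assumes "f \<in> L2" "g \<in> L2" "h \<in> L2"
  shows "sqn (\<lambda>\<omega>. f \<omega> - h \<omega>) \<le> 2 * sqn (\<lambda>\<omega>. f \<omega> - g \<omega>) + 2 * sqn (\<lambda>\<omega>. g \<omega> - h \<omega>)"
  using sqn_add_le[of "\<lambda>\<omega>. f \<omega> - g \<omega>" "\<lambda>\<omega>. g \<omega> - h \<omega>"] assms by (simp add: L2_diff)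

text \<open>The Cauchy--Schwarz inequality in the form given by the arithmetic-geometric mean: the weight \<open>s\<close>
  decides which of the two factors has to be small.\<close>

lemma ip_le:
  assumes "f \<in> L2" "g \<in> L2" "0 < s"
  shows "2 * \<bar>ip f g\<bar> \<le> s * sqn f + sqn g / s"
proof -
  have "0 \<le> sqn (\<lambda>\<omega>. s * f \<omega> - g \<omega>)" "0 \<le> sqn (\<lambda>\<omega>. s * f \<omega> + g \<omega>)"
    by (rule sqn_nonneg)+
  then have "2 * s * ip f g \<le> s * s * sqn f + sqn g" "- (2 * s * ip f g) \<le> s * s * sqn f + sqn g"
    using sqn_diff[OF L2_scale[OF assms(1), of s] assms(2)] sqn_add[OF L2_scale[OF assms(1), of s] assms(2)]
    by (simp_all add: ip_scale_left ip_scale_right)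
  then have "2 * s * \<bar>ip f g\<bar> \<le> s * s * sqn f + sqn g"
    by (cases "0 \<le> ip f g") auto
  then have "(2 * s * \<bar>ip f g\<bar>) / s \<le> (s * s * sqn f + sqn g) / s"
    using assms by (intro divide_right_mono) auto
  then show ?thesis using assms by (simp add: add_divide_distrib)
qed

lemma ip_indicator: "A \<in> sets M \<Longrightarrow> B \<in> sets M \<Longrightarrow> ip (indicator A) (indicator B) = prob (A \<inter> B)"
  by (simp add: ip_def flip: indicator_inter_arith)

lemma ip_indicator_inter:
  "ip f (indicator (A \<inter> B)) = ip (\<lambda>\<omega>. indicator A \<omega> * f \<omega>) (indicator B)"
  by (simp add: ip_def indicator_inter_arith mult_ac)

section \<open>Conditional expectations\<close>

abbreviation E :: "'a set set \<Rightarrow> ('a \<Rightarrow> real) \<Rightarrow> 'a \<Rightarrow> real" where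
  "E \<equiv> cond_exp_on M"

abbreviation meas :: "'a set set \<Rightarrow> ('a \<Rightarrow> real) set" where
  "meas x \<equiv> borel_measurable (sigma (space M) x)"

lemma sets_sub_field: "x \<in> sub_fields M \<Longrightarrow> sets (sigma (space M) x) = x"
  by (auto simp: sub_fields_def sigma_algebra.sets_measure_of_eq)

lemma sub_field_subset: "x \<in> sub_fields M \<Longrightarrow> x \<subseteq> sets M"
  by (simp add: sub_fields_def)

lemma sub_field_null: "x \<in> sub_fields M \<Longrightarrow> null_sets M \<subseteq> x"
  by (simp add: sub_fields_def)

lemma sub_field_sigma_algebra: "x \<in> sub_fields M \<Longrightarrow> sigma_algebra (space M) x"
  by (simp add: sub_fields_def)

lemma sub_field_space: "x \<in> sub_fields M \<Longrightarrow> space M \<in> x"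
  by (meson sub_field_sigma_algebra sigma_algebra.axioms(1) algebra.top)

lemma sub_field_Int: "x \<in> sub_fields M \<Longrightarrow> p \<in> x \<Longrightarrow> q \<in> x \<Longrightarrow> p \<inter> q \<in> x"
  by (meson sub_field_sigma_algebra sigma_algebra.axioms(1) algebra_iff_Int)

lemma sub_field_subalgebra: "x \<in> sub_fields M \<Longrightarrow> subalgebra M (sigma (space M) x)"
  by (simp add: subalgebra_def sets_sub_field sub_field_subset space_measure_of_conv)

lemma sub_field_sfs: "x \<in> sub_fields M \<Longrightarrow> sigma_finite_subalgebra M (sigma (space M) x)"
  using sub_field_subalgebra
  by (simp add: finite_measure_axioms finite_measure_subalgebra_def finite_measure_subalgebra_axioms_def
      finite_measure_subalgebra.axioms finite_measure_subalgebra_is_sigma_finite)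

lemma meas_mono: "x \<in> sub_fields M \<Longrightarrow> y \<in> sub_fields M \<Longrightarrow> x \<subseteq> y \<Longrightarrow> f \<in> meas x \<Longrightarrow> f \<in> meas y"
  by (auto simp: measurable_def sets_sub_field space_measure_of_conv)

lemma meas_measurable: "x \<in> sub_fields M \<Longrightarrow> f \<in> meas x \<Longrightarrow> f \<in> borel_measurable M"
  using measurable_from_subalg[OF sub_field_subalgebra] by blast

lemma meas_indicator: "x \<in> sub_fields M \<Longrightarrow> A \<in> x \<Longrightarrow> indicator A \<in> meas x"
  by (rule borel_measurable_indicator) (simp add: sets_sub_field)

lemma E_meas: "E x f \<in> meas x"
  unfolding cond_exp_on_def by (rule borel_measurable_cond_exp)

lemma E_L2:
  assumes x: "x \<in> sub_fields M" and f: "f \<in> L2"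
  shows "E x f \<in> L2"
proof -
  interpret S: sigma_finite_subalgebra M "sigma (space M) x" by (rule sub_field_sfs[OF x])
  have "integrable M (\<lambda>\<omega>. (E x f \<omega>)\<^sup>2)"
    unfolding cond_exp_on_def
    by (rule S.integrable_convex_cond_exp[where I=UNIV and q="\<lambda>t. t\<^sup>2"])
       (use f in \<open>auto simp: L2_integrable L2_square convex_power2\<close>)
  then show ?thesis
    using meas_measurable[OF x E_meas] by (simp add: L2_functions_def)
qed

lemma ip_E_meas:
  assumes "x \<in> sub_fields M" "f \<in> L2" "g \<in> L2" "g \<in> meas x"
  shows "ip (E x f) g = ip f g"
proof -
  interpret S: sigma_finite_subalgebra M "sigma (space M) x" by (rule sub_field_sfs[OF assms(1)])
  show ?thesis
    using S.real_cond_exp_intg(2)[OF L2_mult_integrable[OF assms(3,2)]] assms(2,4)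
    by (simp add: ip_def cond_exp_on_def mult.commute L2_measurable)
qed

lemma E_self_adjoint:
  assumes "x \<in> sub_fields M" "f \<in> L2" "g \<in> L2"
  shows "ip (E x f) g = ip f (E x g)"
proof -
  have "ip f (E x g) = ip (E x f) (E x g)"
    using assms by (simp add: ip_E_meas E_meas E_L2)
  also have "\<dots> = ip (E x g) (E x f)" by (rule ip_commute)
  also have "\<dots> = ip g (E x f)"
    using assms by (simp add: ip_E_meas E_meas E_L2)
  finally show ?thesis by (simp add: ip_commute)
qed

lemma ip_E_self: "x \<in> sub_fields M \<Longrightarrow> f \<in> L2 \<Longrightarrow> ip (E x f) f = sqn (E x f)"
  using ip_E_meas[of x f "E x f"] by (simp add: E_L2 E_meas ip_commute)

lemma E_eqI:
  assumes x: "x \<in> sub_fields M" and f: "f \<in> L2" and h: "h \<in> L2" "h \<in> meas x"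
    and eq: "\<And>A. A \<in> x \<Longrightarrow> ip f (indicator A) = ip h (indicator A)"
  shows "AE \<omega> in M. E x f \<omega> = h \<omega>"
proof -
  interpret S: sigma_finite_subalgebra M "sigma (space M) x" by (rule sub_field_sfs[OF x])
  show ?thesis
    unfolding cond_exp_on_def
    by (rule S.real_cond_exp_charact)
       (use eq f h in \<open>auto simp: sets_sub_field[OF x] L2_integrable ip_def set_lebesgue_integral_def mult.commute\<close>)
qed

lemma E_of_meas:
  assumes "x \<in> sub_fields M" "f \<in> L2" "f \<in> meas x"
  shows "AE \<omega> in M. E x f \<omega> = f \<omega>"
  by (rule E_eqI) (use assms in auto)

lemma E_cong:
  assumes "x \<in> sub_fields M" "f \<in> L2" "g \<in> L2" "AE \<omega> in M. f \<omega> = g \<omega>"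
  shows "AE \<omega> in M. E x f \<omega> = E x g \<omega>"
proof -
  interpret S: sigma_finite_subalgebra M "sigma (space M) x" by (rule sub_field_sfs[OF assms(1)])
  show ?thesis unfolding cond_exp_on_def
    by (rule S.real_cond_exp_cong) (use assms in \<open>auto simp: L2_measurable\<close>)
qed

lemma E_add:
  assumes "x \<in> sub_fields M" "f \<in> L2" "g \<in> L2"
  shows "AE \<omega> in M. E x (\<lambda>\<omega>. f \<omega> + g \<omega>) \<omega> = E x f \<omega> + E x g \<omega>"
proof -
  interpret S: sigma_finite_subalgebra M "sigma (space M) x" by (rule sub_field_sfs[OF assms(1)])
  show ?thesis unfolding cond_exp_on_def
    by (rule S.real_cond_exp_add) (use assms in \<open>auto simp: L2_integrable\<close>)
qed

lemma E_diff:
  assumes "x \<in> sub_fields M" "f \<in> L2" "g \<in> L2"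
  shows "AE \<omega> in M. E x (\<lambda>\<omega>. f \<omega> - g \<omega>) \<omega> = E x f \<omega> - E x g \<omega>"
proof -
  interpret S: sigma_finite_subalgebra M "sigma (space M) x" by (rule sub_field_sfs[OF assms(1)])
  show ?thesis unfolding cond_exp_on_def
    by (rule S.real_cond_exp_diff) (use assms in \<open>auto simp: L2_integrable\<close>)
qed

lemma E_scale:
  assumes "x \<in> sub_fields M" "f \<in> L2"
  shows "AE \<omega> in M. E x (\<lambda>\<omega>. c * f \<omega>) \<omega> = c * E x f \<omega>"
proof -
  interpret S: sigma_finite_subalgebra M "sigma (space M) x" by (rule sub_field_sfs[OF assms(1)])
  show ?thesis unfolding cond_exp_on_def
    by (rule S.real_cond_exp_cmult) (use assms in \<open>auto simp: L2_integrable\<close>)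
qed

lemma E_sum:
  assumes x: "x \<in> sub_fields M" and "\<And>i. i \<in> I \<Longrightarrow> f i \<in> L2"
  shows "AE \<omega> in M. E x (\<lambda>\<omega>. \<Sum>i\<in>I. f i \<omega>) \<omega> = (\<Sum>i\<in>I. E x (f i) \<omega>)"
  using assms(2)
proof (induction I rule: infinite_finite_induct)
  case (insert i I)
  have "AE \<omega> in M. E x (\<lambda>\<omega>. f i \<omega> + (\<Sum>i\<in>I. f i \<omega>)) \<omega> = E x (f i) \<omega> + E x (\<lambda>\<omega>. \<Sum>i\<in>I. f i \<omega>) \<omega>"
    by (rule E_add[OF x]) (use insert in \<open>auto intro: L2_sum\<close>)
  moreover have "AE \<omega> in M. E x (\<lambda>\<omega>. \<Sum>i\<in>I. f i \<omega>) \<omega> = (\<Sum>i\<in>I. E x (f i) \<omega>)"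
    using insert by auto
  ultimately show ?case
    by eventually_elim (use insert in simp)
qed (auto intro!: E_of_meas[OF x L2_const, of 0, simplified])

lemma E_tower:
  assumes "x \<in> sub_fields M" "y \<in> sub_fields M" "x \<subseteq> y" "f \<in> L2"
  shows "AE \<omega> in M. E x (E y f) \<omega> = E x f \<omega>"
proof (rule E_eqI)
  fix A assume "A \<in> x"
  moreover have "A \<in> y" "A \<in> sets M"
    using calculation assms sub_field_subset by blast+
  ultimately show "ip (E y f) (indicator A) = ip (E x f) (indicator A)"
    using assms by (simp add: ip_E_meas L2_indicator meas_indicator)
qed (use assms in \<open>auto simp: E_L2 E_meas\<close>)

lemma E_of_coarser:
  assumes "x \<in> sub_fields M" "y \<in> sub_fields M" "x \<subseteq> y" "f \<in> L2"
  shows "AE \<omega> in M. E y (E x f) \<omega> = E x f \<omega>"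
  by (rule E_of_meas) (use assms in \<open>auto simp: E_L2 intro: meas_mono[OF _ _ _ E_meas]\<close>)

lemma E_residual_orthogonal:
  assumes "x \<in> sub_fields M" "f \<in> L2" "g \<in> L2" "g \<in> meas x"
  shows "ip (\<lambda>\<omega>. f \<omega> - E x f \<omega>) g = 0"
  using assms by (simp add: ip_diff_left E_L2 ip_E_meas)

lemma sqn_residual:
  assumes "x \<in> sub_fields M" "f \<in> L2"
  shows "sqn (\<lambda>\<omega>. f \<omega> - E x f \<omega>) = sqn f - sqn (E x f)"
  using ip_E_self[OF assms] assms by (simp add: sqn_diff E_L2 ip_commute[of f "E x f"])

lemma sqn_E_le: "x \<in> sub_fields M \<Longrightarrow> f \<in> L2 \<Longrightarrow> sqn (E x f) \<le> sqn f"
  using sqn_nonneg[of "\<lambda>\<omega>. f \<omega> - E x f \<omega>"] by (simp add: sqn_residual)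

text \<open>Conditional expectation is the nearest point projection, so any measurable candidate bounds
  the distance from above.\<close>

lemma sqn_residual_minimal:
  assumes x: "x \<in> sub_fields M" and f: "f \<in> L2" and h: "h \<in> L2" "h \<in> meas x"
  shows "sqn (\<lambda>\<omega>. f \<omega> - E x f \<omega>) \<le> sqn (\<lambda>\<omega>. f \<omega> - h \<omega>)"
proof -
  have "ip (\<lambda>\<omega>. f \<omega> - E x f \<omega>) (\<lambda>\<omega>. E x f \<omega> - h \<omega>) = 0"
    by (rule E_residual_orthogonal) (use x f h in \<open>auto intro!: borel_measurable_diff simp: E_meas L2_intros E_L2\<close>)
  then have "sqn (\<lambda>\<omega>. (f \<omega> - E x f \<omega>) + (E x f \<omega> - h \<omega>)) =
     sqn (\<lambda>\<omega>. f \<omega> - E x f \<omega>) + sqn (\<lambda>\<omega>. E x f \<omega> - h \<omega>)"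
    using x f h by (subst sqn_add) (auto simp: L2_intros E_L2)
  then show ?thesis
    using sqn_nonneg[of "\<lambda>\<omega>. E x f \<omega> - h \<omega>"] by simp
qed

lemma sqn_residual_antimono:
  assumes "x \<in> sub_fields M" "y \<in> sub_fields M" "x \<subseteq> y" "f \<in> L2"
  shows "sqn (\<lambda>\<omega>. f \<omega> - E y f \<omega>) \<le> sqn (\<lambda>\<omega>. f \<omega> - E x f \<omega>)"
  by (rule sqn_residual_minimal) (use assms in \<open>auto simp: E_L2 intro: meas_mono[OF _ _ _ E_meas]\<close>)

lemma sqn_E_mono:
  assumes "x \<in> sub_fields M" "y \<in> sub_fields M" "x \<subseteq> y" "f \<in> L2"
  shows "sqn (E x f) \<le> sqn (E y f)"
  using sqn_residual_antimono[OF assms] assms by (simp add: sqn_residual)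

lemma sets_sub_fields: "sets M \<in> sub_fields M"
  by (auto simp: sub_fields_def sets.sigma_algebra_axioms intro: null_setsD2)

lemma E_top: "f \<in> L2 \<Longrightarrow> AE \<omega> in M. E (sets M) f \<omega> = f \<omega>"
  by (rule E_of_meas[OF sets_sub_fields]) (auto simp: L2_measurable sets_sub_field[OF sets_sub_fields]
      cong: measurable_cong_sets)

lemma sqn_E_diff_le: 
  assumes "x \<in> sub_fields M" "f \<in> L2" "g \<in> L2" 
  shows "sqn (\<lambda>\<omega>. E x f \<omega> - E x g \<omega>) \<le> sqn (\<lambda>\<omega>. f \<omega> - g \<omega>)"
proof -
  have "sqn (\<lambda>\<omega>. E x f \<omega> - E x g \<omega>) = sqn (E x (\<lambda>\<omega>. f \<omega> - g \<omega>))"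
    by (rule ip_cong_AE) (use E_diff[OF assms] assms in \<open>auto simp: L2_intros E_L2\<close>)
  then show ?thesis using sqn_E_le assms by (simp add: L2_diff)
qed

section \<open>Generated sub-\<open>\<sigma>\<close>-fields and independence\<close>

text \<open>The \<open>\<pi>\<close>-\<open>\<lambda>\<close> theorem for the signed measures with densities \<open>u\<close> and \<open>v\<close>.\<close>

lemma ip_eq_on_generated:
  assumes G: "Int_stable G" "G \<subseteq> sets M" "space M \<in> G"
    and uv: "u \<in> L2" "v \<in> L2" and eq: "\<And>A. A \<in> G \<Longrightarrow> ip u (indicator A) = ip v (indicator A)"
    and A: "A \<in> sigma_sets (space M) G"
  shows "ip u (indicator A) = ip v (indicator A)"
proof -
  have GP: "G \<subseteq> Pow (space M)" using G(2) sets.space_closed by blast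
  have sub: "sigma_sets (space M) G \<subseteq> sets M" using G(2) by (rule sets.sigma_sets_subset)
  show ?thesis
    using G(1) GP A
  proof (induction A rule: sigma_sets_induct_disjoint)
    case (compl A)
    have *: "ip w (indicator (space M - A)) = ip w (indicator (space M)) - ip w (indicator A)" if "w \<in> L2" for w
    proof -
      have "ip w (indicator (space M - A)) = ip w (\<lambda>\<omega>. indicator (space M) \<omega> - indicator A \<omega>)"
        unfolding ip_def by (rule Bochner_Integration.integral_cong) (auto simp: indicator_def)
      then show ?thesis using that compl sub by (auto simp: ip_diff_right L2_indicator)
    qed
    show ?case using *[OF uv(1)] *[OF uv(2)] compl eq[OF G(3)] by simp
  next
    case (union A)
    have *: "ip w (indicator (\<Union>i. A i)) = (\<Sum>i. ip w (indicator (A i)))" if w: "w \<in> L2" for w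
    proof -
      have Am: "range A \<subseteq> sets M" using union sub by blast
      have "set_lebesgue_integral M (\<Union>i. A i) w = (\<Sum>i. set_lebesgue_integral M (A i) w)"
      proof (rule lebesgue_integral_countable_add)
        show "set_integrable M (\<Union>i. A i) w"
          using Am L2_integrable[OF w] unfolding set_integrable_def
          by (intro integrable_mult_indicator sets.countable_UN) auto
      qed (use Am union(1) in \<open>auto simp: disjoint_family_on_def\<close>)
      then show ?thesis by (simp add: ip_def set_lebesgue_integral_def mult.commute)
    qed
    show ?case
      using *[OF uv(1)] *[OF uv(2)] union by simp
  qed (use eq in \<open>auto simp: ip_def\<close>)
qed

lemma join_sub_fields: "x \<in> sub_fields M \<Longrightarrow> y \<in> sub_fields M \<Longrightarrow> field_join M x y \<in> sub_fields M"
  unfolding field_join_def by (rule gen_field_in_sub_fields) (auto simp: sub_fields_def)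

lemma join_upper1: "x \<subseteq> field_join M x y" and join_upper2: "y \<subseteq> field_join M x y"
  unfolding field_join_def using gen_field_superset[of "x \<union> y" M] by auto

lemma join_least: "z \<in> sub_fields M \<Longrightarrow> x \<subseteq> z \<Longrightarrow> y \<subseteq> z \<Longrightarrow> field_join M x y \<subseteq> z"
  unfolding field_join_def by (rule gen_field_least) auto

lemma join_commute: "field_join M x y = field_join M y x"
  by (simp add: field_join_def Un_commute)

lemma ip_eq_on_join:
  assumes xy: "x \<in> sub_fields M" "y \<in> sub_fields M"
    and uv: "u \<in> L2" "v \<in> L2"
    and eq: "\<And>p q. p \<in> x \<Longrightarrow> q \<in> y \<Longrightarrow> ip u (indicator (p \<inter> q)) = ip v (indicator (p \<inter> q))"
    and A: "A \<in> field_join M x y"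
  shows "ip u (indicator A) = ip v (indicator A)"
proof -
  define G where "G = (\<lambda>(p, q). p \<inter> q) ` (x \<times> y)"
  have pq: "p \<inter> q \<in> G" if "p \<in> x" "q \<in> y" for p q
    using that by (auto simp: G_def)
  have GM: "G \<subseteq> sets M"
    using xy sub_field_subset by (auto simp: G_def intro!: sets.Int)
  have stable: "Int_stable G"
  proof (rule Int_stableI)
    fix a b assume "a \<in> G" "b \<in> G"
    then obtain p q p' q' where "a = p \<inter> q" "b = p' \<inter> q'" "p \<in> x" "p' \<in> x" "q \<in> y" "q' \<in> y"
      by (auto simp: G_def)
    then have "a \<inter> b = (p \<inter> p') \<inter> (q \<inter> q')" "p \<inter> p' \<in> x" "q \<inter> q' \<in> y"
      using xy by (auto simp: sub_field_Int)
    then show "a \<inter> b \<in> G" using pq by auto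
  qed
  have top: "space M \<in> G"
    using pq[OF sub_field_space sub_field_space] xy by simp
  have AG: "A \<in> sigma_sets (space M) G"
  proof -
    have "x \<union> y \<union> null_sets M \<subseteq> G"
    proof -
      have "p \<in> G" if "p \<in> x" for p
        using pq[OF that sub_field_space[OF xy(2)]] sub_field_subset[OF xy(1)] that sets.sets_into_space
        by (metis in_mono inf.absorb1)
      moreover have "q \<in> G" if "q \<in> y" for q
        using pq[OF sub_field_space[OF xy(1)] that] sub_field_subset[OF xy(2)] that sets.sets_into_space
        by (metis in_mono inf.absorb2)
      ultimately show ?thesis using sub_field_null[OF xy(1)] by blast
    qed
    then show ?thesis
      using A sigma_sets_mono'[of "x \<union> y \<union> null_sets M" G] by (auto simp: field_join_def gen_field_def)
  qed
  have eqG: "ip u (indicator A) = ip v (indicator A)" if "A \<in> G" for A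
    using that eq by (auto simp: G_def)
  show ?thesis
    by (rule ip_eq_on_generated[OF stable GM top uv eqG AG])
qed

lemma ip_indep:
  assumes xy: "x \<in> sub_fields M" "y \<in> sub_fields M" and ind: "indep_set x y"
    and p: "p \<in> x" and h: "h \<in> L2" "h \<in> meas y"
  shows "ip (indicator p) h = prob p * expectation h"
proof -
  have pM: "p \<in> sets M" using p xy sub_field_subset by blast
  have "AE \<omega> in M. E y (indicator p) \<omega> = prob p"
  proof (rule E_eqI)
    fix q assume q: "q \<in> y"
    then have "q \<in> sets M" using xy sub_field_subset by blast
    then show "ip (indicator p) (indicator q) = ip (\<lambda>_. prob p) (indicator q)"
      using indep_setD[OF ind p q] pM by (simp add: ip_indicator) (simp add: ip_def)
  qed (use xy pM in \<open>auto simp: L2_intros\<close>)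
  then have "ip (E y (indicator p)) h = ip (\<lambda>_. prob p) h"
    by (intro ip_cong_AE) (use xy pM h in \<open>auto simp: L2_intros E_L2\<close>)
  then show ?thesis
    using xy pM h by (simp add: ip_E_meas L2_indicator) (simp add: ip_def)
qed

text \<open>For \<open>q\<close> independent of \<open>a\<close>, knowing \<open>a\<close> in addition to \<open>C\<close> gives no information.  It suffices to
  integrate over the rectangles \<open>p \<inter> r\<close> with \<open>p \<in> a\<close> and \<open>r \<in> C\<close>, where \<open>p\<close> splits off as a factor.\<close>

lemma E_join_indep:
  assumes a: "a \<in> sub_fields M" and c: "c \<in> sub_fields M" and C: "C \<in> sub_fields M" "C \<subseteq> c"
    and ind: "indep_set a c" and q: "q \<in> c"
  shows "AE \<omega> in M. E (field_join M a C) (indicator q) \<omega> = E C (indicator q) \<omega>"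
proof (rule E_eqI)
  have qM: "q \<in> sets M" using q c sub_field_subset by blast
  show "field_join M a C \<in> sub_fields M" using a C join_sub_fields by blast
  then show "E C (indicator q) \<in> meas (field_join M a C)"
    using meas_mono[OF C(1) _ join_upper2 E_meas] by blast
  show L: "E C (indicator q) \<in> L2" "indicator q \<in> L2" using C qM by (auto simp: E_L2 L2_indicator)
  fix A assume A: "A \<in> field_join M a C"
  show "ip (indicator q) (indicator A) = ip (E C (indicator q)) (indicator A)"
    using a C(1) L(2,1) _ A
  proof (rule ip_eq_on_join)
    fix p r assume pr: "p \<in> a" "r \<in> C"
    have rM: "r \<in> sets M" using pr C sub_field_subset by blast
    have *: "ip h (indicator (p \<inter> r)) = prob p * ip h (indicator r)" if h: "h \<in> L2" "h \<in> meas c" for h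
    proof -
      have "ip h (indicator (p \<inter> r)) = ip (indicator p) (\<lambda>\<omega>. indicator r \<omega> * h \<omega>)"
        by (simp add: ip_def indicator_inter_arith mult_ac)
      also have "\<dots> = prob p * expectation (\<lambda>\<omega>. indicator r \<omega> * h \<omega>)"
        by (rule ip_indep[OF a c ind pr(1)])
           (use h rM pr C c in \<open>auto intro!: L2_restrict borel_measurable_times meas_indicator\<close>)
      also have "expectation (\<lambda>\<omega>. indicator r \<omega> * h \<omega>) = ip h (indicator r)"
        by (simp add: ip_def mult.commute)
      finally show ?thesis .
    qed
    have "ip (E C (indicator q)) (indicator r) = ip (indicator q) (indicator r)"
      by (rule ip_E_meas) (use C pr L rM in \<open>auto simp: L2_indicator meas_indicator\<close>)
    then show "ip (indicator q) (indicator (p \<inter> r)) = ip (E C (indicator q)) (indicator (p \<inter> r))"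
      using *[OF L(2) meas_indicator[OF c q]] *[OF L(1) meas_mono[OF C(1) c C(2) E_meas]] by simp
  qed
qed

lemma E_mult:
  assumes x: "x \<in> sub_fields M" and f: "f \<in> meas x" and g: "g \<in> L2"
    and fg: "integrable M (\<lambda>\<omega>. f \<omega> * g \<omega>)"
  shows "AE \<omega> in M. E x (\<lambda>\<omega>. f \<omega> * g \<omega>) \<omega> = f \<omega> * E x g \<omega>"
proof -
  interpret S: sigma_finite_subalgebra M "sigma (space M) x" by (rule sub_field_sfs[OF x])
  show ?thesis unfolding cond_exp_on_def
    by (rule S.real_cond_exp_mult) (use assms in \<open>auto simp: L2_measurable\<close>)
qed

lemma E_join_indep_mult:
  assumes a: "a \<in> sub_fields M" and c: "c \<in> sub_fields M" and C: "C \<in> sub_fields M" "C \<subseteq> c"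
    and ind: "indep_set a c" and p: "p \<in> a" and q: "q \<in> c"
  shows "AE \<omega> in M. E (field_join M a C) (indicator (p \<inter> q)) \<omega> = indicator p \<omega> * E C (indicator q) \<omega>"
proof -
  have M: "p \<in> sets M" "q \<in> sets M" using p q a c sub_field_subset by blast+
  have J: "field_join M a C \<in> sub_fields M" using a C join_sub_fields by blast
  have "AE \<omega> in M. E (field_join M a C) (\<lambda>\<omega>. indicator p \<omega> * indicator q \<omega>) \<omega> =
    indicator p \<omega> * E (field_join M a C) (indicator q) \<omega>"
    by (rule E_mult[OF J]) (use J p M join_upper1 in
      \<open>auto simp: L2_indicator intro!: meas_indicator L2_mult_integrable\<close>)
  then show ?thesis
    using E_join_indep[OF a c C ind q]
    unfolding indicator_inter_arith[abs_def] by eventually_elim simp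
qed

lemma indep_set_commute: "indep_set x y \<Longrightarrow> indep_set y x"
  unfolding indep_sets2_eq by (metis Int_commute mult.commute)

text \<open>Together with \<open>ip_eq_on_join\<close>, this reduces identities between conditional expectations to
  rectangles \<open>p \<inter> q\<close>.\<close>

lemma L2_eq_AE:
  assumes "f \<in> L2" "g \<in> L2" "\<And>D. D \<in> sets M \<Longrightarrow> ip f (indicator D) = ip g (indicator D)"
  shows "AE \<omega> in M. f \<omega> = g \<omega>"
proof -
  have "AE \<omega> in M. E (sets M) f \<omega> = g \<omega>"
    by (rule E_eqI[OF sets_sub_fields])
      (use assms in \<open>auto simp: L2_measurable sets_sub_field[OF sets_sub_fields] cong: measurable_cong_sets\<close>)
  then show ?thesis
    using E_top[OF assms(1)] by eventually_elim simp
qed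

text \<open>Over independent \<open>a\<close> and \<open>c\<close> that generate everything, \<open>L\<^sub>2\<close> is a tensor product and the
  operators are \<open>E\<^sub>A \<otimes> 1\<close>, \<open>1 \<otimes> E\<^sub>C\<close> and \<open>E\<^sub>A \<otimes> E\<^sub>C\<close>.  Instead of setting up the tensor product,
  the proof moves the operators to the indicator of a rectangle \<open>p \<inter> q\<close>, where both sides are
  \<open>E\<^sub>A 1\<^sub>p \<cdot> E\<^sub>C 1\<^sub>q\<close>.\<close>

lemma E_tensor:
  assumes a: "a \<in> sub_fields M" and c: "c \<in> sub_fields M" and ind: "indep_set a c"
    and ac: "field_join M a c = sets M"
    and A: "A \<in> sub_fields M" "A \<subseteq> a" and C: "C \<in> sub_fields M" "C \<subseteq> c" and f: "f \<in> L2"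
  shows "AE \<omega> in M. E (field_join M A c) (E (field_join M a C) f) \<omega> = E (field_join M A C) f \<omega>"
proof -
  have J: "field_join M A c \<in> sub_fields M" "field_join M a C \<in> sub_fields M" "field_join M A C \<in> sub_fields M"
    using a c A C by (auto intro: join_sub_fields)
  have AC_aC: "field_join M A C \<subseteq> field_join M a C"
    by (rule join_least[OF J(2) order.trans[OF A(2) join_upper1] join_upper2])
  have indCa: "indep_set C a"
    using ind C(2) A(2) unfolding indep_sets2_eq by (metis Int_commute mult.commute subset_iff)
  \<comment> \<open>The order of the two factors is reversed, because the operators are moved to the other side of the inner product.\<close>
  have key: "AE \<omega> in M. E (field_join M a C) (E (field_join M A c) (indicator (p \<inter> q))) \<omega>
      = E (field_join M A C) (indicator (p \<inter> q)) \<omega>" if p: "p \<in> a" and q: "q \<in> c" for p q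
  proof -
    have pq: "p \<in> sets M" "q \<in> sets M" using p q a c sub_field_subset by blast+
    have L: "indicator p \<in> L2" "indicator q \<in> L2" "indicator (p \<inter> q) \<in> L2"
      "E A (indicator p) \<in> L2" "E C (indicator q) \<in> L2"
      using pq A C by (auto simp: L2_indicator E_L2)
    have "AE \<omega> in M. E (field_join M A c) (indicator (p \<inter> q)) \<omega> = indicator q \<omega> * E A (indicator p) \<omega>"
      using E_join_indep_mult[OF c a A indep_set_commute[OF ind] q p] by (simp add: join_commute Int_commute)
    then have 1: "AE \<omega> in M. E (field_join M a C) (E (field_join M A c) (indicator (p \<inter> q))) \<omega> =
       E (field_join M a C) (\<lambda>\<omega>. indicator q \<omega> * E A (indicator p) \<omega>) \<omega>"
      by (intro E_cong) (use J L pq in \<open>auto simp: E_L2 L2_restrict\<close>)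
    have "E A (indicator p) \<in> meas (field_join M a C)"
      by (rule meas_mono[OF A(1) J(2) order.trans[OF A(2) join_upper1] E_meas])
    then have 2: "AE \<omega> in M. E (field_join M a C) (\<lambda>\<omega>. indicator q \<omega> * E A (indicator p) \<omega>) \<omega> =
       E A (indicator p) \<omega> * E (field_join M a C) (indicator q) \<omega>"
      using E_mult[OF J(2), of "E A (indicator p)" "indicator q"] L
      by (simp add: mult.commute L2_mult_integrable)
    have 3: "AE \<omega> in M. E (field_join M a C) (indicator q) \<omega> = E C (indicator q) \<omega>"
      by (rule E_join_indep[OF a c C ind q])
    have 4: "AE \<omega> in M. E (field_join M A C) (E (field_join M a C) (indicator (p \<inter> q))) \<omega>
       = E (field_join M A C) (indicator (p \<inter> q)) \<omega>"
      by (rule E_tower[OF J(3,2) AC_aC L(3)])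
    have "AE \<omega> in M. E (field_join M a C) (indicator (p \<inter> q)) \<omega> = indicator p \<omega> * E C (indicator q) \<omega>"
      by (rule E_join_indep_mult[OF a c C ind p q])
    then have 5: "AE \<omega> in M. E (field_join M A C) (E (field_join M a C) (indicator (p \<inter> q))) \<omega> =
       E (field_join M A C) (\<lambda>\<omega>. indicator p \<omega> * E C (indicator q) \<omega>) \<omega>"
      by (intro E_cong) (use J L pq in \<open>auto simp: E_L2 L2_restrict\<close>)
    have "E C (indicator q) \<in> meas (field_join M A C)"
      using meas_mono[OF C(1) J(3) join_upper2 E_meas] .
    then have 6: "AE \<omega> in M. E (field_join M A C) (\<lambda>\<omega>. indicator p \<omega> * E C (indicator q) \<omega>) \<omega> =
       E C (indicator q) \<omega> * E (field_join M A C) (indicator p) \<omega>"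
      using E_mult[OF J(3), of "E C (indicator q)" "indicator p"] L
      by (simp add: mult.commute L2_mult_integrable)
    have 7: "AE \<omega> in M. E (field_join M A C) (indicator p) \<omega> = E A (indicator p) \<omega>"
      using E_join_indep[OF C(1) a A indCa p] by (simp add: join_commute)
    show ?thesis
      using 1 2 3 4 5 6 7 by eventually_elim (simp add: mult.commute)
  qed
  define L R where "L = E (field_join M A c) (E (field_join M a C) f)" and "R = E (field_join M A C) f"
  have LR: "L \<in> L2" "R \<in> L2" using f J by (auto simp: L_def R_def E_L2)
  have pq: "ip L (indicator (p \<inter> q)) = ip R (indicator (p \<inter> q))" if p: "p \<in> a" and q: "q \<in> c" for p q
  proof -
    have s: "indicator (p \<inter> q) \<in> L2" using p q a c sub_field_subset by (auto intro!: L2_indicator)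
    have "ip L (indicator (p \<inter> q)) = ip f (E (field_join M a C) (E (field_join M A c) (indicator (p \<inter> q))))"
      using s f J by (simp add: L_def E_self_adjoint E_L2)
    also have "\<dots> = ip f (E (field_join M A C) (indicator (p \<inter> q)))"
      by (rule ip_cong_AE) (use s f J key[OF p q] in \<open>auto simp: E_L2\<close>)
    also have "\<dots> = ip R (indicator (p \<inter> q))"
      using s f J by (simp add: R_def E_self_adjoint)
    finally show ?thesis .
  qed
  have "AE \<omega> in M. L \<omega> = R \<omega>"
    by (rule L2_eq_AE[OF LR]) (rule ip_eq_on_join[OF a c LR pq], auto simp: ac)
  then show ?thesis by (simp add: L_def R_def)
qed

section \<open>Completeness of \<open>L\<^sub>2\<close>\<close>

text \<open>The Riesz--Fischer argument for a rapidly converging sequence: the increments are summable in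
  \<open>L\<^sub>1\<close>, hence almost everywhere, and Fatou's lemma carries the bound to the pointwise limit.\<close>

lemma L2_complete:
  assumes V: "\<And>n. V n \<in> L2"
    and cauchy: "\<And>n i j. n \<le> i \<Longrightarrow> n \<le> j \<Longrightarrow> sqn (\<lambda>\<omega>. V i \<omega> - V j \<omega>) \<le> (1/4) ^ n"
  obtains g where "g \<in> L2" "\<And>n. sqn (\<lambda>\<omega>. V n \<omega> - g \<omega>) \<le> (1/4) ^ n"
proof -
  define D where "D n \<omega> = \<bar>V (Suc n) \<omega> - V n \<omega>\<bar>" for n \<omega>
  have D_L2: "D n \<in> L2" for n
    using L2_diff[OF V V, of "Suc n" n] unfolding D_def L2_functions_def by auto
  have [measurable]: "V n \<in> borel_measurable M" "D n \<in> borel_measurable M" for n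
    using V D_L2 by (auto simp: L2_measurable)
  have intD: "(\<integral>\<omega>. D n \<omega> \<partial>M) \<le> (1/2) ^ n" for n
  proof -
    have "sqn (D n) \<le> (1/4) ^ n"
      using cauchy[of n "Suc n" n] by (simp add: ip_def D_def)
    then have "2 ^ n * sqn (D n) \<le> 2 ^ n * (1/4) ^ n"
      by (intro mult_left_mono) auto
    also have "\<dots> = (1/2) ^ n" by (simp flip: power_mult_distrib)
    finally have *: "2 ^ n * sqn (D n) \<le> (1/2) ^ n" .
    have "2 * \<bar>ip (D n) (\<lambda>_. 1)\<bar> \<le> 2 ^ n * sqn (D n) + sqn (\<lambda>_. 1) / 2 ^ n"
      by (rule ip_le) (auto simp: D_L2 L2_const)
    also have "sqn (\<lambda>_. 1) / 2 ^ n = (1/2) ^ n" by (simp add: ip_def prob_space power_one_over)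
    finally have "\<bar>ip (D n) (\<lambda>_. 1)\<bar> \<le> (1/2) ^ n" using * by linarith
    then show ?thesis by (simp add: ip_def)
  qed
  have "(\<integral>\<^sup>+\<omega>. (\<Sum>n. ennreal (D n \<omega>)) \<partial>M) = (\<Sum>n. \<integral>\<^sup>+\<omega>. ennreal (D n \<omega>) \<partial>M)"
    by (rule nn_integral_suminf) simp
  also have "\<dots> \<le> (\<Sum>n. ennreal ((1/2) ^ n))"
  proof (intro suminf_le allI)
    fix n
    have "(\<integral>\<^sup>+\<omega>. ennreal (D n \<omega>) \<partial>M) = ennreal (\<integral>\<omega>. D n \<omega> \<partial>M)"
      by (rule nn_integral_eq_integral[OF L2_integrable[OF D_L2]]) (simp add: D_def)
    then show "(\<integral>\<^sup>+\<omega>. ennreal (D n \<omega>) \<partial>M) \<le> ennreal ((1/2) ^ n)"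
      using intD by (simp add: ennreal_leI)
  qed auto
  also have "\<dots> = ennreal (\<Sum>n. (1/2) ^ n)"
    by (rule suminf_ennreal2) (auto intro!: summable_geometric)
  also have "\<dots> < \<infinity>" by simp
  finally have "AE \<omega> in M. (\<Sum>n. ennreal (D n \<omega>)) \<noteq> \<infinity>"
    by (intro nn_integral_noteq_infinite) auto
  then have conv: "AE \<omega> in M. convergent (\<lambda>n. V n \<omega>)"
  proof eventually_elim
    case (elim \<omega>)
    then have "summable (\<lambda>n. D n \<omega>)"
      by (intro summable_suminf_not_top) (auto simp: D_def)
    then have "summable (\<lambda>n. V (Suc n) \<omega> - V n \<omega>)"
      unfolding D_def by (rule summable_rabs_cancel)
    then have "convergent (\<lambda>n. \<Sum>k<n. V (Suc k) \<omega> - V k \<omega>)"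
      by (simp add: summable_iff_convergent)
    then have "convergent (\<lambda>n. V n \<omega> - V 0 \<omega>)"
      by (simp add: sum_lessThan_telescope[of "\<lambda>n. V n \<omega>"])
    then have "convergent (\<lambda>n. (V n \<omega> - V 0 \<omega>) + V 0 \<omega>)"
      by (rule convergent_add[OF _ convergent_const])
    then show ?case by simp
  qed
  define g where "g \<omega> = lim (\<lambda>n. V n \<omega>)" for \<omega>
  have [measurable]: "g \<in> borel_measurable M" unfolding g_def by measurable
  have Vg: "(\<lambda>\<omega>. V n \<omega> - g \<omega>) \<in> L2 \<and> sqn (\<lambda>\<omega>. V n \<omega> - g \<omega>) \<le> (1/4) ^ n" for n
  proof -
    have "(\<integral>\<^sup>+\<omega>. ennreal ((V n \<omega> - g \<omega>)\<^sup>2) \<partial>M) = (\<integral>\<^sup>+\<omega>. liminf (\<lambda>m. ennreal ((V n \<omega> - V m \<omega>)\<^sup>2)) \<partial>M)"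
    proof (rule nn_integral_cong_AE)
      show "AE \<omega> in M. ennreal ((V n \<omega> - g \<omega>)\<^sup>2) = liminf (\<lambda>m. ennreal ((V n \<omega> - V m \<omega>)\<^sup>2))"
        using conv
      proof eventually_elim
        case (elim \<omega>)
        then have "(\<lambda>m. V m \<omega>) \<longlonglongrightarrow> g \<omega>" by (simp add: g_def convergent_LIMSEQ_iff)
        then have "(\<lambda>m. ennreal ((V n \<omega> - V m \<omega>)\<^sup>2)) \<longlonglongrightarrow> ennreal ((V n \<omega> - g \<omega>)\<^sup>2)"
          by (intro tendsto_ennrealI tendsto_intros)
        then show ?case by (intro lim_imp_Liminf[symmetric]) simp_all
      qed
    qed
    also have "\<dots> \<le> liminf (\<lambda>m. \<integral>\<^sup>+\<omega>. ennreal ((V n \<omega> - V m \<omega>)\<^sup>2) \<partial>M)"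
      by (rule nn_integral_liminf) simp
    also have "\<dots> \<le> ennreal ((1/4) ^ n)"
    proof (rule Liminf_le)
      have "(\<integral>\<^sup>+\<omega>. ennreal ((V n \<omega> - V m \<omega>)\<^sup>2) \<partial>M) \<le> ennreal ((1/4) ^ n)" if "n \<le> m" for m
      proof -
        have "(\<integral>\<^sup>+\<omega>. ennreal ((V n \<omega> - V m \<omega>)\<^sup>2) \<partial>M) = ennreal (\<integral>\<omega>. (V n \<omega> - V m \<omega>)\<^sup>2 \<partial>M)"
          by (rule nn_integral_eq_integral[OF L2_square[OF L2_diff[OF V V]]]) simp
        then show ?thesis
          using cauchy[of n n m] that by (simp add: ip_def power2_eq_square ennreal_leI)
      qed
      then show "eventually (\<lambda>m. (\<integral>\<^sup>+\<omega>. ennreal ((V n \<omega> - V m \<omega>)\<^sup>2) \<partial>M) \<le> ennreal ((1/4) ^ n)) sequentially"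
        unfolding eventually_sequentially by blast
    qed auto
    finally have *: "(\<integral>\<^sup>+\<omega>. ennreal ((V n \<omega> - g \<omega>)\<^sup>2) \<partial>M) \<le> ennreal ((1/4) ^ n)" .
    then have int: "integrable M (\<lambda>\<omega>. (V n \<omega> - g \<omega>)\<^sup>2)"
      by (intro integrableI_nonneg) (auto simp: top.extremum_strict less_top intro: le_less_trans)
    have "ennreal (\<integral>\<omega>. (V n \<omega> - g \<omega>)\<^sup>2 \<partial>M) \<le> ennreal ((1/4) ^ n)"
      using * nn_integral_eq_integral[OF int] by simp
    then have "sqn (\<lambda>\<omega>. V n \<omega> - g \<omega>) \<le> (1/4) ^ n"
      by (subst (asm) ennreal_le_iff) (simp_all add: ip_def power2_eq_square)
    then show ?thesis using int by (auto simp: L2_functions_def)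
  qed
  have "g \<in> L2" using L2_diff[OF V[of 0], of "\<lambda>\<omega>. V 0 \<omega> - g \<omega>"] Vg[of 0] by simp
  then show ?thesis using Vg that by blast
qed

text \<open>For a monotone family of commuting projections or contractions \<open>V\<close>, the squared distance of two values
  is bounded by the decrease of a quadratic form \<open>\<rho>\<close>.  An index sequence along which \<open>\<rho>\<close> comes within
  \<open>4\<^sup>-\<^sup>n\<close> of its infimum converges rapidly, and whatever lies beyond its \<open>n\<close>-th index is
  comparably close to the limit.\<close>

lemma L2_net_limit:
  fixes P :: "'i \<Rightarrow> bool" and le :: "'i \<Rightarrow> 'i \<Rightarrow> bool" and \<rho> :: "'i \<Rightarrow> real"
  assumes ex: "\<exists>i. P i"
    and refl: "\<And>i. P i \<Longrightarrow> le i i"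
    and trans: "\<And>i j k. P i \<Longrightarrow> P j \<Longrightarrow> P k \<Longrightarrow> le i j \<Longrightarrow> le j k \<Longrightarrow> le i k"
    and directed: "\<And>i j. P i \<Longrightarrow> P j \<Longrightarrow> \<exists>k. P k \<and> le i k \<and> le j k"
    and V: "\<And>i. P i \<Longrightarrow> V i \<in> L2"
    and bounded: "\<And>i. P i \<Longrightarrow> L \<le> \<rho> i"
    and cauchy: "\<And>i j. P i \<Longrightarrow> P j \<Longrightarrow> le i j \<Longrightarrow> sqn (\<lambda>\<omega>. V i \<omega> - V j \<omega>) \<le> \<rho> i - \<rho> j"
  obtains g where "g \<in> L2"
    and "\<And>\<delta>. \<delta> > 0 \<Longrightarrow> \<exists>i. P i \<and> (\<forall>j. P j \<longrightarrow> le i j \<longrightarrow> sqn (\<lambda>\<omega>. V j \<omega> - g \<omega>) \<le> \<delta>)"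
proof -
  define t where "t = Inf (\<rho> ` Collect P)"
  have bb: "bdd_below (\<rho> ` Collect P)" using bounded by (auto intro!: bdd_belowI[of _ L])
  have t_le: "t \<le> \<rho> i" if "P i" for i
    unfolding t_def using bb that by (auto intro: cInf_lower)
  have mono: "\<rho> j \<le> \<rho> i" if "P i" "P j" "le i j" for i j
    using cauchy[OF that] sqn_nonneg[of "\<lambda>\<omega>. V i \<omega> - V j \<omega>"] by simp
  have ex': "\<exists>i. P i \<and> \<rho> i < t + (1/4) ^ n" for n
  proof -
    have "Inf (\<rho> ` Collect P) < t + (1/4) ^ n" by (simp add: t_def)
    then show ?thesis using ex bb by (subst (asm) cInf_less_iff) auto
  qed
  have "\<exists>I. \<forall>n. (P (I n) \<and> \<rho> (I n) < t + (1/4) ^ n) \<and> le (I n) (I (Suc n))"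
  proof (rule dependent_nat_choice)
    show "\<exists>i. P i \<and> \<rho> i < t + (1/4) ^ 0" by (rule ex')
    fix i n assume i: "P i \<and> \<rho> i < t + (1/4) ^ n"
    obtain j where j: "P j" "\<rho> j < t + (1/4) ^ Suc n" using ex' by blast
    obtain k where "P k" "le i k" "le j k" using directed i j by blast
    then show "\<exists>k. (P k \<and> \<rho> k < t + (1/4) ^ Suc n) \<and> le i k" using mono[of j k] j by fastforce
  qed
  then obtain I where I: "\<And>n. P (I n)" "\<And>n. \<rho> (I n) < t + (1/4) ^ n" "\<And>n. le (I n) (I (Suc n))"
    by blast
  have le_I: "le (I m) (I n)" if "m \<le> n" for m n
    using that
  proof (induction n rule: dec_induct)
    case base then show ?case using refl I by blast
  next
    case (step n) then show ?case using trans I by blast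
  qed
  have near: "sqn (\<lambda>\<omega>. V (I n) \<omega> - V j \<omega>) \<le> (1/4) ^ n" if "P j" "le (I n) j" for n j
    using cauchy[OF I(1) that] I(2)[of n] t_le[OF that(1)] by simp
  have pow: "(1/4::real) ^ m \<le> (1/4) ^ n" if "n \<le> m" for m n :: nat
    using that by (intro power_decreasing) auto
  have "sqn (\<lambda>\<omega>. V (I i) \<omega> - V (I j) \<omega>) \<le> (1/4) ^ n" if "n \<le> i" "n \<le> j" for n i j
  proof (cases "i \<le> j")
    case True
    show ?thesis by (rule order.trans[OF near[OF I(1) le_I[OF True]] pow[OF that(1)]])
  next
    case False
    then have "j \<le> i" by simp
    then show ?thesis
      using order.trans[OF near[OF I(1) le_I[OF \<open>j \<le> i\<close>]] pow[OF that(2)]] sqn_diff_commute[of "V (I i)" "V (I j)"]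
      by simp
  qed
  then obtain g where g: "g \<in> L2" "\<And>n. sqn (\<lambda>\<omega>. V (I n) \<omega> - g \<omega>) \<le> (1/4) ^ n"
    using L2_complete[of "\<lambda>n. V (I n)"] V I(1) by blast
  show ?thesis
  proof (rule that[OF g(1)])
    fix \<delta> :: real assume "\<delta> > 0"
    then obtain n where n: "(1/4) ^ n < \<delta> / 4" using real_arch_pow_inv[of "\<delta>/4" "1/4"] by auto
    have "sqn (\<lambda>\<omega>. V j \<omega> - g \<omega>) \<le> \<delta>" if j: "P j" "le (I n) j" for j
      using sqn_triangle[OF V[OF j(1)] V[OF I(1)[of n]] g(1)] near[OF j] g(2)[of n] n
        sqn_diff_commute[of "V j" "V (I n)"] by simp
    then show "\<exists>i. P i \<and> (\<forall>j. P j \<longrightarrow> le i j \<longrightarrow> sqn (\<lambda>\<omega>. V j \<omega> - g \<omega>) \<le> \<delta>)"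
      using I(1) by blast
  qed
qed

end

section \<open>The complete Boolean algebra\<close>

locale complete_noise = prob_space M for M :: "'a measure" +
  fixes B :: "'a set set set"
  assumes noise: "noise_type_boolean_algebra M B"
    and complete: "complete_in_sub_fields M B"
begin

abbreviation bot :: "'a set set" where "bot \<equiv> field_bot M"
abbreviation join :: "'a set set \<Rightarrow> 'a set set \<Rightarrow> 'a set set" (infixl "\<squnion>\<^sub>M" 65)
  where "x \<squnion>\<^sub>M y \<equiv> field_join M x y"
abbreviation Join :: "'a set set set \<Rightarrow> 'a set set" where "Join D \<equiv> field_Sup M D"

definition cmp :: "'a set set \<Rightarrow> 'a set set" where
  "cmp x = (SOME x'. field_compl M B x x')"

lemma B_sub: "x \<in> B \<Longrightarrow> x \<in> sub_fields M"
  using noise by (auto simp: noise_type_boolean_algebra_def)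

lemma Int_B: "x \<in> B \<Longrightarrow> y \<in> B \<Longrightarrow> x \<inter> y \<in> B"
  and join_B: "x \<in> B \<Longrightarrow> y \<in> B \<Longrightarrow> x \<squnion>\<^sub>M y \<in> B"
  and bot_B: "bot \<in> B" and top_B: "sets M \<in> B"
  and distrib: "x \<in> B \<Longrightarrow> y \<in> B \<Longrightarrow> z \<in> B \<Longrightarrow> x \<inter> (y \<squnion>\<^sub>M z) = (x \<inter> y) \<squnion>\<^sub>M (x \<inter> z)"
  using noise by (auto simp: noise_type_boolean_algebra_def field_top_def)

lemma cmp_compl: "x \<in> B \<Longrightarrow> field_compl M B x (cmp x)"
  using noise unfolding cmp_def noise_type_boolean_algebra_def by (metis someI_ex)

lemma cmp_B: "x \<in> B \<Longrightarrow> cmp x \<in> B"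
  and Int_cmp: "x \<in> B \<Longrightarrow> x \<inter> cmp x = bot"
  and join_cmp: "x \<in> B \<Longrightarrow> x \<squnion>\<^sub>M cmp x = sets M"
  using cmp_compl by (auto simp: field_compl_def field_top_def)

lemma cmp_indep: "x \<in> B \<Longrightarrow> indep_set x (cmp x)"
proof -
  assume x: "x \<in> B"
  have "\<forall>x\<in>B. \<forall>x'. field_compl M B x x' \<longrightarrow> indep_set x x'"
    using noise by (simp add: noise_type_boolean_algebra_def)
  then show "indep_set x (cmp x)" using x cmp_compl[OF x] by blast
qed

lemma cmp_unique: "x \<in> B \<Longrightarrow> field_compl M B x x' \<Longrightarrow> x' = cmp x"
  using field_compl_unique[OF noise _ _ cmp_compl] by blast

lemma bot_least: "x \<in> sub_fields M \<Longrightarrow> bot \<subseteq> x"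
proof -
  assume x: "x \<in> sub_fields M"
  then interpret sigma_algebra "space M" x by (rule sub_field_sigma_algebra)
  show ?thesis using sub_field_null[OF x] by (auto simp: field_bot_def)
qed

lemma bot_le: "x \<in> B \<Longrightarrow> bot \<subseteq> x"
  using bot_least B_sub by blast

lemma top_ge: "x \<in> B \<Longrightarrow> x \<subseteq> sets M"
  using B_sub sub_field_subset by blast

lemma join_absorb: "y \<in> sub_fields M \<Longrightarrow> x \<subseteq> y \<Longrightarrow> x \<squnion>\<^sub>M y = y"
  by (rule antisym[OF join_least join_upper2]) auto

lemma join_absorb': "y \<in> sub_fields M \<Longrightarrow> x \<subseteq> y \<Longrightarrow> y \<squnion>\<^sub>M x = y"
  using join_absorb join_commute by metis

lemma join_mono: "y \<in> sub_fields M \<Longrightarrow> y' \<in> sub_fields M \<Longrightarrow> x \<subseteq> y \<Longrightarrow> x' \<subseteq> y' \<Longrightarrow> x \<squnion>\<^sub>M x' \<subseteq> y \<squnion>\<^sub>M y'"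
  by (meson join_least join_sub_fields join_upper1 join_upper2 order.trans)

lemma le_cmp_iff: "x \<in> B \<Longrightarrow> y \<in> B \<Longrightarrow> y \<subseteq> cmp x \<longleftrightarrow> y \<inter> x = bot"
proof
  assume xy: "x \<in> B" "y \<in> B" and le: "y \<subseteq> cmp x"
  then have "y \<inter> x \<subseteq> bot" using Int_cmp by blast
  then show "y \<inter> x = bot" using bot_le[OF Int_B[OF xy(2,1)]] by blast
next
  assume xy: "x \<in> B" "y \<in> B" and dis: "y \<inter> x = bot"
  have "y = y \<inter> (x \<squnion>\<^sub>M cmp x)" using top_ge[OF xy(2)] join_cmp[OF xy(1)] by auto
  also have "\<dots> = y \<inter> cmp x"
    using xy distrib[OF xy(2,1) cmp_B[OF xy(1)]] dis
    by (simp add: join_absorb B_sub Int_B cmp_B bot_le)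
  finally show "y \<subseteq> cmp x" by blast
qed

lemma cmp_cmp: "x \<in> B \<Longrightarrow> cmp (cmp x) = x"
  by (rule cmp_unique[symmetric, OF cmp_B])
     (auto simp: field_compl_def field_top_def Int_cmp join_cmp join_commute Int_commute[of "cmp x" x])

lemma le_iff_Int_cmp: "x \<in> B \<Longrightarrow> y \<in> B \<Longrightarrow> y \<subseteq> x \<longleftrightarrow> y \<inter> cmp x = bot"
  using le_cmp_iff[of "cmp x" y] by (simp add: cmp_cmp cmp_B)

lemma cmp_antimono: "x \<in> B \<Longrightarrow> y \<in> B \<Longrightarrow> x \<subseteq> y \<Longrightarrow> cmp y \<subseteq> cmp x"
proof -
  assume xy: "x \<in> B" "y \<in> B" "x \<subseteq> y"
  have "cmp y \<inter> x \<subseteq> bot" using xy Int_cmp by blast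
  then have "cmp y \<inter> x = bot" using bot_le[OF Int_B[OF cmp_B[OF xy(2)] xy(1)]] by blast
  then show ?thesis using le_cmp_iff[OF xy(1) cmp_B[OF xy(2)]] by simp
qed

lemma cmp_Int: "x \<in> B \<Longrightarrow> y \<in> B \<Longrightarrow> cmp (x \<inter> y) = cmp x \<squnion>\<^sub>M cmp y"
proof -
  assume xy: "x \<in> B" "y \<in> B"
  note [simp] = xy Int_B join_B cmp_B cmp_cmp B_sub
  have "cmp x \<squnion>\<^sub>M cmp y \<subseteq> cmp (x \<inter> y)"
    by (rule join_least) (use cmp_antimono[of "x \<inter> y" x] cmp_antimono[of "x \<inter> y" y] in auto)
  moreover have "cmp (cmp x \<squnion>\<^sub>M cmp y) \<subseteq> x \<inter> y"
    using cmp_antimono[of "cmp x" "cmp x \<squnion>\<^sub>M cmp y"] cmp_antimono[of "cmp y" "cmp x \<squnion>\<^sub>M cmp y"]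
    by (simp add: join_upper1 join_upper2)
  then have "cmp (x \<inter> y) \<subseteq> cmp (cmp (cmp x \<squnion>\<^sub>M cmp y))"
    by (intro cmp_antimono) simp_all
  ultimately show ?thesis by simp
qed

text \<open>Apply \<open>E_tensor\<close> to the independent pair \<open>x'\<close>, \<open>x\<close>, with the trivial field inside \<open>x'\<close> and
  \<open>x \<inter> y\<close> inside \<open>x\<close>.  This gives the claim for \<open>x' \<squnion> (x \<inter> y)\<close> in place of \<open>y\<close>, and that field
  contains \<open>y\<close> by distributivity.\<close>

lemma E_comm:
  assumes x: "x \<in> B" and y: "y \<in> B" and f: "f \<in> L2"
  shows "AE \<omega> in M. E x (E y f) \<omega> = E (x \<inter> y) f \<omega>"
proof -
  note [simp] = x y Int_B join_B cmp_B B_sub f E_L2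
  have x': "indep_set (cmp x) x" "cmp x \<squnion>\<^sub>M x = sets M"
    using cmp_indep[OF x] join_cmp[OF x] by (auto intro: indep_set_commute simp: join_commute)
  have "AE \<omega> in M. E (bot \<squnion>\<^sub>M x) (E (cmp x \<squnion>\<^sub>M (x \<inter> y)) (E y f)) \<omega> = E (bot \<squnion>\<^sub>M (x \<inter> y)) (E y f) \<omega>"
    by (rule E_tensor[OF _ _ x']) (auto simp: bot_B bot_le)
  then have 1: "AE \<omega> in M. E x (E (cmp x \<squnion>\<^sub>M (x \<inter> y)) (E y f)) \<omega> = E (x \<inter> y) (E y f) \<omega>"
    by (simp add: join_absorb bot_le)
  have "y = y \<inter> (cmp x \<squnion>\<^sub>M x)" using top_ge[OF y] x' by auto
  also have "\<dots> = (y \<inter> cmp x) \<squnion>\<^sub>M (y \<inter> x)" by (rule distrib) auto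
  also have "\<dots> \<subseteq> cmp x \<squnion>\<^sub>M (x \<inter> y)" by (rule join_mono) auto
  finally have "AE \<omega> in M. E (cmp x \<squnion>\<^sub>M (x \<inter> y)) (E y f) \<omega> = E y f \<omega>"
    by (intro E_of_coarser) auto
  then have 2: "AE \<omega> in M. E x (E (cmp x \<squnion>\<^sub>M (x \<inter> y)) (E y f)) \<omega> = E x (E y f) \<omega>"
    by (intro E_cong) auto
  have 3: "AE \<omega> in M. E (x \<inter> y) (E y f) \<omega> = E (x \<inter> y) f \<omega>"
    by (rule E_tower) auto
  from 1 2 3 show ?thesis by eventually_elim simp
qed

lemma E_bot: "f \<in> L2 \<Longrightarrow> AE \<omega> in M. E bot f \<omega> = expectation f"
proof (rule E_eqI[OF B_sub[OF bot_B]])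
  assume f: "f \<in> L2"
  fix A assume "A \<in> bot"
  then consider "A \<in> null_sets M" | N where "N \<in> null_sets M" "A = space M - N"
    by (auto simp: field_bot_def)
  then show "ip f (indicator A) = ip (\<lambda>_. expectation f) (indicator A)"
  proof cases
    case 1
    have *: "ip h (indicator A) = 0" if "h \<in> L2" for h
    proof -
      have "ip h (indicator A) = ip h (\<lambda>_. 0)"
        by (rule ip_cong_AE) (use 1 that AE_not_in[OF 1] in \<open>auto simp: L2_intros null_setsD2\<close>)
      then show ?thesis by (simp add: ip_def)
    qed
    show ?thesis using *[OF f] *[OF L2_const] by simp
  next
    case 2
    have *: "ip h (indicator A) = expectation h" if "h \<in> L2" for h
    proof -
      have "ip h (indicator A) = ip h (\<lambda>_. 1)"
        by (rule ip_cong_AE) (use 2 that AE_not_in[OF 2(1)] in \<open>auto simp: L2_intros null_setsD2\<close>)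
      then show ?thesis by (simp add: ip_def)
    qed
    show ?thesis using *[OF f] *[OF L2_const] by (simp add: prob_space)
  qed
qed (auto simp: L2_const)

section \<open>Finite partitions of unity\<close>

lemma Join_B: "D \<subseteq> B \<Longrightarrow> Join D \<in> B"
  and Inf_B: "D \<subseteq> B \<Longrightarrow> field_Inf M D \<in> B"
  using complete by (auto simp: complete_in_sub_fields_def)

lemma Join_upper: "D \<subseteq> B \<Longrightarrow> x \<in> D \<Longrightarrow> x \<subseteq> Join D"
  by (rule field_Sup_is_supremum(2)) (auto intro: B_sub)

lemma Join_least: "D \<subseteq> B \<Longrightarrow> y \<in> sub_fields M \<Longrightarrow> (\<And>x. x \<in> D \<Longrightarrow> x \<subseteq> y) \<Longrightarrow> Join D \<subseteq> y"
  by (rule field_Sup_is_supremum(3)) (auto intro: B_sub)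

lemma Join_mono: "D' \<subseteq> B \<Longrightarrow> D \<subseteq> D' \<Longrightarrow> Join D \<subseteq> Join D'"
  by (rule Join_least) (auto intro: B_sub Join_B dest: Join_upper[THEN subsetD, rotated 2])

lemma Join_empty: "Join {} = bot"
  using Join_least[of "{}" bot] bot_le[OF Join_B[of "{}"]] B_sub[OF bot_B] by blast

lemma Join_insert:
  assumes "y \<in> B" "D \<subseteq> B" shows "Join (insert y D) = y \<squnion>\<^sub>M Join D"
proof (rule antisym)
  have J: "Join D \<in> sub_fields M" "Join (insert y D) \<in> sub_fields M" "y \<squnion>\<^sub>M Join D \<in> sub_fields M"
    using assms by (auto intro!: B_sub Join_B join_B)
  show "Join (insert y D) \<subseteq> y \<squnion>\<^sub>M Join D"
  proof (rule Join_least)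
    fix x assume "x \<in> insert y D"
    then show "x \<subseteq> y \<squnion>\<^sub>M Join D"
      using Join_upper[OF assms(2)] join_upper1[of y "Join D"] join_upper2[of "Join D" y] by blast
  qed (use assms J in auto)
  show "y \<squnion>\<^sub>M Join D \<subseteq> Join (insert y D)"
    by (rule join_least) (use assms J Join_upper[of "insert y D" y] Join_mono[of "insert y D" D] in auto)
qed

lemma Int_Join_bot:
  assumes "finite D" "D \<subseteq> B" "z \<in> B" "\<And>d. d \<in> D \<Longrightarrow> z \<inter> d = bot"
  shows "z \<inter> Join D = bot"
  using assms
proof (induction D)
  case empty then show ?case using bot_le by (auto simp: Join_empty)
next
  case (insert d D)
  then have "z \<inter> Join (insert d D) = (z \<inter> d) \<squnion>\<^sub>M (z \<inter> Join D)"
    by (simp add: Join_insert distrib Join_B)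
  also have "\<dots> = bot" using insert by (simp add: join_absorb B_sub bot_B)
  finally show ?case .
qed

definition part :: "'a set set set \<Rightarrow> bool" where
  "part c \<longleftrightarrow> finite c \<and> c \<subseteq> B \<and> bot \<notin> c \<and> (\<forall>x\<in>c. \<forall>y\<in>c. x \<noteq> y \<longrightarrow> x \<inter> y = bot) \<and> Join c = sets M"

text \<open>The partition \<open>c\<close> is fine enough to contain \<open>z\<close> in the Boolean algebra that it generates.\<close>

definition resolves :: "'a set set set \<Rightarrow> 'a set set \<Rightarrow> bool" where
  "resolves c z \<longleftrightarrow> (\<forall>y\<in>c. y \<subseteq> z \<or> y \<inter> z = bot)"

definition refines :: "'a set set set \<Rightarrow> 'a set set set \<Rightarrow> bool" where
  "refines c b \<longleftrightarrow> (\<forall>x\<in>b. resolves c x)"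

lemma part_finite: "part c \<Longrightarrow> finite c" and part_B: "part c \<Longrightarrow> c \<subseteq> B"
  and part_in_B: "part c \<Longrightarrow> y \<in> c \<Longrightarrow> y \<in> B"
  by (auto simp: part_def)

lemma part_nonzero:
  assumes "part c" "y \<in> c" "y \<subseteq> x" "y \<inter> x = bot" shows False
  using assms by (auto simp: part_def Int_absorb2)

lemma resolves_cmp: "part c \<Longrightarrow> z \<in> B \<Longrightarrow> resolves c z \<Longrightarrow> resolves c (cmp z)"
  using le_cmp_iff[of z] le_iff_Int_cmp[of z] part_in_B unfolding resolves_def by metis

lemma not_le_iff: "part c \<Longrightarrow> z \<in> B \<Longrightarrow> resolves c z \<Longrightarrow> y \<in> c \<Longrightarrow> \<not> y \<subseteq> z \<longleftrightarrow> y \<subseteq> cmp z"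
  using le_cmp_iff[of z y] part_nonzero[of c y z] part_in_B[of c y] unfolding resolves_def by blast

lemma resolves_Join:
  assumes c: "part c" and D: "finite D" "D \<subseteq> B" "\<And>d. d \<in> D \<Longrightarrow> resolves c d"
  shows "resolves c (Join D)"
    and "y \<in> c \<Longrightarrow> y \<subseteq> Join D \<longleftrightarrow> (\<exists>d\<in>D. y \<subseteq> d)"
proof -
  have *: "if (\<exists>d\<in>D. y \<subseteq> d) then y \<subseteq> Join D else y \<inter> Join D = bot" if y: "y \<in> c" for y
  proof (cases "\<exists>d\<in>D. y \<subseteq> d")
    case True
    then show ?thesis using Join_upper[OF D(2)] by auto
  next
    case False
    then have "y \<inter> d = bot" if "d \<in> D" for d using D(3) that y by (auto simp: resolves_def)
    then show ?thesis using False D Int_Join_bot[OF D(1,2) part_in_B[OF c y]] by auto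
  qed
  then show "resolves c (Join D)" unfolding resolves_def by meson
  show "y \<in> c \<Longrightarrow> y \<subseteq> Join D \<longleftrightarrow> (\<exists>d\<in>D. y \<subseteq> d)"
    using *[of y] part_nonzero[OF c, of y "Join D"] by (auto split: if_splits)
qed

lemma join_eq_Join: "x \<squnion>\<^sub>M y = Join {x, y}"
  by (simp add: field_join_def field_Sup_def)

lemma resolves_join:
  assumes "part c" "x \<in> B" "z \<in> B" "resolves c x" "resolves c z"
  shows "resolves c (x \<squnion>\<^sub>M z)" and "y \<in> c \<Longrightarrow> y \<subseteq> x \<squnion>\<^sub>M z \<longleftrightarrow> y \<subseteq> x \<or> y \<subseteq> z"
  unfolding join_eq_Join using resolves_Join[of c "{x, z}"] assms by auto

lemma resolved_eq_Join:
  assumes c: "part c" and z: "z \<in> B" "resolves c z"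
  shows "z = Join {y \<in> c. y \<subseteq> z}"
proof (rule antisym)
  let ?D = "{y \<in> c. y \<subseteq> z}" and ?N = "{y \<in> c. \<not> y \<subseteq> z}"
  have D: "finite ?D" "?D \<subseteq> B" and N: "finite ?N" "?N \<subseteq> B" using c by (auto simp: part_def)
  show "Join ?D \<subseteq> z" by (rule Join_least) (use D z in \<open>auto simp: B_sub\<close>)
  have "c = ?D \<union> ?N" by auto
  have "Join c \<subseteq> Join ?D \<squnion>\<^sub>M Join ?N"
  proof (rule Join_least[OF part_B[OF c]])
    fix y assume "y \<in> c"
    then show "y \<subseteq> Join ?D \<squnion>\<^sub>M Join ?N"
      using Join_upper[OF D(2), of y] Join_upper[OF N(2), of y]
        join_upper1[of "Join ?D" "Join ?N"] join_upper2[of "Join ?N" "Join ?D"] by blast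
  qed (use D N in \<open>auto intro!: B_sub join_B Join_B\<close>)
  then have "z = z \<inter> (Join ?D \<squnion>\<^sub>M Join ?N)" using top_ge[OF z(1)] c by (auto simp: part_def)
  also have "\<dots> = (z \<inter> Join ?D) \<squnion>\<^sub>M (z \<inter> Join ?N)" by (rule distrib) (use z D N in \<open>auto intro: Join_B\<close>)
  also have "z \<inter> Join ?N = bot"
    by (rule Int_Join_bot) (use z N in \<open>auto simp: resolves_def\<close>)
  also have "(z \<inter> Join ?D) \<squnion>\<^sub>M bot = z \<inter> Join ?D"
    by (rule join_absorb') (use z D in \<open>auto intro!: B_sub Int_B Join_B bot_le[THEN subsetD]\<close>)
  finally show "z \<subseteq> Join ?D" by blast
qed

lemma resolves_self: "part c \<Longrightarrow> x \<in> c \<Longrightarrow> resolves c x"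
  unfolding resolves_def part_def by (metis order_refl)

lemma part_le_iff: "part c \<Longrightarrow> x \<in> c \<Longrightarrow> y \<in> c \<Longrightarrow> y \<subseteq> x \<longleftrightarrow> y = x"
  using part_nonzero[of c y x] unfolding part_def by (metis order_refl)

lemma part_Join:
  assumes c: "part c" and D: "D \<subseteq> c"
  shows "resolves c (Join D)" and "y \<in> c \<Longrightarrow> y \<subseteq> Join D \<longleftrightarrow> y \<in> D"
proof -
  have D': "finite D" "D \<subseteq> B" "\<And>d. d \<in> D \<Longrightarrow> resolves c d"
    using c D resolves_self by (auto simp: part_def intro: finite_subset)
  show "resolves c (Join D)" by (rule resolves_Join(1)[OF c D'])
  show "y \<in> c \<Longrightarrow> y \<subseteq> Join D \<longleftrightarrow> y \<in> D"
    using resolves_Join(2)[OF c D', of y] part_le_iff[OF c] D by blast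
qed

lemma resolves_Int:
  assumes "resolves c x" "resolves c z" "x \<in> B" "z \<in> B" "part c"
  shows "resolves c (x \<inter> z)"
  unfolding resolves_def
proof (intro ballI)
  fix y assume y: "y \<in> c"
  have "y \<inter> (x \<inter> z) = bot" if "y \<inter> x = bot \<or> y \<inter> z = bot"
  proof -
    have "y \<inter> (x \<inter> z) \<subseteq> bot" using that by blast
    moreover have "bot \<subseteq> y \<inter> (x \<inter> z)" using assms part_in_B[OF assms(5) y] by (simp add: bot_le)
    ultimately show ?thesis by blast
  qed
  then show "y \<subseteq> x \<inter> z \<or> y \<inter> (x \<inter> z) = bot" using assms(1,2) y by (auto simp: resolves_def)
qed

lemma Join_Int:
  assumes c: "part c" and D: "D \<subseteq> c" and D': "D' \<subseteq> c"
  shows "Join D \<inter> Join D' = Join (D \<inter> D')"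
proof -
  have J: "Join D \<in> B" "Join D' \<in> B" using c D D' by (auto intro!: Join_B simp: part_def)
  have "Join D \<inter> Join D' = Join {y \<in> c. y \<subseteq> Join D \<inter> Join D'}"
    by (rule resolved_eq_Join[OF c]) (use J part_Join[OF c] D D' c in \<open>auto intro: Int_B resolves_Int\<close>)
  also have "{y \<in> c. y \<subseteq> Join D \<inter> Join D'} = D \<inter> D'"
    using part_Join(2)[OF c D] part_Join(2)[OF c D'] D by auto
  finally show ?thesis .
qed

lemma refines_trans:
  assumes "part b" "part c" "refines c b" "z \<in> B" "resolves b z"
  shows "resolves c z"
proof -
  have "resolves c (Join {y \<in> b. y \<subseteq> z})"
    by (rule resolves_Join) (use assms in \<open>auto simp: part_def refines_def\<close>)
  then show ?thesis using resolved_eq_Join[OF assms(1,4,5)] by simp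
qed

text \<open>Cutting every cell along \<open>z\<close> resolves \<open>z\<close>; empty pieces are discarded, because the cells of a
  partition are required to be nonzero.\<close>

lemma split_part:
  assumes c: "part c" and z: "z \<in> B"
  obtains c' where "part c'" "resolves c' z" "\<And>w. w \<in> B \<Longrightarrow> resolves c w \<Longrightarrow> resolves c' w"
proof -
  define c' where "c' = ((\<lambda>y. y \<inter> z) ` c \<union> (\<lambda>y. y \<inter> cmp z) ` c) - {bot}"
  have cB: "\<And>y. y \<in> c \<Longrightarrow> y \<in> B" using part_in_B[OF c] .
  have c'B: "c' \<subseteq> B" using cB z by (auto simp: c'_def intro: Int_B cmp_B)
  have dis: "u \<inter> v = bot" if "u \<in> B" "v \<in> B" "u \<subseteq> u'" "v \<subseteq> v'" "u' \<inter> v' = bot" for u v u' v'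
    using that bot_le[OF Int_B[OF that(1,2)]] by blast
  have zz: "z \<inter> cmp z = bot" "cmp z \<inter> z = bot" using Int_cmp[OF z] by auto
  have c'cases: "\<exists>y w. y \<in> c \<and> w \<in> {z, cmp z} \<and> u = y \<inter> w" if "u \<in> c'" for u
    using that by (auto simp: c'_def)
  have cdis: "y \<inter> y' = bot" if "y \<in> c" "y' \<in> c" "y \<noteq> y'" for y y' using c that by (auto simp: part_def)
  have disj: "u \<inter> v = bot" if uv: "u \<in> c'" "v \<in> c'" "u \<noteq> v" for u v
  proof -
    obtain y w where u: "y \<in> c" "w \<in> {z, cmp z}" "u = y \<inter> w" using c'cases[OF uv(1)] by blast
    obtain y' w' where v: "y' \<in> c" "w' \<in> {z, cmp z}" "v = y' \<inter> w'" using c'cases[OF uv(2)] by blast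
    have uvB: "u \<in> B" "v \<in> B" using uv c'B by auto
    show ?thesis
    proof (cases "y = y'")
      case True
      then have "w \<inter> w' = bot" using u v uv(3) zz by auto
      then show ?thesis by (intro dis[OF uvB, of w w']) (use u v in auto)
    next
      case False
      then show ?thesis by (intro dis[OF uvB, of y y']) (use u v cdis in auto)
    qed
  qed
  have "Join c \<subseteq> Join c'"
  proof (rule Join_least[OF part_B[OF c]])
    fix y assume y: "y \<in> c"
    have up: "y \<inter> w \<subseteq> Join c'" if "w \<in> {z, cmp z}" for w
    proof (cases "y \<inter> w = bot")
      case True then show ?thesis using bot_le[OF Join_B[OF c'B]] by simp
    next
      case False then show ?thesis using y that by (intro Join_upper[OF c'B]) (auto simp: c'_def)
    qed
    have "y = y \<inter> (z \<squnion>\<^sub>M cmp z)" using top_ge[OF cB[OF y]] join_cmp[OF z] by auto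
    also have "\<dots> = (y \<inter> z) \<squnion>\<^sub>M (y \<inter> cmp z)" using y z cB by (intro distrib cmp_B) auto
    also have "\<dots> \<subseteq> Join c'" by (rule join_least) (use up c'B in \<open>auto intro!: B_sub Join_B\<close>)
    finally show "y \<subseteq> Join c'" .
  qed (use c'B in \<open>auto intro!: B_sub Join_B\<close>)
  then have "Join c' = sets M" using c top_ge[OF Join_B[OF c'B]] by (auto simp: part_def)
  moreover have "finite c'" using c by (simp add: c'_def part_def)
  moreover have "bot \<notin> c'" by (simp add: c'_def)
  ultimately have P: "part c'" using c'B disj by (auto simp: part_def)
  have res: "resolves c' w" if w: "w \<in> B" "resolves c w" for w
    unfolding resolves_def
  proof (intro ballI)
    fix u assume u: "u \<in> c'"
    obtain y v where "y \<in> c" "u = y \<inter> v" using c'cases[OF u] by blast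
    moreover have "y \<subseteq> w \<or> y \<inter> w = bot" using w(2) calculation by (auto simp: resolves_def)
    ultimately show "u \<subseteq> w \<or> u \<inter> w = bot" using dis[of u w y w] u c'B w(1) by auto
  qed
  have "resolves c' z"
    unfolding resolves_def
  proof (intro ballI)
    fix u assume u: "u \<in> c'"
    obtain y v where yv: "y \<in> c" "v \<in> {z, cmp z}" "u = y \<inter> v" using c'cases[OF u] by blast
    then show "u \<subseteq> z \<or> u \<inter> z = bot" using dis[of u z "cmp z" z] u c'B z zz by auto
  qed
  then show ?thesis using that P res by blast
qed

lemma resolving_part:
  assumes c: "part c" and Z: "finite Z" "Z \<subseteq> B"
  obtains c' where "part c'" "refines c' c" "\<And>z. z \<in> Z \<Longrightarrow> resolves c' z"
proof -
  have "\<exists>c'. part c' \<and> (\<forall>w\<in>B. resolves c w \<longrightarrow> resolves c' w) \<and> (\<forall>z\<in>Z. resolves c' z)"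
    using Z
  proof (induction Z)
    case empty then show ?case using c by blast
  next
    case (insert z Z)
    then obtain c' where c': "part c'" "\<forall>w\<in>B. resolves c w \<longrightarrow> resolves c' w" "\<forall>z\<in>Z. resolves c' z" by auto
    obtain c'' where "part c''" "resolves c'' z" "\<And>w. w \<in> B \<Longrightarrow> resolves c' w \<Longrightarrow> resolves c'' w"
      using split_part[OF c'(1), of z] insert by auto
    then show ?case using c' insert.prems by (intro exI[of _ c'']) auto
  qed
  then show ?thesis
    using that resolves_self[OF c] part_in_B[OF c] unfolding refines_def by metis
qed

lemma part_exists: "\<exists>c. part c"
proof (cases "sets M = bot")
  case True
  then have "part {}" by (simp add: part_def Join_empty)
  then show ?thesis by blast
next
  case False
  have "Join {sets M} = sets M"
    using Join_insert[OF top_B, of "{}"] join_absorb'[OF sets_sub_fields bot_le[OF top_B]]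
    by (simp add: Join_empty)
  then have "part {sets M}" using False top_B by (simp add: part_def)
  then show ?thesis by blast
qed

lemma refines_refl: "part c \<Longrightarrow> refines c c"
  by (simp add: refines_def resolves_self)

lemma refines_transitive: "part b \<Longrightarrow> part c \<Longrightarrow> part d \<Longrightarrow> refines c b \<Longrightarrow> refines d c \<Longrightarrow> refines d b"
  unfolding refines_def using refines_trans[of c d] part_in_B by (auto simp: refines_def)

lemma refines_directed:
  assumes "part b" "part c"
  obtains d where "part d" "refines d b" "refines d c"
  using resolving_part[OF assms(1) part_finite[OF assms(2)] part_B[OF assms(2)]]
  unfolding refines_def by metis

section \<open>Joint spectral decomposition over a finite partition\<close>

text \<open>A joint diagonalization of all conditional expectations on the algebra generated by \<open>c\<close>:
  \<open>F A\<close> is the part of \<open>f\<close> whose spectrum meets exactly the cells in \<open>A\<close>, so \<open>E z\<close> keeps it if all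
  these cells lie in \<open>z\<close> and kills it otherwise.\<close>

definition decomposes ::
  "'a set set set \<Rightarrow> ('a \<Rightarrow> real) \<Rightarrow> ('a set set set \<Rightarrow> 'a \<Rightarrow> real) \<Rightarrow> bool" where
  "decomposes c f F \<longleftrightarrow>
     (\<forall>A. A \<subseteq> c \<longrightarrow> F A \<in> L2) \<and>
     (AE \<omega> in M. f \<omega> = (\<Sum>A\<in>Pow c. F A \<omega>)) \<and>
     (\<forall>z\<in>B. resolves c z \<longrightarrow> (\<forall>A. A \<subseteq> c \<longrightarrow>
        (AE \<omega> in M. E z (F A) \<omega> = of_bool (\<forall>y\<in>A. y \<subseteq> z) * F A \<omega>))) \<and>
     (\<forall>A A'. A \<subseteq> c \<longrightarrow> A' \<subseteq> c \<longrightarrow> A \<noteq> A' \<longrightarrow> ip (F A) (F A') = 0)"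

text \<open>Moebius inversion of \<open>D \<mapsto> E (Join D) f\<close> over the subsets \<open>D\<close> of \<open>c\<close>.  Conditioning on \<open>Join S\<close>
  replaces \<open>D\<close> by \<open>S \<inter> D\<close>; if some cell of \<open>A\<close> is not in \<open>S\<close>, the alternating sum cancels.\<close>

lemma decomposition_exists:
  assumes c: "part c" and f: "f \<in> L2"
  obtains F where "decomposes c f F"
proof -
  define q where "q D = E (Join D) f" for D
  define F where "F A \<omega> = (\<Sum>D\<in>Pow A. (-1) ^ (card A + card D) * q D \<omega>)" for A \<omega>
  have fin: "finite A" if "A \<subseteq> c" for A using that c finite_subset by (auto simp: part_def)
  have JB: "Join D \<in> B" if "D \<subseteq> c" for D using that c by (auto intro!: Join_B simp: part_def)
  have qL: "q D \<in> L2" if "D \<subseteq> c" for D using JB[OF that] f by (simp add: q_def E_L2 B_sub)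
  have FL: "F A \<in> L2" if "A \<subseteq> c" for A
    unfolding F_def using that qL by (intro L2_sum L2_scale) auto
  have "q c \<omega> = (\<Sum>A\<in>Pow c. F A \<omega>)" for \<omega>
  proof -
    have "q c \<omega> = (\<Sum>T\<in>Pow c. (-1) ^ card T * (\<Sum>D\<in>Pow T. (-1) ^ card D * q D \<omega>))"
      by (rule inclusion_exclusion_symmetric) (use c in \<open>auto simp: part_def\<close>)
    also have "\<dots> = (\<Sum>A\<in>Pow c. F A \<omega>)"
      by (simp add: F_def power_add sum_distrib_left mult.assoc)
    finally show ?thesis .
  qed
  then have sum: "AE \<omega> in M. f \<omega> = (\<Sum>A\<in>Pow c. F A \<omega>)"
    using E_top[OF f] c by (simp add: q_def part_def eq_commute)
  have EF: "AE \<omega> in M. E z (F A) \<omega> = of_bool (\<forall>y\<in>A. y \<subseteq> z) * F A \<omega>"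
    if z: "z \<in> B" "resolves c z" and A: "A \<subseteq> c" for z A
  proof -
    define S where "S = {y \<in> c. y \<subseteq> z}"
    have zS: "z = Join S" unfolding S_def by (rule resolved_eq_Join[OF c z])
    have Sc: "S \<subseteq> c" by (auto simp: S_def)
    have Ez: "AE \<omega> in M. E z (q D) \<omega> = q (S \<inter> D) \<omega>" if D: "D \<in> Pow A" for D
    proof -
      have "D \<subseteq> c" using D A by auto
      then show ?thesis
        using E_comm[OF z(1) JB f] Join_Int[OF c Sc] by (simp add: q_def flip: zS)
    qed
    have "AE \<omega> in M. E z (F A) \<omega> = (\<Sum>D\<in>Pow A. E z (\<lambda>\<omega>. (-1) ^ (card A + card D) * q D \<omega>) \<omega>)"
      unfolding F_def by (rule E_sum) (use z A qL in \<open>auto intro!: L2_scale simp: B_sub\<close>)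
    moreover have "AE \<omega> in M. \<forall>D\<in>Pow A. E z (\<lambda>\<omega>. (-1) ^ (card A + card D) * q D \<omega>) \<omega> = (-1) ^ (card A + card D) * E z (q D) \<omega>"
      by (rule AE_finite_allI) (use fin[OF A] A z qL in \<open>auto intro!: E_scale simp: B_sub\<close>)
    moreover have "AE \<omega> in M. \<forall>D\<in>Pow A. E z (q D) \<omega> = q (S \<inter> D) \<omega>"
      by (rule AE_finite_allI) (use fin[OF A] Ez in auto)
    ultimately show ?thesis
    proof eventually_elim
      case (elim \<omega>)
      then have 1: "E z (F A) \<omega> = (\<Sum>D\<in>Pow A. (-1) ^ (card A + card D) * q (S \<inter> D) \<omega>)" by simp
      show ?case
      proof (cases "\<forall>y\<in>A. y \<subseteq> z")
        case True
        then have "S \<inter> D = D" if "D \<in> Pow A" for D using that A by (auto simp: S_def)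
        then show ?thesis using 1 True by (simp add: F_def)
      next
        case False
        then obtain a where a: "a \<in> A" "\<not> a \<subseteq> z" by blast
        have "(\<Sum>D\<in>Pow A. (-1) ^ (card A + card D) * q (S \<inter> D) \<omega>) = 0"
          by (rule alternating_sum_zero[OF fin[OF A] a(1)]) (use a in \<open>auto simp: S_def\<close>)
        then show ?thesis using 1 False by simp
      qed
    qed
  qed
  have orth1: "ip (F A) (F A') = 0" if A: "A \<subseteq> c" "A' \<subseteq> c" "\<not> A \<subseteq> A'" for A A'
  proof -
    define z where "z = Join A'"
    have z: "z \<in> B" "resolves c z" using JB part_Join[OF c] A by (auto simp: z_def)
    have le: "y \<subseteq> z \<longleftrightarrow> y \<in> A'" if "y \<in> c" for y using part_Join(2)[OF c A(2) that] by (simp add: z_def)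
    have le': "(\<forall>y\<in>A'. y \<subseteq> z) = True" "(\<forall>y\<in>A. y \<subseteq> z) = False" using le A by blast+
    have 1: "AE \<omega> in M. E z (F A') \<omega> = F A' \<omega>" "AE \<omega> in M. E z (F A) \<omega> = 0"
      using EF[OF z A(2), unfolded le'] EF[OF z A(1), unfolded le'] by simp_all
    note L = FL[OF A(1)] FL[OF A(2)]
    have "ip (F A) (F A') = ip (F A) (E z (F A'))"
      by (rule ip_cong_AE) (use 1 L z in \<open>auto simp: E_L2 B_sub\<close>)
    also have "\<dots> = ip (E z (F A)) (F A')" using L z by (simp add: E_self_adjoint B_sub)
    also have "\<dots> = ip (\<lambda>_. 0) (F A')"
      by (rule ip_cong_AE) (use 1 L z in \<open>auto simp: E_L2 B_sub L2_const\<close>)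
    finally show ?thesis by (simp add: ip_def)
  qed
  have orth: "ip (F A) (F A') = 0" if "A \<subseteq> c" "A' \<subseteq> c" "A \<noteq> A'" for A A'
    using orth1[of A A'] orth1[of A' A] ip_commute[of "F A" "F A'"] that by auto
  show ?thesis
    by (rule that[of F]) (unfold decomposes_def, use FL sum EF orth in blast)
qed

text \<open>The function \<open>g\<close> arises from the decomposed one by multiplying each spectral part with the
  number \<open>\<phi> A\<close>.  All computations below take place on these symbols.\<close>

definition has_symbol ::
  "'a set set set \<Rightarrow> ('a set set set \<Rightarrow> 'a \<Rightarrow> real) \<Rightarrow> ('a \<Rightarrow> real) \<Rightarrow> ('a set set set \<Rightarrow> real) \<Rightarrow> bool" where
  "has_symbol c F g \<phi> \<longleftrightarrow> g \<in> L2 \<and> (AE \<omega> in M. g \<omega> = (\<Sum>A\<in>Pow c. \<phi> A * F A \<omega>))"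

lemma symbol_self: "decomposes c f F \<Longrightarrow> f \<in> L2 \<Longrightarrow> has_symbol c F f (\<lambda>_. 1)"
  by (simp add: has_symbol_def decomposes_def)

lemma symbol_add:
  "has_symbol c F g \<phi> \<Longrightarrow> has_symbol c F h \<psi> \<Longrightarrow> has_symbol c F (\<lambda>\<omega>. g \<omega> + h \<omega>) (\<lambda>A. \<phi> A + \<psi> A)"
  unfolding has_symbol_def
  by (auto simp: L2_add distrib_right sum.distrib)

lemma symbol_diff:
  "has_symbol c F g \<phi> \<Longrightarrow> has_symbol c F h \<psi> \<Longrightarrow> has_symbol c F (\<lambda>\<omega>. g \<omega> - h \<omega>) (\<lambda>A. \<phi> A - \<psi> A)"
  unfolding has_symbol_def
  by (auto simp: L2_diff left_diff_distrib sum_subtractf)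

lemma symbol_scale: "has_symbol c F g \<phi> \<Longrightarrow> has_symbol c F (\<lambda>\<omega>. a * g \<omega>) (\<lambda>A. a * \<phi> A)"
  unfolding has_symbol_def by (auto simp: L2_scale sum_distrib_left mult.assoc)

lemma symbol_sum:
  "finite I \<Longrightarrow> (\<And>i. i \<in> I \<Longrightarrow> has_symbol c F (g i) (\<phi> i)) \<Longrightarrow>
     has_symbol c F (\<lambda>\<omega>. \<Sum>i\<in>I. g i \<omega>) (\<lambda>A. \<Sum>i\<in>I. \<phi> i A)"
proof (induction I rule: finite_induct)
  case empty then show ?case by (simp add: has_symbol_def L2_const)
next
  case (insert i I)
  then show ?case using symbol_add[of c F "g i" "\<phi> i" "\<lambda>\<omega>. \<Sum>i\<in>I. g i \<omega>" "\<lambda>A. \<Sum>i\<in>I. \<phi> i A"] by simp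
qed

lemma symbol_E:
  assumes c: "part c" and F: "decomposes c f F" and z: "z \<in> B" "resolves c z" and g: "has_symbol c F g \<phi>"
  shows "has_symbol c F (E z g) (\<lambda>A. of_bool (\<forall>y\<in>A. y \<subseteq> z) * \<phi> A)"
proof -
  have fin: "finite (Pow c)" using c by (simp add: part_def)
  have L: "\<And>A. A \<in> Pow c \<Longrightarrow> F A \<in> L2" using F by (simp add: decomposes_def)
  have gL: "g \<in> L2" using g by (simp add: has_symbol_def)
  have "AE \<omega> in M. E z g \<omega> = E z (\<lambda>\<omega>. \<Sum>A\<in>Pow c. \<phi> A * F A \<omega>) \<omega>"
    by (rule E_cong) (use g z L in \<open>auto simp: has_symbol_def B_sub intro!: L2_sum L2_scale\<close>)
  moreover have "AE \<omega> in M. E z (\<lambda>\<omega>. \<Sum>A\<in>Pow c. \<phi> A * F A \<omega>) \<omega> = (\<Sum>A\<in>Pow c. E z (\<lambda>\<omega>. \<phi> A * F A \<omega>) \<omega>)"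
    by (rule E_sum) (use L z in \<open>auto simp: B_sub intro!: L2_scale\<close>)
  moreover have "AE \<omega> in M. \<forall>A\<in>Pow c. E z (\<lambda>\<omega>. \<phi> A * F A \<omega>) \<omega> = \<phi> A * E z (F A) \<omega>"
    by (rule AE_finite_allI[OF fin]) (use L z in \<open>auto simp: B_sub intro!: E_scale\<close>)
  moreover have "AE \<omega> in M. \<forall>A\<in>Pow c. E z (F A) \<omega> = of_bool (\<forall>y\<in>A. y \<subseteq> z) * F A \<omega>"
    by (rule AE_finite_allI[OF fin]) (use F z in \<open>simp add: decomposes_def\<close>)
  ultimately have "AE \<omega> in M. E z g \<omega> = (\<Sum>A\<in>Pow c. (of_bool (\<forall>y\<in>A. y \<subseteq> z) * \<phi> A) * F A \<omega>)"
    by eventually_elim (simp add: mult_ac)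
  then show ?thesis using gL z by (simp add: has_symbol_def E_L2 B_sub)
qed

lemma symbol_ip:
  assumes c: "part c" and F: "decomposes c f F" and g: "has_symbol c F g \<phi>" and h: "has_symbol c F h \<psi>"
  shows "ip g h = (\<Sum>A\<in>Pow c. \<phi> A * \<psi> A * sqn (F A))"
proof -
  have L: "\<And>A. A \<in> Pow c \<Longrightarrow> F A \<in> L2" using F by (simp add: decomposes_def)
  have fin: "finite (Pow c)" using c by (simp add: part_def)
  have L': "(\<lambda>\<omega>. \<Sum>A\<in>Pow c. \<nu> A * F A \<omega>) \<in> L2" for \<nu> :: "_ \<Rightarrow> real" using L by (intro L2_sum L2_scale) auto
  have "ip g h = ip (\<lambda>\<omega>. \<Sum>A\<in>Pow c. \<phi> A * F A \<omega>) (\<lambda>\<omega>. \<Sum>A\<in>Pow c. \<psi> A * F A \<omega>)"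
    by (rule ip_cong_AE) (use g h L' in \<open>auto simp: has_symbol_def\<close>)
  also have "\<dots> = (\<Sum>A\<in>Pow c. ip (\<lambda>\<omega>. \<phi> A * F A \<omega>) (\<lambda>\<omega>. \<Sum>A\<in>Pow c. \<psi> A * F A \<omega>))"
    by (rule ip_sum_left) (use L L' in \<open>auto intro: L2_scale\<close>)
  also have "\<dots> = (\<Sum>A\<in>Pow c. \<phi> A * ip (F A) (\<lambda>\<omega>. \<Sum>A\<in>Pow c. \<psi> A * F A \<omega>))"
    by (simp only: ip_scale_left)
  also have "\<dots> = (\<Sum>A\<in>Pow c. \<phi> A * (\<Sum>A'\<in>Pow c. ip (F A) (\<lambda>\<omega>. \<psi> A' * F A' \<omega>)))"
    by (intro sum.cong refl arg_cong2[where f="(*)"] ip_sum_right) (use L in \<open>auto intro: L2_scale\<close>)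
  also have "\<dots> = (\<Sum>A\<in>Pow c. \<Sum>A'\<in>Pow c. \<phi> A * (\<psi> A' * ip (F A) (F A')))"
    by (simp only: ip_scale_right sum_distrib_left)
  also have "\<dots> = (\<Sum>A\<in>Pow c. \<Sum>A'\<in>Pow c. if A' = A then \<phi> A * \<psi> A * sqn (F A) else 0)"
    by (intro sum.cong refl) (use F in \<open>auto simp: decomposes_def\<close>)
  also have "\<dots> = (\<Sum>A\<in>Pow c. \<phi> A * \<psi> A * sqn (F A))" using fin by simp
  finally show ?thesis .
qed

lemma symbol_sqn:
  assumes "part c" "decomposes c f F" "has_symbol c F g \<phi>"
  shows "sqn g = (\<Sum>A\<in>Pow c. (\<phi> A)\<^sup>2 * sqn (F A))"
  using symbol_ip[OF assms assms(3)] by (simp add: power2_eq_square)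

section \<open>Traces on coarser partitions\<close>

text \<open>The cells of the coarser partition \<open>b\<close> that are met by a set of cells of a finer partition.\<close>

definition trace :: "'a set set set \<Rightarrow> 'a set set set \<Rightarrow> 'a set set set" where
  "trace b A = {x \<in> b. \<exists>y\<in>A. y \<subseteq> x}"

lemma le_unique_atom:
  assumes b: "part b" and c: "part c" and v: "v \<in> c" "x \<in> b" "x' \<in> b" "v \<subseteq> x" "v \<subseteq> x'"
  shows "x = x'"
proof (rule ccontr)
  assume "x \<noteq> x'"
  then have "x \<inter> x' = bot" using b v by (auto simp: part_def)
  then have "v \<subseteq> bot" using v by blast
  then have "v = bot" using bot_le[OF part_in_B[OF c v(1)]] by blast
  then show False using c v(1) by (simp add: part_def)
qed

lemma atom_below:
  assumes b: "part b" and c: "part c" and r: "refines c b" and z: "z \<in> B" "resolves b z"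
    and v: "v \<in> c" "v \<subseteq> z"
  shows "\<exists>x\<in>b. v \<subseteq> x \<and> x \<subseteq> z"
proof -
  have D: "finite {x \<in> b. x \<subseteq> z}" "{x \<in> b. x \<subseteq> z} \<subseteq> B" "\<And>d. d \<in> {x \<in> b. x \<subseteq> z} \<Longrightarrow> resolves c d"
    using b r by (auto simp: part_def refines_def)
  have "v \<subseteq> Join {x \<in> b. x \<subseteq> z}" using v resolved_eq_Join[OF b z] by simp
  then have "\<exists>d\<in>{x \<in> b. x \<subseteq> z}. v \<subseteq> d"
    using resolves_Join(2)[OF c D v(1)] by blast
  then show ?thesis by blast
qed

lemma resolves_top: "part b \<Longrightarrow> resolves b (sets M)"
  using top_ge part_in_B unfolding resolves_def by blast

lemma atom_above:
  assumes b: "part b" and c: "part c" and r: "refines c b" and v: "v \<in> c"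
  shows "\<exists>x\<in>b. v \<subseteq> x"
proof -
  have "v \<subseteq> sets M" by (rule top_ge[OF part_in_B[OF c v]])
  from atom_below[OF b c r top_B resolves_top[OF b] v this] show ?thesis by blast
qed

text \<open>Consequently an operator built from the algebra generated by \<open>b\<close> has a symbol that depends on \<open>A\<close>
  only through its trace, and the symbol can be computed in \<open>b\<close> itself.\<close>

lemma trace_le_iff:
  assumes b: "part b" and c: "part c" and r: "refines c b" and z: "z \<in> B" "resolves b z" and A: "A \<subseteq> c"
  shows "(\<forall>v\<in>A. v \<subseteq> z) \<longleftrightarrow> (\<forall>x\<in>trace b A. x \<subseteq> z)"
proof
  assume L: "\<forall>v\<in>A. v \<subseteq> z"
  show "\<forall>x\<in>trace b A. x \<subseteq> z"
  proof
    fix x assume "x \<in> trace b A"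
    then obtain v where x: "x \<in> b" "v \<in> A" "v \<subseteq> x" by (auto simp: trace_def)
    have "v \<in> c" using x A by auto
    moreover have "v \<subseteq> z" using L x by blast
    ultimately obtain x' where "x' \<in> b" "v \<subseteq> x'" "x' \<subseteq> z" using atom_below[OF b c r z, of v] by blast
    then show "x \<subseteq> z" using le_unique_atom[OF b c \<open>v \<in> c\<close>, of x x'] x by auto
  qed
next
  assume R: "\<forall>x\<in>trace b A. x \<subseteq> z"
  show "\<forall>v\<in>A. v \<subseteq> z"
  proof
    fix v assume v: "v \<in> A"
    then obtain x where "x \<in> b" "v \<subseteq> x"
      using atom_above[OF b c r, of v] A by blast
    then show "v \<subseteq> z" using R v by (auto simp: trace_def)
  qed
qed

lemma trace_subset: "trace b A \<subseteq> b" by (auto simp: trace_def)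

lemma trace_self: "part c \<Longrightarrow> A \<subseteq> c \<Longrightarrow> trace c A = A"
  unfolding trace_def using part_le_iff[of c] by blast

lemma symbol_E_coarse:
  assumes "part b" "part c" "refines c b" "decomposes c f F" "z \<in> B" "resolves b z" "has_symbol c F g (\<lambda>A. \<phi> (trace b A))"
  shows "has_symbol c F (E z g) (\<lambda>A. of_bool (\<forall>y\<in>trace b A. y \<subseteq> z) * \<phi> (trace b A))"
proof -
  have "has_symbol c F (E z g) (\<lambda>A. of_bool (\<forall>y\<in>A. y \<subseteq> z) * \<phi> (trace b A))"
    using symbol_E[OF assms(2,4,5) refines_trans[OF assms(1,2,3,5,6)] assms(7)] .
  moreover have "(\<Sum>A\<in>Pow c. of_bool (\<forall>y\<in>A. y \<subseteq> z) * \<phi> (trace b A) * F A \<omega>) =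
     (\<Sum>A\<in>Pow c. of_bool (\<forall>y\<in>trace b A. y \<subseteq> z) * \<phi> (trace b A) * F A \<omega>)" for \<omega>
    using trace_le_iff[OF assms(1-3,5,6)] by (intro sum.cong) auto
  ultimately show ?thesis by (simp add: has_symbol_def)
qed

lemma symbol_cong:
  "has_symbol c F g \<phi> \<Longrightarrow> (\<And>A. A \<subseteq> c \<Longrightarrow> \<phi> A = \<psi> A) \<Longrightarrow> has_symbol c F g \<psi>"
proof -
  assume g: "has_symbol c F g \<phi>" and eq: "\<And>A. A \<subseteq> c \<Longrightarrow> \<phi> A = \<psi> A"
  have "(\<Sum>A\<in>Pow c. \<phi> A * F A \<omega>) = (\<Sum>A\<in>Pow c. \<psi> A * F A \<omega>)" for \<omega>
    by (rule sum.cong) (use eq in auto)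
  then show ?thesis using g by (simp add: has_symbol_def)
qed

lemma trace_card_sum:
  assumes b: "part b" and c: "part c" and r: "refines c b" and A: "A \<subseteq> c"
  shows "card A = (\<Sum>x\<in>b. card {v \<in> A. v \<subseteq> x})"
    and "card (trace b A) = (\<Sum>x\<in>b. of_bool (\<exists>v\<in>A. v \<subseteq> x))"
proof -
  have finA: "finite A" using A c finite_subset by (auto simp: part_def)
  have "A = (\<Union>x\<in>b. {v \<in> A. v \<subseteq> x})"
  proof -
    have "\<exists>x\<in>b. v \<subseteq> x" if "v \<in> A" for v
      using atom_above[OF b c r, of v] that A by blast
    then show ?thesis by auto
  qed
  also have "card \<dots> = (\<Sum>x\<in>b. card {v \<in> A. v \<subseteq> x})"
  proof (rule card_UN_disjoint)
    show "\<forall>x\<in>b. \<forall>x'\<in>b. x \<noteq> x' \<longrightarrow> {v \<in> A. v \<subseteq> x} \<inter> {v \<in> A. v \<subseteq> x'} = {}"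
      using le_unique_atom[OF b c] A by blast
  qed (use finA part_finite[OF b] in auto)
  finally show "card A = (\<Sum>x\<in>b. card {v \<in> A. v \<subseteq> x})" .
  have "(\<Sum>x\<in>b. of_bool (\<exists>v\<in>A. v \<subseteq> x)) = (\<Sum>x\<in>trace b A. (1::nat))"
    unfolding trace_def using part_finite[OF b] by (simp add: of_bool_def sum.If_cases Int_def)
  then show "card (trace b A) = (\<Sum>x\<in>b. of_bool (\<exists>v\<in>A. v \<subseteq> x))" by simp
qed

lemma card_trace_below:
  assumes b: "part b" and c: "part c" and A: "A \<subseteq> c"
  shows "card {y \<in> trace b A. y \<subseteq> x} \<le> card {v \<in> A. v \<subseteq> x}"
proof -
  \<comment> \<open>the cell of \<open>b\<close> around \<open>v\<close>\<close>
  define Y where "Y v = (SOME y. y \<in> b \<and> v \<subseteq> y)" for v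
  have finA: "finite A" using A c finite_subset by (auto simp: part_def)
  have "{y \<in> trace b A. y \<subseteq> x} \<subseteq> Y ` {v \<in> A. v \<subseteq> x}"
  proof
    fix y assume "y \<in> {y \<in> trace b A. y \<subseteq> x}"
    then obtain v where y: "y \<in> b" "v \<in> A" "v \<subseteq> y" "y \<subseteq> x" by (auto simp: trace_def)
    have "Y v \<in> b \<and> v \<subseteq> Y v"
      unfolding Y_def by (rule someI[of "\<lambda>y. y \<in> b \<and> v \<subseteq> y" y]) (use y in simp)
    then have "Y v = y" using le_unique_atom[OF b c, of v "Y v" y] y A by auto
    then show "y \<in> Y ` {v \<in> A. v \<subseteq> x}" using y by auto
  qed
  then have "card {y \<in> trace b A. y \<subseteq> x} \<le> card (Y ` {v \<in> A. v \<subseteq> x})"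
    using finA by (intro card_mono) auto
  also have "\<dots> \<le> card {v \<in> A. v \<subseteq> x}" using finA by (intro card_image_le) auto
  finally show ?thesis .
qed

lemma card_trace_le:
  assumes b: "part b" and c: "part c" and r: "refines c b" and A: "A \<subseteq> c"
  shows "card (trace b A) \<le> card A"
proof -
  have "finite A" using A c finite_subset by (auto simp: part_def)
  then have "of_bool (\<exists>v\<in>A. v \<subseteq> x) \<le> card {v \<in> A. v \<subseteq> x}" for x
    by (auto simp: of_bool_def Suc_le_eq card_gt_0_iff)
  then show ?thesis unfolding trace_card_sum[OF assms] by (intro sum_mono)
qed

lemma all_le_cmp_iff:
  assumes "part c" "x \<in> B" "resolves c x" "A \<subseteq> c"
  shows "(\<forall>v\<in>A. v \<subseteq> cmp x) \<longleftrightarrow> \<not> (\<exists>v\<in>A. v \<subseteq> x)"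
  using not_le_iff[OF assms(1-3)] assms(4) by blast

section \<open>The expected number of occupied cells\<close>

text \<open>The summand of \<open>x\<close> is the mass of the part of the spectrum of \<open>g\<close> that is not contained in \<open>x'\<close>.  So this is the
  mean number of cells of \<open>b\<close> met by the spectrum, as \<open>kappa_symbol\<close> shows.\<close>

definition kappa :: "'a set set set \<Rightarrow> ('a \<Rightarrow> real) \<Rightarrow> real" where
  "kappa b g = (\<Sum>x\<in>b. sqn (\<lambda>\<omega>. g \<omega> - E (cmp x) g \<omega>))"

lemma kappa_symbol:
  assumes b: "part b" and c: "part c" and r: "refines c b" and F: "decomposes c f F"
    and g: "has_symbol c F g \<phi>"
  shows "kappa b g = (\<Sum>A\<in>Pow c. real (card (trace b A)) * (\<phi> A)\<^sup>2 * sqn (F A))"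
proof -
  have "kappa b g = (\<Sum>x\<in>b. \<Sum>A\<in>Pow c. of_bool (\<exists>v\<in>A. v \<subseteq> x) * (\<phi> A)\<^sup>2 * sqn (F A))"
    unfolding kappa_def
  proof (rule sum.cong[OF refl])
    fix x assume x: "x \<in> b"
    have xB: "x \<in> B" using x part_in_B[OF b] by blast
    have rx: "resolves c x" using r x by (simp add: refines_def)
    have "has_symbol c F (\<lambda>\<omega>. g \<omega> - E (cmp x) g \<omega>) (\<lambda>A. \<phi> A - of_bool (\<forall>v\<in>A. v \<subseteq> cmp x) * \<phi> A)"
      by (intro symbol_diff symbol_E[OF c F] g cmp_B resolves_cmp c xB rx)
    from symbol_sqn[OF c F this]
    have "sqn (\<lambda>\<omega>. g \<omega> - E (cmp x) g \<omega>) =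
      (\<Sum>A\<in>Pow c. (\<phi> A - of_bool (\<forall>v\<in>A. v \<subseteq> cmp x) * \<phi> A)\<^sup>2 * sqn (F A))" .
    also have "\<dots> = (\<Sum>A\<in>Pow c. of_bool (\<exists>v\<in>A. v \<subseteq> x) * (\<phi> A)\<^sup>2 * sqn (F A))"
    proof (rule sum.cong[OF refl])
      fix A assume "A \<in> Pow c"
      then have iff: "(\<forall>v\<in>A. v \<subseteq> cmp x) \<longleftrightarrow> \<not> (\<exists>v\<in>A. v \<subseteq> x)"
        using all_le_cmp_iff[OF c xB rx] by blast
      show "(\<phi> A - of_bool (\<forall>v\<in>A. v \<subseteq> cmp x) * \<phi> A)\<^sup>2 * sqn (F A) =
          of_bool (\<exists>v\<in>A. v \<subseteq> x) * (\<phi> A)\<^sup>2 * sqn (F A)"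
        unfolding iff by (cases "\<exists>v\<in>A. v \<subseteq> x") simp_all
    qed
    finally show "sqn (\<lambda>\<omega>. g \<omega> - E (cmp x) g \<omega>) = \<dots>" .
  qed
  also have "\<dots> = (\<Sum>A\<in>Pow c. \<Sum>x\<in>b. of_bool (\<exists>v\<in>A. v \<subseteq> x) * (\<phi> A)\<^sup>2 * sqn (F A))"
    by (rule sum.swap)
  also have "\<dots> = (\<Sum>A\<in>Pow c. real (card (trace b A)) * (\<phi> A)\<^sup>2 * sqn (F A))"
    by (rule sum.cong[OF refl]) (use trace_card_sum(2)[OF b c r] in \<open>auto simp: sum_distrib_right\<close>)
  finally show ?thesis .
qed

section \<open>The noise operators\<close>

text \<open>The mean of the projections that forget a random union of cells.\<close>

definition noise_op :: "real \<Rightarrow> 'a set set set \<Rightarrow> ('a \<Rightarrow> real) \<Rightarrow> 'a \<Rightarrow> real" where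
  "noise_op \<epsilon> b f \<omega> = (\<Sum>D\<in>Pow b. choice_weight \<epsilon> b D * E (cmp (Join D)) f \<omega>)"

lemma part_Join_B: "part b \<Longrightarrow> D \<subseteq> b \<Longrightarrow> Join D \<in> B"
  by (rule Join_B) (auto simp: part_def)

lemma noise_op_L2: "part b \<Longrightarrow> f \<in> L2 \<Longrightarrow> noise_op \<epsilon> b f \<in> L2"
  unfolding noise_op_def
  by (intro L2_sum L2_scale E_L2 B_sub cmp_B part_Join_B) auto

lemma ip_noise_op:
  assumes b: "part b" and f: "f \<in> L2"
  shows "ip (noise_op \<epsilon> b f) f = (\<Sum>D\<in>Pow b. choice_weight \<epsilon> b D * sqn (E (cmp (Join D)) f))"
proof -
  have s: "cmp (Join D) \<in> sub_fields M" if "D \<in> Pow b" for D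
    using that b by (intro B_sub cmp_B part_Join_B) auto
  have "ip (noise_op \<epsilon> b f) f = (\<Sum>D\<in>Pow b. ip (\<lambda>\<omega>. choice_weight \<epsilon> b D * E (cmp (Join D)) f \<omega>) f)"
    unfolding noise_op_def by (rule ip_sum_left) (use s f in \<open>auto intro!: L2_scale E_L2\<close>)
  also have "\<dots> = (\<Sum>D\<in>Pow b. choice_weight \<epsilon> b D * sqn (E (cmp (Join D)) f))"
    by (intro sum.cong refl) (use s f in \<open>simp add: ip_scale_left ip_E_self\<close>)
  finally show ?thesis .
qed

text \<open>A spectral part survives if none of its cells is forgotten, which has probability
  \<open>1 - \<epsilon>\<close> for each cell.\<close>

lemma noise_op_symbol:
  assumes b: "part b" and c: "part c" and r: "refines c b" and F: "decomposes c f F" and f: "f \<in> L2"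
  shows "has_symbol c F (noise_op \<epsilon> b f) (\<lambda>A. (1 - \<epsilon>) ^ card (trace b A))"
proof -
  have "has_symbol c F (\<lambda>\<omega>. \<Sum>D\<in>Pow b. choice_weight \<epsilon> b D * E (cmp (Join D)) f \<omega>)
     (\<lambda>A. \<Sum>D\<in>Pow b. choice_weight \<epsilon> b D * (of_bool (\<forall>y\<in>trace b A. y \<subseteq> cmp (Join D)) * 1))"
  proof (intro symbol_sum symbol_scale)
    fix D assume D: "D \<in> Pow b"
    show "has_symbol c F (E (cmp (Join D)) f) (\<lambda>A. of_bool (\<forall>y\<in>trace b A. y \<subseteq> cmp (Join D)) * 1)"
      by (rule symbol_E_coarse[OF b c r F, where \<phi>="\<lambda>_. 1"])
         (use D symbol_self[OF F f] part_Join_B[OF b] part_Join(1)[OF b] in \<open>auto intro: cmp_B resolves_cmp[OF b]\<close>)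
  qed (use part_finite[OF b] in simp)
  then have "has_symbol c F (noise_op \<epsilon> b f)
     (\<lambda>A. \<Sum>D\<in>Pow b. choice_weight \<epsilon> b D * (of_bool (\<forall>y\<in>trace b A. y \<subseteq> cmp (Join D)) * 1))"
    by (simp add: noise_op_def[abs_def])
  then show ?thesis
  proof (rule symbol_cong)
    fix A
    have "(\<Sum>D\<in>Pow b. choice_weight \<epsilon> b D * (of_bool (\<forall>y\<in>trace b A. y \<subseteq> cmp (Join D)) * 1)) =
       (\<Sum>D\<in>Pow b. choice_weight \<epsilon> b D * of_bool (D \<inter> trace b A = {}))"
    proof (rule sum.cong[OF refl])
      fix D assume D: "D \<in> Pow b"
      have "(\<forall>y\<in>trace b A. y \<subseteq> cmp (Join D)) \<longleftrightarrow> \<not> (\<exists>y\<in>trace b A. y \<subseteq> Join D)"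
        by (rule all_le_cmp_iff[OF b]) (use D b trace_subset in \<open>auto intro: part_Join_B part_Join\<close>)
      also have "\<dots> \<longleftrightarrow> D \<inter> trace b A = {}"
        using part_Join(2)[OF b, of D] D trace_subset[of b A] by blast
      finally show "choice_weight \<epsilon> b D * (of_bool (\<forall>y\<in>trace b A. y \<subseteq> cmp (Join D)) * 1) =
         choice_weight \<epsilon> b D * of_bool (D \<inter> trace b A = {})" by simp
    qed
    then show "(\<Sum>D\<in>Pow b. choice_weight \<epsilon> b D * (of_bool (\<forall>y\<in>trace b A. y \<subseteq> cmp (Join D)) * 1)) =
       (1 - \<epsilon>) ^ card (trace b A)"
      using choice_avoid[OF part_finite[OF b] trace_subset] by simp
  qed
qed

text \<open>Under refinement the symbol decreases within \<open>[0, 1]\<close>, and \<open>t\<^sup>2 \<le> t\<close> there.\<close>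

lemma noise_op_cauchy:
  assumes b: "part b" and c: "part c" and r: "refines c b" and f: "f \<in> L2" and \<epsilon>: "0 \<le> \<epsilon>" "\<epsilon> \<le> 1"
  shows "sqn (\<lambda>\<omega>. noise_op \<epsilon> b f \<omega> - noise_op \<epsilon> c f \<omega>) \<le> ip (noise_op \<epsilon> b f) f - ip (noise_op \<epsilon> c f) f"
proof -
  obtain F where F: "decomposes c f F" using decomposition_exists[OF c f] .
  define p where "p A = (1 - \<epsilon>) ^ card (trace b A)" for A
  define q where "q A = (1 - \<epsilon>) ^ card (trace c A)" for A
  note sb = noise_op_symbol[OF b c r F f, of \<epsilon>, folded p_def]
  note sc = noise_op_symbol[OF c c refines_refl[OF c] F f, of \<epsilon>, folded q_def]
  note s1 = symbol_self[OF F f]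
  have "sqn (\<lambda>\<omega>. noise_op \<epsilon> b f \<omega> - noise_op \<epsilon> c f \<omega>) = (\<Sum>A\<in>Pow c. (p A - q A)\<^sup>2 * sqn (F A))"
    by (rule symbol_sqn[OF c F symbol_diff[OF sb sc]])
  also have "\<dots> \<le> (\<Sum>A\<in>Pow c. (p A * 1 * sqn (F A) - q A * 1 * sqn (F A)))"
  proof (rule sum_mono)
    fix A assume "A \<in> Pow c"
    then have "q A \<le> p A" "p A \<le> 1" "0 \<le> q A"
      using card_trace_le[OF b c r, of A] trace_self[OF c, of A] \<epsilon>
      by (auto simp: p_def q_def power_decreasing power_le_one)
    then have "(p A - q A)\<^sup>2 \<le> p A - q A"
      by (simp add: power2_eq_square mult_left_le)
    then have "(p A - q A)\<^sup>2 * sqn (F A) \<le> (p A - q A) * sqn (F A)"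
      by (rule mult_right_mono) (rule sqn_nonneg)
    then show "(p A - q A)\<^sup>2 * sqn (F A) \<le> p A * 1 * sqn (F A) - q A * 1 * sqn (F A)"
      by (simp add: left_diff_distrib)
  qed
  also have "\<dots> = ip (noise_op \<epsilon> b f) f - ip (noise_op \<epsilon> c f) f"
    unfolding symbol_ip[OF c F sb s1] symbol_ip[OF c F sc s1] sum_subtractf ..
  finally show ?thesis .
qed

text \<open>The bound does not depend on the partitions: large numbers of cells are suppressed by the symbol
  of the noise operator.\<close>

lemma kappa_noise_op:
  assumes b: "part b" and c: "part c" and r: "refines c b" and f: "f \<in> L2" and \<epsilon>: "0 < \<epsilon>" "\<epsilon> \<le> 1"
  shows "kappa b (noise_op \<epsilon> c f) \<le> sqn f / \<epsilon>"
proof -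
  obtain F where F: "decomposes c f F" using decomposition_exists[OF c f] .
  note sc = noise_op_symbol[OF c c refines_refl[OF c] F f, of \<epsilon>]
  have "kappa b (noise_op \<epsilon> c f) = (\<Sum>A\<in>Pow c. real (card (trace b A)) * ((1 - \<epsilon>) ^ card (trace c A))\<^sup>2 * sqn (F A))"
    by (rule kappa_symbol[OF b c r F sc])
  also have "\<dots> \<le> (\<Sum>A\<in>Pow c. 1 / \<epsilon> * (1\<^sup>2 * sqn (F A)))"
  proof (rule sum_mono)
    fix A assume A: "A \<in> Pow c"
    have "real (card (trace b A)) * ((1 - \<epsilon>) ^ card (trace c A))\<^sup>2 \<le> real (card A) * ((1 - \<epsilon>) ^ card A)\<^sup>2"
      using card_trace_le[OF b c r, of A] trace_self[OF c, of A] A by (intro mult_mono) auto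
    also have "\<dots> \<le> 1 / \<epsilon>"
      using power_times_exponent_le[of "1 - \<epsilon>" "card A"] \<epsilon> by simp
    finally show "real (card (trace b A)) * ((1 - \<epsilon>) ^ card (trace c A))\<^sup>2 * sqn (F A) \<le> 1 / \<epsilon> * (1\<^sup>2 * sqn (F A))"
      using mult_right_mono[OF _ sqn_nonneg[of "F A"]] by fastforce
  qed
  also have "\<dots> = sqn f / \<epsilon>"
    unfolding symbol_sqn[OF c F symbol_self[OF F f]] by (simp add: sum_divide_distrib)
  finally show ?thesis .
qed

section \<open>At most one occupied cell inside a given field\<close>

text \<open>The projection to the part of the spectrum that meets at most one of the cells of \<open>b\<close> inside
  \<open>x\<close>: either none, or exactly one cell \<open>y\<close>.  Outside \<open>x\<close> the spectrum is unrestricted.\<close>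

definition at_most_one :: "'a set set \<Rightarrow> 'a set set set \<Rightarrow> ('a \<Rightarrow> real) \<Rightarrow> 'a \<Rightarrow> real" where
  "at_most_one x b g \<omega> = E (cmp x) g \<omega> + (\<Sum>y\<in>{y \<in> b. y \<subseteq> x}. E (y \<squnion>\<^sub>M cmp x) g \<omega> - E (cmp x) g \<omega>)"

lemma at_most_one_formula:
  assumes b: "part b" and x: "x \<in> B" "resolves b x" and A: "A \<subseteq> b"
  shows "of_bool (\<forall>v\<in>A. v \<subseteq> cmp x) + (\<Sum>y\<in>{y \<in> b. y \<subseteq> x}. of_bool (\<forall>v\<in>A. v \<subseteq> y \<squnion>\<^sub>M cmp x) - of_bool (\<forall>v\<in>A. v \<subseteq> cmp x))
     = (of_bool (card {v \<in> A. v \<subseteq> x} \<le> 1) :: real)"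
proof -
  define N where "N = {v \<in> A. v \<subseteq> x}"
  define S where "S = {y \<in> b. y \<subseteq> x}"
  have "finite A" using part_finite[OF b] A finite_subset by blast
  then have fin: "finite S" "finite N" using part_finite[OF b] by (auto simp: S_def N_def)
  have 1: "(\<forall>v\<in>A. v \<subseteq> cmp x) \<longleftrightarrow> N = {}"
    using all_le_cmp_iff[OF b x A] by (auto simp: N_def)
  have 2: "(\<forall>v\<in>A. v \<subseteq> y \<squnion>\<^sub>M cmp x) \<longleftrightarrow> N \<subseteq> {y}" if y: "y \<in> S" for y
  proof -
    have yb: "y \<in> b" using y by (simp add: S_def)
    have "v \<subseteq> y \<squnion>\<^sub>M cmp x \<longleftrightarrow> v = y \<or> \<not> v \<subseteq> x" if "v \<in> A" for v
    proof -
      have v: "v \<in> b" using that A by auto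
      have "v \<subseteq> y \<squnion>\<^sub>M cmp x \<longleftrightarrow> v \<subseteq> y \<or> v \<subseteq> cmp x"
        by (rule resolves_join(2)[OF b part_in_B[OF b yb] cmp_B[OF x(1)] resolves_self[OF b yb] resolves_cmp[OF b x] v])
      then show ?thesis using part_le_iff[OF b yb v] not_le_iff[OF b x v] by blast
    qed
    then show ?thesis by (auto simp: N_def)
  qed
  have "of_bool (\<forall>v\<in>A. v \<subseteq> cmp x) + (\<Sum>y\<in>S. of_bool (\<forall>v\<in>A. v \<subseteq> y \<squnion>\<^sub>M cmp x) - of_bool (\<forall>v\<in>A. v \<subseteq> cmp x))
     = of_bool (N = {}) + (\<Sum>y\<in>S. of_bool (N \<subseteq> {y}) - of_bool (N = {}) :: real)"
    using 1 2 by simp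
  also have "\<dots> = of_bool (card N \<le> 1)"
  proof -
    consider "N = {}" | y where "N = {y}" | "card N > 1"
      using empty_or_singleton_or_larger[OF fin(2)] by blast
    then show ?thesis
    proof cases
      case 1 then show ?thesis by simp
    next
      case (2 y)
      then have "y \<in> S" using A by (auto simp: N_def S_def)
      moreover have "(\<Sum>v\<in>S. of_bool (N \<subseteq> {v}) - of_bool (N = {}) :: real) = (\<Sum>v\<in>S. if v = y then 1 else 0)"
        using 2 by (intro sum.cong) auto
      ultimately show ?thesis using 2 fin by simp
    next
      case 3
      then have "N \<noteq> {}" "\<not> N \<subseteq> {y}" for y using card_mono[of "{y}" N] by auto
      then show ?thesis using 3 by simp
    qed
  qed
  finally show ?thesis by (simp add: S_def N_def)
qed

lemma at_most_one_symbol: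
  assumes b: "part b" and c: "part c" and r: "refines c b" and F: "decomposes c g F" and g: "g \<in> L2"
    and x: "x \<in> B" "resolves b x"
  shows "has_symbol c F (at_most_one x b g) (\<lambda>A. of_bool (card {y \<in> trace b A. y \<subseteq> x} \<le> 1))"
proof -
  have 1: "has_symbol c F (E z g) (\<lambda>A. of_bool (\<forall>y\<in>trace b A. y \<subseteq> z))" if "z \<in> B" "resolves b z" for z
    using symbol_E_coarse[OF b c r F that, where \<phi>="\<lambda>_. 1"] symbol_self[OF F g] by simp
  have x': "cmp x \<in> B" "resolves b (cmp x)" using cmp_B[OF x(1)] resolves_cmp[OF b x] by auto
  have y': "y \<squnion>\<^sub>M cmp x \<in> B" "resolves b (y \<squnion>\<^sub>M cmp x)" if "y \<in> b" for y
    using join_B[OF part_in_B[OF b that] x'(1)]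
      resolves_join(1)[OF b part_in_B[OF b that] x'(1) resolves_self[OF b that] x'(2)] by auto
  have "has_symbol c F (at_most_one x b g) (\<lambda>A. of_bool (\<forall>v\<in>trace b A. v \<subseteq> cmp x) +
     (\<Sum>y\<in>{y \<in> b. y \<subseteq> x}. of_bool (\<forall>v\<in>trace b A. v \<subseteq> y \<squnion>\<^sub>M cmp x) - of_bool (\<forall>v\<in>trace b A. v \<subseteq> cmp x)))"
    unfolding at_most_one_def[abs_def]
    by (intro symbol_add symbol_sum symbol_diff 1) (use x' y' part_finite[OF b] in auto)
  then show ?thesis
    by (rule symbol_cong) (rule at_most_one_formula[OF b x trace_subset])
qed

lemma at_most_one_L2:
  assumes "part b" "g \<in> L2" "x \<in> B" "resolves b x" shows "at_most_one x b g \<in> L2"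
proof -
  obtain F where "decomposes b g F" using decomposition_exists[OF assms(1,2)] .
  from at_most_one_symbol[OF assms(1,1) refines_refl[OF assms(1)] this assms(2-4)]
  show ?thesis by (simp add: has_symbol_def)
qed

lemma at_most_one_symbol_self:
  assumes c: "part c" and F: "decomposes c g F" and g: "g \<in> L2" and x: "x \<in> B" "resolves c x"
  shows "has_symbol c F (at_most_one x c g) (\<lambda>A. of_bool (card {y \<in> A. y \<subseteq> x} \<le> 1))"
  by (rule symbol_cong[OF at_most_one_symbol[OF c c refines_refl[OF c] F g x]]) (simp add: trace_self[OF c])

lemma at_most_one_cauchy:
  assumes b: "part b" and c: "part c" and r: "refines c b" and g: "g \<in> L2" and x: "x \<in> B" "resolves b x"
  shows "sqn (\<lambda>\<omega>. at_most_one x b g \<omega> - at_most_one x c g \<omega>) \<le> ip (at_most_one x b g) g - ip (at_most_one x c g) g"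
proof -
  obtain F where F: "decomposes c g F" using decomposition_exists[OF c g] .
  define p :: "_ \<Rightarrow> real" where "p A = of_bool (card {y \<in> trace b A. y \<subseteq> x} \<le> 1)" for A
  define q :: "_ \<Rightarrow> real" where "q A = of_bool (card {y \<in> A. y \<subseteq> x} \<le> 1)" for A
  note sb = at_most_one_symbol[OF b c r F g x, folded p_def]
  note sc = at_most_one_symbol_self[OF c F g x(1) refines_trans[OF b c r x], folded q_def]
  note s1 = symbol_self[OF F g]
  have "sqn (\<lambda>\<omega>. at_most_one x b g \<omega> - at_most_one x c g \<omega>) = (\<Sum>A\<in>Pow c. (p A - q A)\<^sup>2 * sqn (F A))"
    by (rule symbol_sqn[OF c F symbol_diff[OF sb sc]])
  also have "\<dots> = (\<Sum>A\<in>Pow c. (p A * 1 * sqn (F A) - q A * 1 * sqn (F A)))"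
  proof (rule sum.cong[OF refl])
    fix A assume "A \<in> Pow c"
    then have "card {y \<in> trace b A. y \<subseteq> x} \<le> card {y \<in> A. y \<subseteq> x}"
      using card_trace_below[OF b c] by simp
    then show "(p A - q A)\<^sup>2 * sqn (F A) = p A * 1 * sqn (F A) - q A * 1 * sqn (F A)"
      by (auto simp: p_def q_def)
  qed
  also have "\<dots> = ip (at_most_one x b g) g - ip (at_most_one x c g) g"
    unfolding symbol_ip[OF c F sb s1] symbol_ip[OF c F sc s1] sum_subtractf ..
  finally show ?thesis by simp
qed

text \<open>This identity says that no spectral point meets both \<open>y\<close> and the rest of \<open>x\<close>.  It involves no
  partition, so it survives the limit over refinements.\<close>

lemma at_most_one_relation:
  assumes c: "part c" and g: "g \<in> L2" and x: "x \<in> B" "resolves c x" and y: "y \<in> B" "resolves c y" "y \<subseteq> x"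
  defines "u \<equiv> at_most_one x c g"
  shows "sqn (\<lambda>\<omega>. (u \<omega> + E (cmp x) u \<omega>) - (E (y \<squnion>\<^sub>M cmp x) u \<omega> + E (cmp y) u \<omega>)) = 0"
proof -
  obtain F where F: "decomposes c g F" using decomposition_exists[OF c g] .
  define q :: "_ \<Rightarrow> real" where "q A = of_bool (card {v \<in> A. v \<subseteq> x} \<le> 1)" for A
  note sc = at_most_one_symbol_self[OF c F g x, folded q_def u_def]
  have "has_symbol c F (\<lambda>\<omega>. (u \<omega> + E (cmp x) u \<omega>) - (E (y \<squnion>\<^sub>M cmp x) u \<omega> + E (cmp y) u \<omega>))
    (\<lambda>A. (q A + of_bool (\<forall>v\<in>A. v \<subseteq> cmp x) * q A) -
       (of_bool (\<forall>v\<in>A. v \<subseteq> y \<squnion>\<^sub>M cmp x) * q A + of_bool (\<forall>v\<in>A. v \<subseteq> cmp y) * q A))"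
    by (intro symbol_diff symbol_add symbol_E[OF c F] sc c cmp_B join_B x y resolves_cmp resolves_join(1))
  then have "has_symbol c F (\<lambda>\<omega>. (u \<omega> + E (cmp x) u \<omega>) - (E (y \<squnion>\<^sub>M cmp x) u \<omega> + E (cmp y) u \<omega>)) (\<lambda>A. 0)"
  proof (rule symbol_cong)
    fix A assume A: "A \<subseteq> c"
    define N where "N = {v \<in> A. v \<subseteq> x}"
    have "finite A" using part_finite[OF c] A finite_subset by blast
    then have finN: "finite N" by (simp add: N_def)
    have 1: "(\<forall>v\<in>A. v \<subseteq> cmp x) \<longleftrightarrow> N = {}" using all_le_cmp_iff[OF c x A] by (auto simp: N_def)
    have 2: "(\<forall>v\<in>A. v \<subseteq> cmp y) \<longleftrightarrow> (\<forall>v\<in>N. \<not> v \<subseteq> y)"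
    proof -
      have "v \<subseteq> x" if "v \<subseteq> y" for v using that y(3) by (rule order.trans)
      then show ?thesis unfolding all_le_cmp_iff[OF c y(1,2) A] N_def by blast
    qed
    have "v \<subseteq> y \<squnion>\<^sub>M cmp x \<longleftrightarrow> v \<subseteq> y \<or> \<not> v \<subseteq> x" if "v \<in> A" for v
    proof -
      have v: "v \<in> c" using that A by auto
      show ?thesis
        using resolves_join(2)[OF c y(1) cmp_B[OF x(1)] y(2) resolves_cmp[OF c x] v] not_le_iff[OF c x v] by blast
    qed
    then have 3: "(\<forall>v\<in>A. v \<subseteq> y \<squnion>\<^sub>M cmp x) \<longleftrightarrow> (\<forall>v\<in>N. v \<subseteq> y)" by (auto simp: N_def)
    consider "N = {}" | v where "N = {v}" | "card N > 1"
      using empty_or_singleton_or_larger[OF finN] by blast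
    then show "(q A + of_bool (\<forall>v\<in>A. v \<subseteq> cmp x) * q A) -
       (of_bool (\<forall>v\<in>A. v \<subseteq> y \<squnion>\<^sub>M cmp x) * q A + of_bool (\<forall>v\<in>A. v \<subseteq> cmp y) * q A) = 0"
      unfolding 1 2 3
    proof cases
      case 3
      then have "q A = 0" by (simp add: q_def N_def)
      then show "(q A + of_bool (N = {}) * q A) -
       (of_bool (\<forall>v\<in>N. v \<subseteq> y) * q A + of_bool (\<forall>v\<in>N. \<not> v \<subseteq> y) * q A) = 0" by simp
    qed auto
  qed
  from symbol_sqn[OF c F this] show ?thesis by simp
qed

text \<open>A cell \<open>x\<close> of \<open>b\<close> that contains \<open>n \<ge> 2\<close> occupied cells of \<open>c\<close> contributes \<open>n - 1 \<ge> 1\<close> to the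
  growth of the number of occupied cells.\<close>

lemma sum_at_most_one_residual:
  assumes b: "part b" and c: "part c" and r: "refines c b" and g: "g \<in> L2"
  shows "(\<Sum>x\<in>b. sqn (\<lambda>\<omega>. g \<omega> - at_most_one x c g \<omega>)) \<le> kappa c g - kappa b g"
proof -
  obtain F where F: "decomposes c g F" using decomposition_exists[OF c g] .
  note s1 = symbol_self[OF F g]
  have "(\<Sum>x\<in>b. sqn (\<lambda>\<omega>. g \<omega> - at_most_one x c g \<omega>)) = (\<Sum>x\<in>b. \<Sum>A\<in>Pow c. of_bool (2 \<le> card {v \<in> A. v \<subseteq> x}) * sqn (F A))"
  proof (rule sum.cong[OF refl])
    fix x assume x: "x \<in> b"
    have xB: "x \<in> B" "resolves c x" using x part_in_B[OF b] r by (auto simp: refines_def)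
    have "sqn (\<lambda>\<omega>. g \<omega> - at_most_one x c g \<omega>) = (\<Sum>A\<in>Pow c. (1 - of_bool (card {v \<in> A. v \<subseteq> x} \<le> 1))\<^sup>2 * sqn (F A))"
      by (rule symbol_sqn[OF c F symbol_diff[OF s1 at_most_one_symbol_self[OF c F g xB]]])
    then show "sqn (\<lambda>\<omega>. g \<omega> - at_most_one x c g \<omega>) = (\<Sum>A\<in>Pow c. of_bool (2 \<le> card {v \<in> A. v \<subseteq> x}) * sqn (F A))"
      by (simp add: of_bool_def if_distrib not_le cong: if_cong) (rule sum.cong; auto)
  qed
  also have "\<dots> = (\<Sum>A\<in>Pow c. (\<Sum>x\<in>b. of_bool (2 \<le> card {v \<in> A. v \<subseteq> x})) * sqn (F A))"
    by (subst sum.swap) (simp add: sum_distrib_right)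
  also have "\<dots> \<le> (\<Sum>A\<in>Pow c. real (card (trace c A)) * 1\<^sup>2 * sqn (F A) - real (card (trace b A)) * 1\<^sup>2 * sqn (F A))"
  proof (rule sum_mono)
    fix A assume A: "A \<in> Pow c"
    then have fin: "finite A" using part_finite[OF c] finite_subset by auto
    have "(\<Sum>x\<in>b. of_bool (2 \<le> card {v \<in> A. v \<subseteq> x})) \<le>
        (\<Sum>x\<in>b. real (card {v \<in> A. v \<subseteq> x}) - of_bool (\<exists>v\<in>A. v \<subseteq> x))"
    proof (rule sum_mono)
      fix x
      have "1 \<le> card {v \<in> A. v \<subseteq> x}" if "\<exists>v\<in>A. v \<subseteq> x"
        using fin that by (auto simp: Suc_le_eq card_gt_0_iff)
      then show "of_bool (2 \<le> card {v \<in> A. v \<subseteq> x}) \<le> real (card {v \<in> A. v \<subseteq> x}) - of_bool (\<exists>v\<in>A. v \<subseteq> x)"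
        by (cases "\<exists>v\<in>A. v \<subseteq> x") (simp_all add: of_bool_def)
    qed
    also have "\<dots> = real (card A) - real (card (trace b A))"
      using trace_card_sum[OF b c r, of A] A by (simp add: sum_subtractf)
    finally have "(\<Sum>x\<in>b. of_bool (2 \<le> card {v \<in> A. v \<subseteq> x})) * sqn (F A) \<le> (real (card A) - real (card (trace b A))) * sqn (F A)"
      by (rule mult_right_mono) (rule sqn_nonneg)
    then show "(\<Sum>x\<in>b. of_bool (2 \<le> card {v \<in> A. v \<subseteq> x})) * sqn (F A) \<le>
       real (card (trace c A)) * 1\<^sup>2 * sqn (F A) - real (card (trace b A)) * 1\<^sup>2 * sqn (F A)"
      using trace_self[OF c, of A] A by (simp add: left_diff_distrib)
  qed
  also have "\<dots> = kappa c g - kappa b g"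
    unfolding kappa_symbol[OF b c r F s1] kappa_symbol[OF c c refines_refl[OF c] F s1] sum_subtractf ..
  finally show ?thesis .
qed

section \<open>Choosing a small element that meets almost all the spectrum\<close>

text \<open>A spectral part inside the join of \<open>u\<close> with the chosen cells, but not inside \<open>u\<close>, has a cell outside \<open>u\<close>,
  and this cell must have been chosen.\<close>

lemma random_join_small:
  assumes c: "part c" and u: "u \<in> B" "resolves c u" and d: "d \<in> L2" and \<epsilon>: "0 \<le> \<epsilon>" "\<epsilon> \<le> 1"
  shows "(\<Sum>D\<in>Pow c. choice_weight \<epsilon> c D * (sqn (E (u \<squnion>\<^sub>M Join D) d) - sqn (E u d))) \<le> \<epsilon> * sqn d"
proof -
  obtain F where F: "decomposes c d F" using decomposition_exists[OF c d] .
  note s1 = symbol_self[OF F d]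
  have E: "sqn (E z d) = (\<Sum>A\<in>Pow c. of_bool (\<forall>v\<in>A. v \<subseteq> z) * sqn (F A))" if "z \<in> B" "resolves c z" for z
  proof -
    have "(of_bool P * 1)\<^sup>2 = (of_bool P :: real)" for P by (cases P) auto
    then show ?thesis using symbol_sqn[OF c F symbol_E[OF c F that s1]] by simp
  qed
  have JB: "Join D \<in> B" "resolves c (Join D)" if "D \<in> Pow c" for D
    using that part_Join_B[OF c] part_Join[OF c] by auto
  have "(\<Sum>D\<in>Pow c. choice_weight \<epsilon> c D * (sqn (E (u \<squnion>\<^sub>M Join D) d) - sqn (E u d)))
    = (\<Sum>D\<in>Pow c. \<Sum>A\<in>Pow c. choice_weight \<epsilon> c D * (of_bool (\<forall>v\<in>A. v \<subseteq> u \<squnion>\<^sub>M Join D) - of_bool (\<forall>v\<in>A. v \<subseteq> u)) * sqn (F A))"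
  proof (rule sum.cong[OF refl])
    fix D assume D: "D \<in> Pow c"
    show "choice_weight \<epsilon> c D * (sqn (E (u \<squnion>\<^sub>M Join D) d) - sqn (E u d)) =
      (\<Sum>A\<in>Pow c. choice_weight \<epsilon> c D * (of_bool (\<forall>v\<in>A. v \<subseteq> u \<squnion>\<^sub>M Join D) - of_bool (\<forall>v\<in>A. v \<subseteq> u)) * sqn (F A))"
      unfolding E[OF u] E[OF join_B[OF u(1) JB(1)[OF D]] resolves_join(1)[OF c u(1) JB(1)[OF D] u(2) JB(2)[OF D]]]
      by (simp add: sum_distrib_left mult.assoc left_diff_distrib right_diff_distrib sum_subtractf)
  qed
  also have "\<dots> = (\<Sum>A\<in>Pow c. (\<Sum>D\<in>Pow c. choice_weight \<epsilon> c D * (of_bool (\<forall>v\<in>A. v \<subseteq> u \<squnion>\<^sub>M Join D) - of_bool (\<forall>v\<in>A. v \<subseteq> u))) * sqn (F A))"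
    by (subst sum.swap) (simp add: sum_distrib_right)
  also have "\<dots> \<le> (\<Sum>A\<in>Pow c. \<epsilon> * (1\<^sup>2 * sqn (F A)))"
  proof (rule sum_mono)
    fix A assume A: "A \<in> Pow c"
    have "(\<Sum>D\<in>Pow c. choice_weight \<epsilon> c D * (of_bool (\<forall>v\<in>A. v \<subseteq> u \<squnion>\<^sub>M Join D) - of_bool (\<forall>v\<in>A. v \<subseteq> u))) \<le> \<epsilon>"
    proof (cases "\<forall>v\<in>A. v \<subseteq> u")
      case True
      then have "\<forall>v\<in>A. v \<subseteq> u \<squnion>\<^sub>M Join D" for D using join_upper1[of u "Join D"] by blast
      then show ?thesis using True \<epsilon> by simp
    next
      case False
      then obtain a where a: "a \<in> A" "\<not> a \<subseteq> u" by blast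
      have ac: "a \<in> c" using a A by auto
      have "(\<Sum>D\<in>Pow c. choice_weight \<epsilon> c D * (of_bool (\<forall>v\<in>A. v \<subseteq> u \<squnion>\<^sub>M Join D) - of_bool (\<forall>v\<in>A. v \<subseteq> u)))
        \<le> (\<Sum>D\<in>Pow c. choice_weight \<epsilon> c D * of_bool (a \<in> D))"
      proof (intro sum_mono mult_left_mono choice_weight_nonneg \<epsilon>)
        fix D assume D: "D \<in> Pow c"
        have "a \<in> D" if "\<forall>v\<in>A. v \<subseteq> u \<squnion>\<^sub>M Join D"
          using resolves_join(2)[OF c u(1) JB(1)[OF D] u(2) JB(2)[OF D] ac] that a
            part_Join(2)[OF c _ ac, of D] D by blast
        then show "of_bool (\<forall>v\<in>A. v \<subseteq> u \<squnion>\<^sub>M Join D) - of_bool (\<forall>v\<in>A. v \<subseteq> u) \<le> (of_bool (a \<in> D) :: real)"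
          by (auto simp: of_bool_def)
      qed
      also have "\<dots> = \<epsilon>" by (rule choice_contains[OF part_finite[OF c] ac])
      finally show ?thesis .
    qed
    then show "(\<Sum>D\<in>Pow c. choice_weight \<epsilon> c D * (of_bool (\<forall>v\<in>A. v \<subseteq> u \<squnion>\<^sub>M Join D) - of_bool (\<forall>v\<in>A. v \<subseteq> u))) * sqn (F A)
       \<le> \<epsilon> * (1\<^sup>2 * sqn (F A))"
      using mult_right_mono[OF _ sqn_nonneg[of "F A"]] by fastforce
  qed
  also have "\<dots> = \<epsilon> * sqn d"
    unfolding symbol_sqn[OF c F s1] by (simp add: sum_distrib_left)
  finally show ?thesis .
qed

text \<open>The probabilistic method: all the quantities to be bounded are nonnegative and their sum has a mean
  below \<open>\<delta>\<close>, so some choice of cells makes each of them smaller than \<open>\<delta>\<close>.\<close>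

lemma small_element_exists:
  assumes f: "f \<in> L2" and vanish: "\<And>\<epsilon> \<eta>. 0 < \<epsilon> \<Longrightarrow> \<epsilon> < 1 \<Longrightarrow> 0 < \<eta> \<Longrightarrow> \<exists>b. part b \<and> ip (noise_op \<epsilon> b f) f < \<eta>"
    and U: "finite U" "U \<subseteq> B" and Ds: "finite Ds" "Ds \<subseteq> L2" and \<delta>: "\<delta> > 0"
  obtains r where "r \<in> B" "sqn (E (cmp r) f) < \<delta>"
    "\<And>u d. u \<in> U \<Longrightarrow> d \<in> Ds \<Longrightarrow> sqn (E (u \<squnion>\<^sub>M r) d) < sqn (E u d) + \<delta>"
proof -
  define S where "S = (\<Sum>u\<in>U. \<Sum>d\<in>Ds. sqn d)"
  have S0: "0 \<le> S" unfolding S_def by (intro sum_nonneg sqn_nonneg)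
  \<comment> \<open>small enough for the total growth of the \<open>sqn (E u d)\<close> to cost at most \<open>\<delta> / 2\<close> on average\<close>
  define \<epsilon> where "\<epsilon> = min (1/2) (\<delta> / (2 * (S + 1)))"
  have \<epsilon>: "0 < \<epsilon>" "\<epsilon> < 1" using \<delta> S0 by (auto simp: \<epsilon>_def min_def)
  have "\<epsilon> * S \<le> \<delta> / (2 * (S + 1)) * S" using S0 by (intro mult_right_mono) (auto simp: \<epsilon>_def)
  also have "\<dots> \<le> \<delta> / 2" using \<delta> S0 by (simp add: field_simps)
  finally have \<epsilon>S: "\<epsilon> * S \<le> \<delta> / 2" .
  obtain b where b: "part b" "ip (noise_op \<epsilon> b f) f < \<delta> / 2" using vanish[OF \<epsilon>, of "\<delta> / 2"] \<delta> by auto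
  obtain c where c: "part c" "refines c b" "\<And>u. u \<in> U \<Longrightarrow> resolves c u" using resolving_part[OF b(1) U] by blast
  have small: "ip (noise_op \<epsilon> c f) f < \<delta> / 2"
    using noise_op_cauchy[OF b(1) c(1,2) f, of \<epsilon>] \<epsilon> b(2) sqn_nonneg[of "\<lambda>\<omega>. noise_op \<epsilon> b f \<omega> - noise_op \<epsilon> c f \<omega>"] by simp
  \<comment> \<open>the sum of everything that has to be small if the cells in \<open>D\<close> are chosen\<close>
  define X where "X D = sqn (E (cmp (Join D)) f) + (\<Sum>u\<in>U. \<Sum>d\<in>Ds. sqn (E (u \<squnion>\<^sub>M Join D) d) - sqn (E u d))" for D
  let ?w = "choice_weight \<epsilon> c"
  have "(\<Sum>D\<in>Pow c. ?w D * X D) = (\<Sum>D\<in>Pow c. ?w D * sqn (E (cmp (Join D)) f)) +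
     (\<Sum>D\<in>Pow c. \<Sum>u\<in>U. \<Sum>d\<in>Ds. ?w D * (sqn (E (u \<squnion>\<^sub>M Join D) d) - sqn (E u d)))"
    by (simp add: X_def distrib_left sum.distrib sum_distrib_left)
  also have "(\<Sum>D\<in>Pow c. \<Sum>u\<in>U. \<Sum>d\<in>Ds. ?w D * (sqn (E (u \<squnion>\<^sub>M Join D) d) - sqn (E u d))) =
     (\<Sum>u\<in>U. \<Sum>d\<in>Ds. \<Sum>D\<in>Pow c. ?w D * (sqn (E (u \<squnion>\<^sub>M Join D) d) - sqn (E u d)))"
    by (subst sum.swap) (intro sum.cong refl sum.swap)
  also have "\<dots> \<le> (\<Sum>u\<in>U. \<Sum>d\<in>Ds. \<epsilon> * sqn d)"
    by (intro sum_mono random_join_small[OF c(1)]) (use U Ds c \<epsilon> in auto)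
  also have "\<dots> = \<epsilon> * S" by (simp add: S_def sum_distrib_left mult.left_commute)
  also have "(\<Sum>D\<in>Pow c. ?w D * sqn (E (cmp (Join D)) f)) = ip (noise_op \<epsilon> c f) f"
    by (rule ip_noise_op[OF c(1) f, symmetric])
  finally have total: "(\<Sum>D\<in>Pow c. ?w D * X D) < \<delta>" using small \<epsilon>S by linarith
  have "\<exists>D\<in>Pow c. X D < \<delta>"
  proof (rule ccontr)
    assume "\<not> ?thesis"
    then have "(\<Sum>D\<in>Pow c. ?w D * \<delta>) \<le> (\<Sum>D\<in>Pow c. ?w D * X D)"
      using \<epsilon> by (intro sum_mono mult_left_mono choice_weight_nonneg) (auto simp: not_less)
    then show False
      using total choice_total[OF part_finite[OF c(1)], of \<epsilon>] by (simp flip: sum_distrib_right)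
  qed
  then obtain D where D: "D \<subseteq> c" "X D < \<delta>" by blast
  have JB: "Join D \<in> B" by (rule part_Join_B[OF c(1) D(1)])
  have nonneg: "0 \<le> sqn (E (u \<squnion>\<^sub>M Join D) d) - sqn (E u d)" if "u \<in> U" "d \<in> Ds" for u d
    using sqn_E_mono[of u "u \<squnion>\<^sub>M Join D" d] that U Ds JB join_upper1 by (auto simp: B_sub join_B subset_iff)
  show ?thesis
  proof (rule that[OF JB])
    have "0 \<le> (\<Sum>u\<in>U. \<Sum>d\<in>Ds. sqn (E (u \<squnion>\<^sub>M Join D) d) - sqn (E u d))"
      by (intro sum_nonneg nonneg)
    then show "sqn (E (cmp (Join D)) f) < \<delta>" using D(2) by (simp add: X_def)
    fix u d assume ud: "u \<in> U" "d \<in> Ds"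
    have "sqn (E (u \<squnion>\<^sub>M Join D) d) - sqn (E u d) \<le> (\<Sum>d\<in>Ds. sqn (E (u \<squnion>\<^sub>M Join D) d) - sqn (E u d))"
      by (rule member_le_sum) (use ud nonneg Ds in auto)
    also have "\<dots> \<le> (\<Sum>u\<in>U. \<Sum>d\<in>Ds. sqn (E (u \<squnion>\<^sub>M Join D) d) - sqn (E u d))"
      by (rule member_le_sum[of u U "\<lambda>u. \<Sum>d\<in>Ds. sqn (E (u \<squnion>\<^sub>M Join D) d) - sqn (E u d)"])
         (use ud nonneg U in \<open>auto intro!: sum_nonneg\<close>)
    also have "\<dots> < \<delta>" using D(2) sqn_nonneg[of "E (cmp (Join D)) f"] by (simp add: X_def)
    finally show "sqn (E (u \<squnion>\<^sub>M Join D) d) < sqn (E u d) + \<delta>" by simp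
  qed
qed

section \<open>The fields generated by the first chaos\<close>

text \<open>The part inside \<open>x\<close> of the field generated by the first chaos.\<close>

definition chaos_field :: "'a set set \<Rightarrow> 'a set set" where
  "chaos_field x = gen_field M {h -` S \<inter> space M | h S. h \<in> first_chaos M B \<and> h \<in> meas x \<and> S \<in> sets borel}"

lemma chaos_gens_subset:
  assumes "x \<in> sub_fields M"
  shows "{h -` S \<inter> space M | h S. h \<in> first_chaos M B \<and> h \<in> meas x \<and> S \<in> sets borel} \<subseteq> x"
proof
  fix a assume "a \<in> {h -` S \<inter> space M | h S. h \<in> first_chaos M B \<and> h \<in> meas x \<and> S \<in> sets borel}"
  then obtain h S where "a = h -` S \<inter> space M" "h \<in> meas x" "S \<in> sets borel" by blast
  then show "a \<in> x"
    using measurable_sets[of h "sigma (space M) x" borel S] by (simp add: sets_sub_field[OF assms] space_measure_of_conv)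
qed

lemma chaos_field_sub: "x \<in> sub_fields M \<Longrightarrow> chaos_field x \<in> sub_fields M"
  unfolding chaos_field_def
  by (rule gen_field_in_sub_fields[OF order.trans[OF chaos_gens_subset sub_field_subset]])

lemma chaos_field_subset: "x \<in> sub_fields M \<Longrightarrow> chaos_field x \<subseteq> x"
  unfolding chaos_field_def by (rule gen_field_least[OF _ chaos_gens_subset])

lemma chaos_field_meas:
  assumes x: "x \<in> sub_fields M" and h: "h \<in> first_chaos M B" "h \<in> meas x"
  shows "h \<in> meas (chaos_field x)"
proof (rule measurableI)
  fix S :: "real set" assume "S \<in> sets borel"
  then have "h -` S \<inter> space M \<in> chaos_field x"
    unfolding chaos_field_def using h by (intro gen_field_superset[THEN subsetD]) blast
  then show "h -` S \<inter> space (sigma (space M) (chaos_field x)) \<in> sets (sigma (space M) (chaos_field x))"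
    by (simp add: sets_sub_field[OF chaos_field_sub[OF x]] space_measure_of_conv)
qed simp

lemma chaos_field_mono:
  assumes "x \<in> sub_fields M" "y \<in> sub_fields M" "x \<subseteq> y"
  shows "chaos_field x \<subseteq> chaos_field y"
proof -
  have "{h -` S \<inter> space M | h S. h \<in> first_chaos M B \<and> h \<in> meas x \<and> S \<in> sets borel} \<subseteq> chaos_field y"
    unfolding chaos_field_def using meas_mono[OF assms]
    by (intro order.trans[OF _ gen_field_superset]) blast
  then show ?thesis
    unfolding chaos_field_def[of x] by (rule gen_field_least[OF chaos_field_sub[OF assms(2)]])
qed

lemma first_chaosI:
  assumes "f \<in> L2" "\<And>y. y \<in> B \<Longrightarrow> AE \<omega> in M. f \<omega> = E y f \<omega> + E (cmp y) f \<omega>"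
  shows "f \<in> first_chaos M B"
  unfolding first_chaos_def using assms cmp_unique by blast

text \<open>The hypothesis says that \<open>u\<close> has at most one spectral point inside \<open>x\<close>.  Multiply it by the
  indicator of \<open>C \<in> x'\<close> and condition on \<open>x\<close>: the result is a constant plus a function \<open>v\<close> that is
  additive over \<open>x = y \<squnion> (x \<inter> y')\<close>, that is, a first chaos function.  So all slices of
  \<open>u\<close> in the direction of \<open>x\<close> are measurable with respect to the chaos inside \<open>x\<close>.\<close>

lemma relative_chaos:
  assumes x: "x \<in> B" and u: "u \<in> L2"
    and rel: "\<And>y. y \<in> B \<Longrightarrow> y \<subseteq> x \<Longrightarrow>
      AE \<omega> in M. u \<omega> + E (cmp x) u \<omega> = E (y \<squnion>\<^sub>M cmp x) u \<omega> + E (cmp y) u \<omega>"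
  shows "AE \<omega> in M. E (chaos_field x \<squnion>\<^sub>M cmp x) u \<omega> = u \<omega>"
proof -
  note xs = B_sub[OF x] and x' = cmp_B[OF x] and xs' = B_sub[OF cmp_B[OF x]]
  note G = chaos_field_sub[OF xs] chaos_field_subset[OF xs]
  \<comment> \<open>The slice of \<open>u\<close> over \<open>C\<close>, conditioned on \<open>x\<close>, is measurable with respect to the chaos inside \<open>x\<close>.\<close>
  have slice: "AE \<omega> in M. E (chaos_field x) (\<lambda>\<omega>. indicator C \<omega> * u \<omega>) \<omega> = E x (\<lambda>\<omega>. indicator C \<omega> * u \<omega>) \<omega>"
    if C: "C \<in> cmp x" for C
  proof -
    have CM: "C \<in> sets M" using C top_ge[OF x'] by blast
    define w where "w = (\<lambda>\<omega>. indicator C \<omega> * u \<omega>)"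
    have w: "w \<in> L2" unfolding w_def by (rule L2_restrict[OF u CM])
    have pull: "AE \<omega> in M. E z w \<omega> = indicator C \<omega> * E z u \<omega>" if z: "z \<in> B" "cmp x \<subseteq> z" for z
      unfolding w_def
      by (rule E_mult[OF B_sub[OF z(1)]])
         (use C z u CM in \<open>auto intro!: meas_indicator L2_mult_integrable L2_indicator simp: B_sub\<close>)
    have cut: "AE \<omega> in M. E x w \<omega> + E bot w \<omega> = E y w \<omega> + E (x \<inter> cmp y) w \<omega>" if y: "y \<in> B" "y \<subseteq> x" for y
    proof -
      have yx: "y \<squnion>\<^sub>M cmp x \<in> B" "cmp y \<in> B" "cmp x \<subseteq> cmp y" using x x' y by (auto intro: join_B cmp_B cmp_antimono[THEN subsetD])
      have L: "E (cmp x) w \<in> L2" "E (y \<squnion>\<^sub>M cmp x) w \<in> L2" "E (cmp y) w \<in> L2"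
        using w yx x' by (auto simp: E_L2 B_sub)
      have "AE \<omega> in M. w \<omega> + E (cmp x) w \<omega> = E (y \<squnion>\<^sub>M cmp x) w \<omega> + E (cmp y) w \<omega>"
        using pull[OF x' order_refl] pull[OF yx(1) join_upper2] pull[OF yx(2,3)] rel[OF y]
      proof eventually_elim
        case (elim \<omega>)
        have "w \<omega> + E (cmp x) w \<omega> = indicator C \<omega> * (u \<omega> + E (cmp x) u \<omega>)"
          using elim(1) by (simp add: w_def distrib_left)
        also have "\<dots> = indicator C \<omega> * (E (y \<squnion>\<^sub>M cmp x) u \<omega> + E (cmp y) u \<omega>)" using elim by simp
        finally show ?case using elim(2,3) by (simp add: distrib_left)
      qed
      then have "AE \<omega> in M. E x (\<lambda>\<omega>. w \<omega> + E (cmp x) w \<omega>) \<omega> = E x (\<lambda>\<omega>. E (y \<squnion>\<^sub>M cmp x) w \<omega> + E (cmp y) w \<omega>) \<omega>"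
        by (intro E_cong xs L2_add w L)
      moreover note E_add[OF xs w L(1)] E_add[OF xs L(2,3)]
        E_comm[OF x x' w] E_comm[OF x yx(1) w] E_comm[OF x yx(2) w]
      moreover have "x \<inter> cmp x = bot" by (rule Int_cmp[OF x])
      moreover have "x \<inter> (y \<squnion>\<^sub>M cmp x) = y"
      proof -
        have "x \<inter> (y \<squnion>\<^sub>M cmp x) = (x \<inter> y) \<squnion>\<^sub>M (x \<inter> cmp x)" by (rule distrib[OF x y(1) x'])
        also have "\<dots> = y" using y x Int_cmp[OF x]
          by (simp add: Int_absorb1 join_absorb' B_sub bot_le)
        finally show ?thesis .
      qed
      ultimately show ?thesis by (auto elim!: eventually_elim2)
    qed
    define v where "v = (\<lambda>\<omega>. E x w \<omega> - E bot w \<omega>)"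
    have L: "E x w \<in> L2" "E bot w \<in> L2" using w xs bot_B by (auto simp: E_L2 B_sub)
    have v: "v \<in> L2" unfolding v_def by (rule L2_diff[OF L])
    have Ev: "AE \<omega> in M. E y v \<omega> = E (x \<inter> y) w \<omega> - E bot w \<omega>" if y: "y \<in> B" for y
    proof -
      have "y \<inter> bot = bot" using bot_le[OF y] by blast
      then show ?thesis
        using E_diff[OF B_sub[OF y] L] E_comm[OF y x w] E_comm[OF y bot_B w]
        unfolding v_def by (simp add: Int_commute) (elim eventually_elim2, auto)
    qed
    have chaos: "v \<in> first_chaos M B"
    proof (rule first_chaosI[OF v])
      fix y assume y: "y \<in> B"
      have xy: "x \<inter> y \<in> B" "x \<inter> y \<subseteq> x" using Int_B[OF x y] by auto
      have "x \<inter> cmp (x \<inter> y) = (x \<inter> cmp x) \<squnion>\<^sub>M (x \<inter> cmp y)"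
        unfolding cmp_Int[OF x y] by (rule distrib[OF x x' cmp_B[OF y]])
      also have "\<dots> = x \<inter> cmp y"
        unfolding Int_cmp[OF x] by (rule join_absorb[OF B_sub bot_le]) (intro Int_B x cmp_B y)+
      finally have "AE \<omega> in M. E x w \<omega> + E bot w \<omega> = E (x \<inter> y) w \<omega> + E (x \<inter> cmp y) w \<omega>"
        using cut[OF xy] by simp
      then show "AE \<omega> in M. v \<omega> = E y v \<omega> + E (cmp y) v \<omega>"
        using Ev[OF y] Ev[OF cmp_B[OF y]] unfolding v_def by eventually_elim simp
    qed
    have const: "E bot w \<in> meas z" if "z \<in> sub_fields M" for z
      by (rule meas_mono[OF B_sub[OF bot_B] that bot_least[OF that] E_meas])
    have "v \<in> meas x" unfolding v_def by (intro borel_measurable_diff E_meas const xs)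
    then have "v \<in> meas (chaos_field x)" by (rule chaos_field_meas[OF xs chaos])
    then have "(\<lambda>\<omega>. v \<omega> + E bot w \<omega>) \<in> meas (chaos_field x)"
      by (rule borel_measurable_add[OF _ const[OF G(1)]])
    then have "E x w \<in> meas (chaos_field x)" by (simp add: v_def)
    then have "AE \<omega> in M. E (chaos_field x) (E x w) \<omega> = E x w \<omega>"
      by (rule E_of_meas[OF G(1) L(1)])
    then show ?thesis
      using E_tower[OF G(1) xs G(2) w] unfolding w_def by eventually_elim simp
  qed
  define K where "K = chaos_field x \<squnion>\<^sub>M cmp x"
  have K: "K \<in> sub_fields M" unfolding K_def by (rule join_sub_fields[OF G(1) xs'])
  have Ku: "E K u \<in> L2" by (rule E_L2[OF K u])
  have "ip u (indicator (p \<inter> C)) = ip (E K u) (indicator (p \<inter> C))" if p: "p \<in> x" and C: "C \<in> cmp x" for p C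
  proof -
    have M: "p \<in> sets M" "C \<in> sets M" using p C top_ge x x' by blast+
    note I = L2_indicator[OF M(1)] and w = L2_restrict[OF u M(2)]
    let ?w = "\<lambda>\<omega>. indicator C \<omega> * u \<omega>"
    have "ip u (indicator (p \<inter> C)) = ip ?w (indicator p)"
      unfolding Int_commute[of p C] by (rule ip_indicator_inter)
    also have "\<dots> = ip (E x ?w) (indicator p)"
      by (rule ip_E_meas[OF xs w I meas_indicator[OF xs p], symmetric])
    also have "\<dots> = ip (E (chaos_field x) ?w) (indicator p)"
      by (rule ip_cong_AE) (use slice[OF C] w I xs G in \<open>auto simp: E_L2 eq_commute\<close>)
    also have "\<dots> = ip ?w (E (chaos_field x) (indicator p))" by (rule E_self_adjoint[OF G(1) w I])
    also have "\<dots> = ip u (\<lambda>\<omega>. indicator C \<omega> * E (chaos_field x) (indicator p) \<omega>)"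
      by (simp add: ip_def mult_ac)
    also have "\<dots> = ip u (E K (indicator (p \<inter> C)))"
    proof (rule ip_cong_AE)
      show "AE \<omega> in M. indicator C \<omega> * E (chaos_field x) (indicator p) \<omega> = E K (indicator (p \<inter> C)) \<omega>"
        using E_join_indep_mult[OF xs' xs G indep_set_commute[OF cmp_indep[OF x]] C p]
        by (simp add: K_def join_commute Int_commute eq_commute)
    qed (use u M I G K in \<open>auto intro!: L2_restrict E_L2 L2_indicator\<close>)
    also have "\<dots> = ip (E K u) (indicator (p \<inter> C))"
      by (rule E_self_adjoint[OF K u, symmetric]) (use M in \<open>auto intro: L2_indicator\<close>)
    finally show ?thesis .
  qed
  then have "ip u (indicator D) = ip (E K u) (indicator D)" if "D \<in> sets M" for D
    using ip_eq_on_join[OF xs xs' u Ku] that join_cmp[OF x] by blast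
  then have "AE \<omega> in M. u \<omega> = E K u \<omega>" by (rule L2_eq_AE[OF u Ku])
  then show ?thesis by (simp add: K_def eq_commute)
qed

section \<open>The distance from the classical part\<close>

text \<open>The squared distance of \<open>g\<close> from the functions that are arbitrary outside \<open>x\<close> and generated by
  first chaos inside \<open>x\<close>.\<close>

definition defect :: "'a set set \<Rightarrow> ('a \<Rightarrow> real) \<Rightarrow> real" where
  "defect x g = sqn (\<lambda>\<omega>. g \<omega> - E (chaos_field x \<squnion>\<^sub>M cmp x) g \<omega>)"

lemma chaos_join_sub: "x \<in> B \<Longrightarrow> chaos_field x \<squnion>\<^sub>M cmp x \<in> sub_fields M"
  by (intro join_sub_fields chaos_field_sub B_sub cmp_B)

lemma cmp_join: "x \<in> B \<Longrightarrow> y \<in> B \<Longrightarrow> cmp (x \<squnion>\<^sub>M y) = cmp x \<inter> cmp y"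
  using cmp_cmp[OF Int_B[OF cmp_B cmp_B]] cmp_Int[OF cmp_B cmp_B] cmp_cmp by metis

text \<open>The projections belonging to \<open>x\<close> and \<open>y\<close> act on different tensor factors, and their product projects
  to a subspace of the one belonging to \<open>x \<squnion> y\<close>; by Pythagoras, the squared error of
  a product of projections is at most the sum of their squared errors.\<close>

lemma defect_join:
  assumes x: "x \<in> B" and y: "y \<in> B" and xy: "x \<inter> y = bot" and g: "g \<in> L2"
  shows "defect (x \<squnion>\<^sub>M y) g \<le> defect x g + defect y g"
proof -
  note s = B_sub[OF x] B_sub[OF y] B_sub[OF cmp_B[OF x]] B_sub[OF cmp_B[OF y]]
  define R where "R = cmp x \<inter> cmp y"
  have R: "R \<in> B" unfolding R_def by (intro Int_B cmp_B x y)
  have Rs: "R \<in> sub_fields M" by (rule B_sub[OF R])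
  have yx': "y \<subseteq> cmp x" and xy': "x \<subseteq> cmp y"
    using xy le_cmp_iff[OF x y] le_cmp_iff[OF y x] by (auto simp: Int_commute)
  note Gx = chaos_field_sub[OF s(1)] chaos_field_subset[OF s(1)]
  note Gy = chaos_field_sub[OF s(2)] chaos_field_subset[OF s(2)]
  define C where "C = chaos_field y \<squnion>\<^sub>M R"
  have C: "C \<in> sub_fields M" unfolding C_def by (rule join_sub_fields[OF Gy(1) Rs])
  have Cx: "C \<subseteq> cmp x" unfolding C_def
    by (rule join_least[OF s(3) order.trans[OF Gy(2) yx']]) (simp add: R_def)
  have cy: "cmp y = x \<squnion>\<^sub>M R"
  proof -
    have "cmp y = cmp y \<inter> (x \<squnion>\<^sub>M cmp x)" using top_ge[OF cmp_B[OF y]] join_cmp[OF x] by auto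
    also have "\<dots> = (cmp y \<inter> x) \<squnion>\<^sub>M (cmp y \<inter> cmp x)" by (intro distrib cmp_B x y)
    also have "cmp y \<inter> x = x" using xy' by blast
    finally show ?thesis by (simp add: R_def Int_commute)
  qed
  have eq: "x \<squnion>\<^sub>M C = chaos_field y \<squnion>\<^sub>M cmp y"
  proof (rule antisym)
    have J: "chaos_field y \<squnion>\<^sub>M cmp y \<in> sub_fields M" by (rule chaos_join_sub[OF y])
    have "R \<subseteq> cmp y" by (simp add: R_def)
    then show "x \<squnion>\<^sub>M C \<subseteq> chaos_field y \<squnion>\<^sub>M cmp y"
      unfolding C_def
      by (intro join_least J order.trans[OF xy' join_upper2] join_upper1 order.trans[OF _ join_upper2])
    have J': "x \<squnion>\<^sub>M C \<in> sub_fields M" by (rule join_sub_fields[OF s(1) C])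
    have "chaos_field y \<subseteq> x \<squnion>\<^sub>M C" "R \<subseteq> x \<squnion>\<^sub>M C"
      unfolding C_def by (rule order.trans[OF join_upper1 join_upper2], rule order.trans[OF join_upper2 join_upper2])
    then show "chaos_field y \<squnion>\<^sub>M cmp y \<subseteq> x \<squnion>\<^sub>M C"
      unfolding cy by (intro join_least J' join_upper1)
  qed
  let ?P = "E (chaos_field x \<squnion>\<^sub>M cmp x)" and ?Q = "E (chaos_field y \<squnion>\<^sub>M cmp y)"
  note Js = chaos_join_sub[OF x] chaos_join_sub[OF y]
  have tens: "AE \<omega> in M. ?P (?Q g) \<omega> = E (chaos_field x \<squnion>\<^sub>M C) g \<omega>"
    using E_tensor[OF s(1,3) cmp_indep[OF x] join_cmp[OF x] Gx C Cx g] unfolding eq .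
  have L: "?P g \<in> L2" "?Q g \<in> L2" "?P (?Q g) \<in> L2" using Js g by (auto simp: E_L2)
  have K: "chaos_field x \<squnion>\<^sub>M C \<in> sub_fields M" by (rule join_sub_fields[OF Gx(1) C])
  have incl: "chaos_field x \<squnion>\<^sub>M C \<subseteq> chaos_field (x \<squnion>\<^sub>M y) \<squnion>\<^sub>M cmp (x \<squnion>\<^sub>M y)"
  proof -
    have xyB: "x \<squnion>\<^sub>M y \<in> B" by (rule join_B[OF x y])
    have incl: "chaos_field x \<subseteq> chaos_field (x \<squnion>\<^sub>M y)" "chaos_field y \<subseteq> chaos_field (x \<squnion>\<^sub>M y)"
      by (intro chaos_field_mono s B_sub[OF xyB] join_upper1 join_upper2)+
    show ?thesis
      unfolding C_def cmp_join[OF x y] R_def[symmetric]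
      by (intro join_least join_upper2 chaos_join_sub[OF xyB, unfolded cmp_join[OF x y] R_def[symmetric]]
          order.trans[OF incl(1) join_upper1] order.trans[OF incl(2) join_upper1])
  qed
  have orth: "ip (\<lambda>\<omega>. g \<omega> - ?P g \<omega>) (\<lambda>\<omega>. ?P g \<omega> - ?P (?Q g) \<omega>) = 0"
    by (rule E_residual_orthogonal) (use Js g L in \<open>auto intro!: borel_measurable_diff E_meas L2_diff\<close>)
  have "defect (x \<squnion>\<^sub>M y) g \<le> sqn (\<lambda>\<omega>. g \<omega> - E (chaos_field x \<squnion>\<^sub>M C) g \<omega>)"
    unfolding defect_def by (rule sqn_residual_antimono[OF K chaos_join_sub[OF join_B[OF x y]] incl g])
  also have "\<dots> = sqn (\<lambda>\<omega>. g \<omega> - ?P (?Q g) \<omega>)"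
    by (rule ip_cong_AE) (use tens g L K in \<open>auto intro!: L2_diff E_L2\<close>)
  also have "\<dots> = sqn (\<lambda>\<omega>. (g \<omega> - ?P g \<omega>) + (?P g \<omega> - ?P (?Q g) \<omega>))" by simp
  also have "\<dots> = sqn (\<lambda>\<omega>. g \<omega> - ?P g \<omega>) + sqn (\<lambda>\<omega>. ?P g \<omega> - ?P (?Q g) \<omega>)"
    by (subst sqn_add) (use orth g L in \<open>auto intro!: L2_diff\<close>)
  also have "\<dots> \<le> defect x g + defect y g"
    using sqn_E_diff_le[OF Js(1) g L(2)] by (simp add: defect_def)
  finally show ?thesis .
qed

lemma cmp_bot: "cmp bot = sets M" and cmp_top: "cmp (sets M) = bot"
proof -
  have "sets M = cmp bot"
    by (rule cmp_unique[OF bot_B])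
       (auto simp: field_compl_def field_top_def top_B Int_absorb2 bot_le join_absorb sets_sub_fields)
  then show "cmp bot = sets M" "cmp (sets M) = bot" using cmp_cmp[OF bot_B] by simp_all
qed

lemma defect_bot: "g \<in> L2 \<Longrightarrow> defect bot g = 0"
proof -
  assume g: "g \<in> L2"
  have "chaos_field bot \<squnion>\<^sub>M cmp bot = sets M"
    unfolding cmp_bot by (rule join_absorb[OF sets_sub_fields sub_field_subset[OF chaos_field_sub[OF B_sub[OF bot_B]]]])
  then have "defect bot g = sqn (\<lambda>_. 0)"
    unfolding defect_def
    by (intro ip_cong_AE) (use E_top[OF g] g in \<open>auto intro!: L2_diff E_L2 L2_const sets_sub_fields\<close>)
  then show ?thesis by (simp add: ip_def)
qed

lemma defect_Join:
  assumes "finite D" "D \<subseteq> B" "\<And>x y. x \<in> D \<Longrightarrow> y \<in> D \<Longrightarrow> x \<noteq> y \<Longrightarrow> x \<inter> y = bot" and g: "g \<in> L2"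
  shows "defect (Join D) g \<le> (\<Sum>x\<in>D. defect x g)"
  using assms(1-3)
proof (induction D rule: finite_induct)
  case empty then show ?case by (simp add: Join_empty defect_bot[OF g])
next
  case (insert x D)
  have D: "D \<subseteq> B" "x \<in> B" using insert.prems by auto
  have "x \<inter> Join D = bot"
    by (rule Int_Join_bot) (use insert in auto)
  then have "defect (Join (insert x D)) g \<le> defect x g + defect (Join D) g"
    unfolding Join_insert[OF D(2,1)] by (intro defect_join D Join_B g)
  also have "\<dots> \<le> defect x g + (\<Sum>x\<in>D. defect x g)"
    using insert by (intro add_left_mono insert.IH) auto
  finally show ?case using insert by simp
qed

lemma defect_top: "defect (sets M) g = sqn (\<lambda>\<omega>. g \<omega> - E (chaos_field (sets M)) g \<omega>)"
  unfolding defect_def cmp_top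
  using join_absorb'[OF chaos_field_sub[OF sets_sub_fields] bot_least[OF chaos_field_sub[OF sets_sub_fields]]] by simp

lemma at_most_one_nonneg:
  assumes c: "part c" and g: "g \<in> L2" and x: "x \<in> B" "resolves c x"
  shows "0 \<le> ip (at_most_one x c g) g"
proof -
  obtain F where F: "decomposes c g F" using decomposition_exists[OF c g] .
  show ?thesis
    unfolding symbol_ip[OF c F at_most_one_symbol_self[OF c F g x] symbol_self[OF F g]]
    by (intro sum_nonneg mult_nonneg_nonneg sqn_nonneg) auto
qed

text \<open>The parts of \<open>g\<close> with at most one occupied cell in \<open>x\<close> decrease under refinement to a limit to
  which \<open>relative_chaos\<close> applies.\<close>

lemma defect_le_at_most_one:
  assumes x: "x \<in> B" and g: "g \<in> L2" and \<eta>: "\<eta> > 0"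
  obtains b where "part b" "resolves b x"
    "\<And>c. part c \<Longrightarrow> refines c b \<Longrightarrow> defect x g \<le> 2 * sqn (\<lambda>\<omega>. g \<omega> - at_most_one x c g \<omega>) + \<eta>"
proof -
  let ?P = "\<lambda>b. part b \<and> resolves b x"
  obtain u where u: "u \<in> L2"
    and lim: "\<And>\<delta>. \<delta> > 0 \<Longrightarrow> \<exists>b. ?P b \<and> (\<forall>c. ?P c \<longrightarrow> refines c b \<longrightarrow> sqn (\<lambda>\<omega>. at_most_one x c g \<omega> - u \<omega>) \<le> \<delta>)"
  proof (rule L2_net_limit[of ?P "\<lambda>b c. refines c b" "\<lambda>b. at_most_one x b g" 0 "\<lambda>b. ip (at_most_one x b g) g"])
    obtain c where "part c" using part_exists by blast
    then show "\<exists>b. ?P b" using resolving_part[of c "{x}"] x by auto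
    show "refines c b \<Longrightarrow> refines d c \<Longrightarrow> refines d b" if "?P b" "?P c" "?P d" for b c d
      using refines_transitive that by blast
    show "\<exists>d. ?P d \<and> refines d b \<and> refines d c" if "?P b" "?P c" for b c
      using refines_directed[of b c] refines_trans[of b _ x] that x by metis
  qed (use refines_refl at_most_one_L2 g x at_most_one_nonneg at_most_one_cauchy in auto)
  have rel: "AE \<omega> in M. u \<omega> + E (cmp x) u \<omega> = E (y \<squnion>\<^sub>M cmp x) u \<omega> + E (cmp y) u \<omega>" if y: "y \<in> B" "y \<subseteq> x" for y
  proof -
    \<comment> \<open>The error in the identity for \<open>y\<close> depends continuously on the function and vanishes along the net.\<close>
    define \<Psi> where "\<Psi> h \<omega> = (h \<omega> + E (cmp x) h \<omega>) - (E (y \<squnion>\<^sub>M cmp x) h \<omega> + E (cmp y) h \<omega>)" for h \<omega>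
    note z = B_sub[OF cmp_B[OF x]] B_sub[OF join_B[OF y(1) cmp_B[OF x]]] B_sub[OF cmp_B[OF y(1)]]
    have \<Psi>L: "\<Psi> h \<in> L2" if "h \<in> L2" for h
      unfolding \<Psi>_def by (intro L2_diff L2_add E_L2 z that)
    have contr: "sqn (\<lambda>\<omega>. \<Psi> h \<omega> - \<Psi> k \<omega>) \<le> 16 * sqn (\<lambda>\<omega>. h \<omega> - k \<omega>)" if hk: "h \<in> L2" "k \<in> L2" for h k
    proof -
      define a where "a = (\<lambda>\<omega>. h \<omega> - k \<omega>)"
      define e where "e z = (\<lambda>\<omega>. E z h \<omega> - E z k \<omega>)" for z
      have e: "e z \<in> L2" "sqn (e z) \<le> sqn a" if "z \<in> sub_fields M" for z
        using sqn_E_diff_le[OF that hk] hk that unfolding e_def a_def by (auto intro!: L2_diff E_L2)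
      have a: "a \<in> L2" unfolding a_def by (rule L2_diff[OF hk])
      have "sqn (\<lambda>\<omega>. \<Psi> h \<omega> - \<Psi> k \<omega>) = sqn (\<lambda>\<omega>. (a \<omega> + e (cmp x) \<omega>) - (e (y \<squnion>\<^sub>M cmp x) \<omega> + e (cmp y) \<omega>))"
        by (simp add: \<Psi>_def a_def e_def algebra_simps)
      also have "\<dots> \<le> 2 * sqn (\<lambda>\<omega>. a \<omega> + e (cmp x) \<omega>) + 2 * sqn (\<lambda>\<omega>. e (y \<squnion>\<^sub>M cmp x) \<omega> + e (cmp y) \<omega>)"
        by (intro sqn_diff_le L2_add a e z)
      also have "\<dots> \<le> 2 * (2 * sqn a + 2 * sqn (e (cmp x))) + 2 * (2 * sqn (e (y \<squnion>\<^sub>M cmp x)) + 2 * sqn (e (cmp y)))"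
        by (intro add_mono mult_left_mono sqn_add_le a e z) auto
      also have "\<dots> \<le> 16 * sqn a"
      proof -
        have "2 * (2 * t + 2 * p) + 2 * (2 * q + 2 * r) \<le> 16 * t" if "p \<le> t" "q \<le> t" "r \<le> t" for p q r t :: real
          using that by simp
        then show ?thesis using e(2)[OF z(1)] e(2)[OF z(2)] e(2)[OF z(3)] .
      qed
      finally show ?thesis unfolding a_def .
    qed
    have "sqn (\<Psi> u) \<le> \<delta>" if \<delta>: "\<delta> > 0" for \<delta>
    proof -
      obtain b where b: "part b" "resolves b x"
        "\<And>c. part c \<Longrightarrow> resolves c x \<Longrightarrow> refines c b \<Longrightarrow> sqn (\<lambda>\<omega>. at_most_one x c g \<omega> - u \<omega>) \<le> \<delta> / 32"
        using lim[of "\<delta> / 32"] \<delta> by auto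
      obtain c where c: "part c" "refines c b" "resolves c y"
        using resolving_part[OF b(1), of "{y}"] y by auto
      have cx: "resolves c x" by (rule refines_trans[OF b(1) c(1,2) x b(2)])
      note l = at_most_one_L2[OF c(1) g x cx]
      have "sqn (\<Psi> (at_most_one x c g)) = 0"
        unfolding \<Psi>_def using at_most_one_relation[OF c(1) g x cx y(1) c(3) y(2)] .
      moreover have "sqn (\<lambda>\<omega>. \<Psi> u \<omega> - \<Psi> (at_most_one x c g) \<omega>) \<le> 16 * (\<delta> / 32)"
        using contr[OF u l] b(3)[OF c(1) cx c(2)] sqn_diff_commute[of u "at_most_one x c g"] by linarith
      moreover have "sqn (\<lambda>\<omega>. (\<Psi> u \<omega> - \<Psi> (at_most_one x c g) \<omega>) + \<Psi> (at_most_one x c g) \<omega>)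
         \<le> 2 * sqn (\<lambda>\<omega>. \<Psi> u \<omega> - \<Psi> (at_most_one x c g) \<omega>) + 2 * sqn (\<Psi> (at_most_one x c g))"
        by (rule sqn_add_le) (intro L2_diff \<Psi>L u l)+
      ultimately show ?thesis by simp
    qed
    then have "sqn (\<Psi> u) \<le> 0" by (rule dense_ge)
    then have "sqn (\<Psi> u) = 0" using sqn_nonneg[of "\<Psi> u"] by simp
    then have "AE \<omega> in M. \<Psi> u \<omega> = 0" using sqn_eq_0_iff[OF \<Psi>L[OF u]] by simp
    then show ?thesis unfolding \<Psi>_def by eventually_elim simp
  qed
  define K where "K = chaos_field x \<squnion>\<^sub>M cmp x"
  have K: "K \<in> sub_fields M" unfolding K_def by (rule chaos_join_sub[OF x])
  have Ku: "AE \<omega> in M. E K u \<omega> = u \<omega>" unfolding K_def by (rule relative_chaos[OF x u rel])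
  have "defect x g \<le> sqn (\<lambda>\<omega>. g \<omega> - E K u \<omega>)"
    unfolding defect_def K_def[symmetric] by (rule sqn_residual_minimal[OF K g E_L2[OF K u] E_meas])
  also have "\<dots> = sqn (\<lambda>\<omega>. g \<omega> - u \<omega>)"
    by (rule ip_cong_AE) (use Ku g u K in \<open>auto intro!: L2_diff E_L2\<close>)
  finally have d: "defect x g \<le> sqn (\<lambda>\<omega>. g \<omega> - u \<omega>)" .
  obtain b where b: "part b" "resolves b x"
    "\<And>c. part c \<Longrightarrow> resolves c x \<Longrightarrow> refines c b \<Longrightarrow> sqn (\<lambda>\<omega>. at_most_one x c g \<omega> - u \<omega>) \<le> \<eta> / 2"
    using lim[of "\<eta> / 2"] \<eta> by auto
  show ?thesis
  proof (rule that[OF b(1,2)])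
    fix c assume c: "part c" "refines c b"
    have cx: "resolves c x" by (rule refines_trans[OF b(1) c x b(2)])
    show "defect x g \<le> 2 * sqn (\<lambda>\<omega>. g \<omega> - at_most_one x c g \<omega>) + \<eta>"
      using d sqn_triangle[OF g at_most_one_L2[OF c(1) g x cx] u] b(3)[OF c(1) cx c(2)] by linarith
  qed
qed

text \<open>Choose \<open>b\<close> such that \<open>kappa\<close> can hardly grow any more, and sum the defects over its cells.\<close>

lemma bounded_kappa_classical:
  assumes g: "g \<in> L2" and bound: "\<And>b. part b \<Longrightarrow> kappa b g \<le> C"
  shows "AE \<omega> in M. E (chaos_field (sets M)) g \<omega> = g \<omega>"
proof -
  define s where "s = Sup ((\<lambda>b. kappa b g) ` Collect part)"
  have bdd: "bdd_above ((\<lambda>b. kappa b g) ` Collect part)" using bound by (auto intro!: bdd_aboveI[of _ C])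
  have le_s: "kappa b g \<le> s" if "part b" for b
    unfolding s_def using bdd that by (auto intro: cSup_upper)
  have "defect (sets M) g \<le> \<delta>" if \<delta>: "\<delta> > 0" for \<delta>
  proof -
    have "s - \<delta> / 4 < Sup ((\<lambda>b. kappa b g) ` Collect part)" using \<delta> by (simp add: s_def)
    then obtain b where b: "part b" "s - \<delta> / 4 < kappa b g"
      using part_exists bdd by (subst (asm) less_cSup_iff) auto
    define \<eta> where "\<eta> = \<delta> / (2 * (real (card b) + 1))"
    have \<eta>: "\<eta> > 0" using \<delta> by (simp add: \<eta>_def)
    have "\<forall>x\<in>b. \<exists>b'. part b' \<and> (\<forall>c. part c \<longrightarrow> refines c b' \<longrightarrow> defect x g \<le> 2 * sqn (\<lambda>\<omega>. g \<omega> - at_most_one x c g \<omega>) + \<eta>)"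
      using defect_le_at_most_one[OF part_in_B[OF b(1)] g \<eta>] by metis
    then obtain \<beta> where \<beta>: "\<And>x. x \<in> b \<Longrightarrow> part (\<beta> x)"
      "\<And>x c. x \<in> b \<Longrightarrow> part c \<Longrightarrow> refines c (\<beta> x) \<Longrightarrow> defect x g \<le> 2 * sqn (\<lambda>\<omega>. g \<omega> - at_most_one x c g \<omega>) + \<eta>"
      by metis
    have "finite (\<Union>x\<in>b. \<beta> x)" "(\<Union>x\<in>b. \<beta> x) \<subseteq> B"
      using \<beta>(1) part_finite part_B part_finite[OF b(1)] by auto
    then obtain c where c: "part c" "refines c b" "\<And>z. z \<in> (\<Union>x\<in>b. \<beta> x) \<Longrightarrow> resolves c z"
      using resolving_part[OF b(1)] by blast
    have "defect (sets M) g = defect (Join b) g" using b by (simp add: part_def)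
    also have "\<dots> \<le> (\<Sum>x\<in>b. defect x g)"
      by (rule defect_Join) (use b g in \<open>auto simp: part_def\<close>)
    also have "\<dots> \<le> (\<Sum>x\<in>b. 2 * sqn (\<lambda>\<omega>. g \<omega> - at_most_one x c g \<omega>) + \<eta>)"
      by (intro sum_mono \<beta>(2) c(1)) (use c(3) in \<open>auto simp: refines_def\<close>)
    also have "\<dots> = 2 * (\<Sum>x\<in>b. sqn (\<lambda>\<omega>. g \<omega> - at_most_one x c g \<omega>)) + real (card b) * \<eta>"
      by (simp add: sum.distrib sum_distrib_left)
    also have "\<dots> \<le> 2 * (\<delta> / 4) + \<delta> / 2"
    proof (intro add_mono)
      show "2 * (\<Sum>x\<in>b. sqn (\<lambda>\<omega>. g \<omega> - at_most_one x c g \<omega>)) \<le> 2 * (\<delta> / 4)"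
        using sum_at_most_one_residual[OF b(1) c(1,2) g] le_s[OF c(1)] b(2) by simp
      show "real (card b) * \<eta> \<le> \<delta> / 2" using \<delta> by (simp add: \<eta>_def field_simps)
    qed
    finally show ?thesis by simp
  qed
  then have "defect (sets M) g \<le> 0" by (rule dense_ge)
  then have "sqn (\<lambda>\<omega>. g \<omega> - E (chaos_field (sets M)) g \<omega>) = 0"
    using sqn_nonneg[of "\<lambda>\<omega>. g \<omega> - E (chaos_field (sets M)) g \<omega>"] by (simp add: defect_top)
  then have "AE \<omega> in M. g \<omega> - E (chaos_field (sets M)) g \<omega> = 0"
    by (subst (asm) sqn_eq_0_iff) (intro L2_diff g E_L2 chaos_field_sub sets_sub_fields)+
  then show ?thesis by eventually_elim simp
qed

text \<open>The limit \<open>g\<close> of the noise operators applied to \<open>f\<close> is generated by the first chaos, because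
  \<open>kappa_noise_op\<close> passes to the limit.  Hence \<open>g\<close> is orthogonal to \<open>f\<close>.\<close>

lemma noise_op_vanishes:
  assumes f: "f \<in> L2" and orth: "\<And>h. h \<in> L2 \<Longrightarrow> AE \<omega> in M. E (chaos_field (sets M)) h \<omega> = h \<omega> \<Longrightarrow> ip f h = 0"
    and \<epsilon>: "0 < \<epsilon>" "\<epsilon> < 1" and \<eta>: "0 < \<eta>"
  shows "\<exists>b. part b \<and> ip (noise_op \<epsilon> b f) f < \<eta>"
proof -
  obtain g where g: "g \<in> L2"
    and lim: "\<And>\<delta>. \<delta> > 0 \<Longrightarrow> \<exists>b. part b \<and> (\<forall>c. part c \<longrightarrow> refines c b \<longrightarrow> sqn (\<lambda>\<omega>. noise_op \<epsilon> c f \<omega> - g \<omega>) \<le> \<delta>)"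
  proof (rule L2_net_limit[of part "\<lambda>b c. refines c b" "\<lambda>b. noise_op \<epsilon> b f" 0 "\<lambda>b. ip (noise_op \<epsilon> b f) f"])
    show "\<exists>d. part d \<and> refines d b \<and> refines d c" if "part b" "part c" for b c
      using refines_directed[OF that] by metis
    show "0 \<le> ip (noise_op \<epsilon> b f) f" if "part b" for b
      unfolding ip_noise_op[OF that f]
      by (intro sum_nonneg mult_nonneg_nonneg choice_weight_nonneg sqn_nonneg) (use \<epsilon> in auto)
    show "sqn (\<lambda>\<omega>. noise_op \<epsilon> b f \<omega> - noise_op \<epsilon> c f \<omega>) \<le> ip (noise_op \<epsilon> b f) f - ip (noise_op \<epsilon> c f) f"
      if "part b" "part c" "refines c b" for b c
      by (rule noise_op_cauchy[OF that f]) (use \<epsilon> in auto)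
    show "refines d b" if "part b" "part c" "part d" "refines c b" "refines d c" for b c d
      using refines_transitive that by blast
  qed (rule part_exists, erule refines_refl, erule noise_op_L2[OF _ f], blast)
  have "kappa b g \<le> 2 * (sqn f / \<epsilon>) + 8" if b: "part b" for b
  proof -
    define \<delta> where "\<delta> = 1 / (real (card b) + 1)"
    have \<delta>: "\<delta> > 0" by (simp add: \<delta>_def)
    obtain b' where b': "part b'" "\<And>c. part c \<Longrightarrow> refines c b' \<Longrightarrow> sqn (\<lambda>\<omega>. noise_op \<epsilon> c f \<omega> - g \<omega>) \<le> \<delta>"
      using lim[OF \<delta>] by blast
    obtain c where c: "part c" "refines c b" "refines c b'" using refines_directed[OF b b'(1)] .
    define h where "h = noise_op \<epsilon> c f"
    have h: "h \<in> L2" unfolding h_def by (rule noise_op_L2[OF c(1) f])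
    have hg: "sqn (\<lambda>\<omega>. g \<omega> - h \<omega>) \<le> \<delta>" using b'(2)[OF c(1,3)] sqn_diff_commute[of g h] by (simp add: h_def)
    have "kappa b g \<le> (\<Sum>x\<in>b. 2 * sqn (\<lambda>\<omega>. h \<omega> - E (cmp x) h \<omega>) + 8 * \<delta>)"
      unfolding kappa_def
    proof (rule sum_mono)
      fix x assume "x \<in> b"
      then have z: "cmp x \<in> sub_fields M" using part_in_B[OF b] by (intro B_sub cmp_B)
      note L = E_L2[OF z g] E_L2[OF z h]
      let ?A = "\<lambda>\<omega>. h \<omega> - E (cmp x) h \<omega>" and ?D = "\<lambda>\<omega>. (g \<omega> - h \<omega>) - (E (cmp x) g \<omega> - E (cmp x) h \<omega>)"
      have "sqn (\<lambda>\<omega>. g \<omega> - E (cmp x) g \<omega>) = sqn (\<lambda>\<omega>. ?A \<omega> + ?D \<omega>)" by simp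
      also have "\<dots> \<le> 2 * sqn ?A + 2 * sqn ?D" by (rule sqn_add_le) (intro L2_diff L g h)+
      also have "sqn ?D \<le> 2 * sqn (\<lambda>\<omega>. g \<omega> - h \<omega>) + 2 * sqn (\<lambda>\<omega>. E (cmp x) g \<omega> - E (cmp x) h \<omega>)"
        by (rule sqn_diff_le) (intro L2_diff L g h)+
      also have "\<dots> \<le> 2 * \<delta> + 2 * \<delta>" using sqn_E_diff_le[OF z g h] hg by linarith
      finally show "sqn (\<lambda>\<omega>. g \<omega> - E (cmp x) g \<omega>) \<le> 2 * sqn ?A + 8 * \<delta>" by simp
    qed
    also have "\<dots> = 2 * kappa b h + 8 * (real (card b) * \<delta>)"
      by (simp add: kappa_def sum.distrib sum_distrib_left)
    also have "\<dots> \<le> 2 * (sqn f / \<epsilon>) + 8 * 1"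
    proof (intro add_mono mult_left_mono)
      show "kappa b h \<le> sqn f / \<epsilon>" unfolding h_def by (rule kappa_noise_op[OF b c(1,2) f]) (use \<epsilon> in auto)
      show "real (card b) * \<delta> \<le> 1" by (simp add: \<delta>_def)
    qed auto
    finally show ?thesis by simp
  qed
  then have fg: "ip f g = 0" by (intro orth g bounded_kappa_classical)
  \<comment> \<open>The weight in \<open>ip_le\<close> makes the term with \<open>f\<close> smaller than \<open>\<eta>\<close>; the partition then takes care of the other.\<close>
  define s where "s = \<eta> / (sqn f + 1)"
  have s: "s > 0" "s * sqn f < \<eta>"
    using \<eta> sqn_nonneg[of f] by (auto simp: s_def field_simps)
  obtain b where b: "part b" "\<And>c. part c \<Longrightarrow> refines c b \<Longrightarrow> sqn (\<lambda>\<omega>. noise_op \<epsilon> c f \<omega> - g \<omega>) \<le> s * \<eta>"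
    using lim[of "s * \<eta>"] s \<eta> by auto
  note T = noise_op_L2[OF b(1) f, of \<epsilon>]
  have "2 * \<bar>ip f (\<lambda>\<omega>. noise_op \<epsilon> b f \<omega> - g \<omega>)\<bar> \<le> s * sqn f + sqn (\<lambda>\<omega>. noise_op \<epsilon> b f \<omega> - g \<omega>) / s"
    by (rule ip_le[OF f L2_diff[OF T g] s(1)])
  also have "sqn (\<lambda>\<omega>. noise_op \<epsilon> b f \<omega> - g \<omega>) / s \<le> \<eta>"
    using b(2)[OF b(1) refines_refl[OF b(1)]] s by (simp add: field_simps)
  finally have "\<bar>ip f (\<lambda>\<omega>. noise_op \<epsilon> b f \<omega> - g \<omega>)\<bar> < \<eta>" using s(2) by linarith
  then have "ip f (noise_op \<epsilon> b f) < \<eta>" using fg by (simp add: ip_diff_right f T g)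
  then show ?thesis using b(1) by (auto simp: ip_commute[of f])
qed

section \<open>Monotone sequences in the Boolean algebra\<close>

text \<open>An increasing sequence of fields is a \<open>\<pi>\<close>-system that generates its supremum.\<close>

lemma ip_eq_on_chain:
  fixes s :: "nat \<Rightarrow> 'a set set"
  assumes s: "\<And>k. s k \<in> B" "\<And>k. s k \<subseteq> s (Suc k)"
    and uv: "u \<in> L2" "v \<in> L2"
    and eq: "\<And>k A. A \<in> s k \<Longrightarrow> ip u (indicator A) = ip v (indicator A)"
    and A: "A \<in> Join (range s)"
  shows "ip u (indicator A) = ip v (indicator A)"
proof -
  have mono: "s i \<subseteq> s j" if "i \<le> j" for i j using lift_Suc_mono_le[of s, OF s(2) that] .
  define G where "G = (\<Union>k. s k)"
  have stable: "Int_stable G"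
  proof (rule Int_stableI)
    fix a b assume "a \<in> G" "b \<in> G"
    then obtain i j where "a \<in> s i" "b \<in> s j" by (auto simp: G_def)
    then have "a \<in> s (max i j)" "b \<in> s (max i j)" using mono[of i "max i j"] mono[of j "max i j"] by auto
    then have "a \<inter> b \<in> s (max i j)" by (intro sub_field_Int B_sub s)
    then show "a \<inter> b \<in> G" by (auto simp: G_def)
  qed
  have GM: "G \<subseteq> sets M" using top_ge[OF s(1)] by (auto simp: G_def)
  have top: "space M \<in> G" using sub_field_space[OF B_sub[OF s(1)]] by (auto simp: G_def)
  have AG: "A \<in> sigma_sets (space M) G"
  proof -
    have "\<Union> (range s) \<union> null_sets M = G" using sub_field_null[OF B_sub[OF s(1)]] by (auto simp: G_def)
    then show ?thesis using A by (simp add: field_Sup_def gen_field_def)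
  qed
  have eqG: "ip u (indicator A) = ip v (indicator A)" if "A \<in> G" for A
    using that eq by (auto simp: G_def)
  show ?thesis by (rule ip_eq_on_generated[OF stable GM top uv eqG AG])
qed

lemma sqn_E_minus_bot:
  assumes x: "x \<in> B" and f: "f \<in> L2"
  shows "sqn (\<lambda>\<omega>. E x f \<omega> - E bot f \<omega>) = sqn (E x f) - sqn (E bot f)"
proof -
  note s = B_sub[OF x] B_sub[OF bot_B]
  note L = E_L2[OF s(1) f] E_L2[OF s(2) f]
  have t: "AE \<omega> in M. E bot (E x f) \<omega> = E bot f \<omega>" by (rule E_tower[OF s(2,1) bot_le[OF x] f])
  have "sqn (\<lambda>\<omega>. E x f \<omega> - E bot f \<omega>) = sqn (\<lambda>\<omega>. E x f \<omega> - E bot (E x f) \<omega>)"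
    by (rule ip_cong_AE) (use t L s in \<open>auto intro!: L2_diff E_L2\<close>)
  also have "\<dots> = sqn (E x f) - sqn (E bot (E x f))" by (rule sqn_residual[OF s(2) L(1)])
  also have "sqn (E bot (E x f)) = sqn (E bot f)"
    by (rule ip_cong_AE) (use t L s in \<open>auto intro!: E_L2\<close>)
  finally show ?thesis .
qed

text \<open>The functions \<open>E (s k) d\<close> converge to some \<open>g\<close>, and \<open>g\<close> and \<open>d\<close> have the same
  conditional expectation on the supremum.  So the bound at the finite levels carries over, up to a factor
  \<open>2\<close> that comes from the triangle inequality for squared norms.\<close>

lemma sqn_E_limit_le:
  fixes s :: "nat \<Rightarrow> 'a set set"
  assumes s: "\<And>k. s k \<in> B" "\<And>k. s k \<subseteq> s (Suc k)" and d: "d \<in> L2"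
    and bound: "\<And>k. sqn (E (s k) d) \<le> sqn (E bot d) + C"
  shows "sqn (\<lambda>\<omega>. E (Join (range s)) d \<omega> - E bot d \<omega>) \<le> 2 * C"
proof -
  have mono: "s i \<subseteq> s j" if "i \<le> j" for i j using lift_Suc_mono_le[of s, OF s(2) that] .
  have L: "E (s k) d \<in> L2" for k by (intro E_L2 B_sub s d)
  note Lb = E_L2[OF B_sub[OF bot_B] d]
  obtain g where g: "g \<in> L2"
    and lim: "\<And>\<delta>. \<delta> > 0 \<Longrightarrow> \<exists>i. True \<and> (\<forall>j. True \<longrightarrow> i \<le> j \<longrightarrow> sqn (\<lambda>\<omega>. E (s j) d \<omega> - g \<omega>) \<le> \<delta>)"
  proof (rule L2_net_limit[of "\<lambda>_. True" "(\<le>)" "\<lambda>k. E (s k) d" "- sqn d" "\<lambda>k. - sqn (E (s k) d)"])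
    show "\<exists>k. True \<and> i \<le> k \<and> j \<le> k" for i j :: nat by (rule exI[of _ "max i j"]) simp
    show "- sqn d \<le> - sqn (E (s i) d)" for i using sqn_E_le[OF B_sub[OF s(1)] d] by simp
    show "sqn (\<lambda>\<omega>. E (s i) d \<omega> - E (s j) d \<omega>) \<le> - sqn (E (s i) d) - - sqn (E (s j) d)" if "i \<le> j" for i j
    proof -
      have t: "AE \<omega> in M. E (s i) (E (s j) d) \<omega> = E (s i) d \<omega>"
        by (rule E_tower[OF B_sub[OF s(1)] B_sub[OF s(1)] mono[OF that] d])
      have "sqn (\<lambda>\<omega>. E (s i) d \<omega> - E (s j) d \<omega>) = sqn (\<lambda>\<omega>. E (s j) d \<omega> - E (s i) (E (s j) d) \<omega>)"
        unfolding sqn_diff_commute[of "E (s i) d"]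
        by (rule ip_cong_AE) (use t L d in \<open>auto intro!: L2_diff E_L2 B_sub s\<close>)
      also have "\<dots> = sqn (E (s j) d) - sqn (E (s i) (E (s j) d))"
        by (rule sqn_residual[OF B_sub[OF s(1)] L])
      also have "sqn (E (s i) (E (s j) d)) = sqn (E (s i) d)"
        by (rule ip_cong_AE) (use t L d in \<open>auto intro!: E_L2 B_sub s\<close>)
      finally show ?thesis by simp
    qed
  qed (use L in auto)
  define W where "W = Join (range s)"
  have WB: "W \<in> B" unfolding W_def using s(1) by (intro Join_B) auto
  have W: "W \<in> sub_fields M" by (rule B_sub[OF WB])
  have ip_eq: "ip d (indicator A) = ip g (indicator A)" if A: "A \<in> s k" for k A
  proof -
    have AM: "A \<in> sets M" using A top_ge[OF s(1)] by blast
    have "\<bar>ip d (indicator A) - ip g (indicator A)\<bar> \<le> t" if t: "t > 0" for t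
    proof -
      obtain i where i: "\<And>j. i \<le> j \<Longrightarrow> sqn (\<lambda>\<omega>. E (s j) d \<omega> - g \<omega>) \<le> t\<^sup>2" using lim[of "t\<^sup>2"] t by auto
      define j where "j = max i k"
      have ij: "sqn (\<lambda>\<omega>. E (s j) d \<omega> - g \<omega>) \<le> t\<^sup>2" using i[of j] by (simp add: j_def)
      have "A \<in> s j" using mono[of k j] A by (auto simp: j_def)
      then have "ip (E (s j) d) (indicator A) = ip d (indicator A)"
        by (intro ip_E_meas B_sub s d L2_indicator AM meas_indicator)
      then have "ip d (indicator A) - ip g (indicator A) = ip (indicator A) (\<lambda>\<omega>. E (s j) d \<omega> - g \<omega>)"
        unfolding ip_diff_right[OF L g L2_indicator[OF AM]] by (simp add: ip_commute)
      moreover have "2 * \<bar>ip (indicator A) (\<lambda>\<omega>. E (s j) d \<omega> - g \<omega>)\<bar> \<le> t * sqn (indicator A) + sqn (\<lambda>\<omega>. E (s j) d \<omega> - g \<omega>) / t"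
        by (rule ip_le) (use L g AM t in \<open>auto intro!: L2_diff L2_indicator\<close>)
      moreover have "t * sqn (indicator A) \<le> t"
        using t AM by (simp add: ip_indicator mult_left_le)
      moreover have "sqn (\<lambda>\<omega>. E (s j) d \<omega> - g \<omega>) / t \<le> t"
        using ij t by (simp add: divide_le_eq power2_eq_square)
      ultimately show ?thesis by linarith
    qed
    then have "\<bar>ip d (indicator A) - ip g (indicator A)\<bar> \<le> 0" by (rule dense_ge)
    then show ?thesis by simp
  qed
  have EW: "AE \<omega> in M. E W d \<omega> = E W g \<omega>"
  proof (rule E_eqI[OF W d E_L2[OF W g] E_meas])
    fix A assume A: "A \<in> W"
    then have AM: "A \<in> sets M" using top_ge[OF WB] by blast
    have "ip d (indicator A) = ip g (indicator A)"
      by (rule ip_eq_on_chain[where s=s, OF s d g ip_eq]) (use A in \<open>auto simp: W_def\<close>)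
    also have "\<dots> = ip (E W g) (indicator A)"
      by (rule ip_E_meas[OF W g L2_indicator[OF AM] meas_indicator[OF W A], symmetric])
    finally show "ip d (indicator A) = ip (E W g) (indicator A)" .
  qed
  have Eb: "AE \<omega> in M. E W (E bot d) \<omega> = E bot d \<omega>"
    by (rule E_of_coarser[OF B_sub[OF bot_B] W bot_le[OF WB] d])
  have "sqn (\<lambda>\<omega>. g \<omega> - E bot d \<omega>) \<le> 2 * C + \<delta>" if \<delta>: "\<delta> > 0" for \<delta>
  proof -
    obtain i where "sqn (\<lambda>\<omega>. E (s i) d \<omega> - g \<omega>) \<le> \<delta> / 2" using lim[of "\<delta> / 2"] \<delta> by auto
    then have "sqn (\<lambda>\<omega>. g \<omega> - E (s i) d \<omega>) \<le> \<delta> / 2" using sqn_diff_commute[of g "E (s i) d"] by simp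
    moreover have "sqn (\<lambda>\<omega>. E (s i) d \<omega> - E bot d \<omega>) \<le> C"
      using sqn_E_minus_bot[OF s(1) d, of i] bound[of i] by simp
    ultimately show ?thesis using sqn_triangle[OF g L[of i] Lb] by linarith
  qed
  then have gb: "sqn (\<lambda>\<omega>. g \<omega> - E bot d \<omega>) \<le> 2 * C" by (rule field_le_epsilon)
  have "sqn (\<lambda>\<omega>. E W d \<omega> - E bot d \<omega>) = sqn (\<lambda>\<omega>. E W g \<omega> - E W (E bot d) \<omega>)"
    by (rule ip_cong_AE) (use EW Eb g d Lb W in \<open>auto intro!: L2_diff E_L2\<close>)
  also have "\<dots> \<le> 2 * C" using sqn_E_diff_le[OF W g Lb] gb by linarith
  finally show ?thesis by (simp add: W_def)
qed

text \<open>For the indicator of \<open>A \<in> x\<close>, the hypothesis reads \<open>prob A = (prob A)\<^sup>2\<close>.\<close>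

lemma E_trivial_imp_bot:
  assumes x: "x \<in> B" and triv: "\<And>h. h \<in> L2 \<Longrightarrow> sqn (\<lambda>\<omega>. E x h \<omega> - E bot h \<omega>) = 0"
  shows "x = bot"
proof (rule antisym[OF _ bot_le[OF x]])
  show "x \<subseteq> bot"
  proof
    fix A assume A: "A \<in> x"
    have AM: "A \<in> sets M" using A top_ge[OF x] by blast
    note I = L2_indicator[OF AM]
    have "sqn (E x (indicator A)) = sqn (E bot (indicator A))"
      using sqn_E_minus_bot[OF x I] triv[OF I] by simp
    also have "sqn (E bot (indicator A)) = sqn (\<lambda>_. prob A)"
      by (rule ip_cong_AE) (use E_bot[OF I] AM I in \<open>auto intro!: E_L2 B_sub bot_B L2_const\<close>)
    also have "\<dots> = prob A * prob A" by (simp add: ip_def prob_space)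
    also have "sqn (E x (indicator A)) = sqn (indicator A)"
      by (rule ip_cong_AE)
         (use E_of_meas[OF B_sub[OF x] I meas_indicator[OF B_sub[OF x] A]] I x in \<open>auto intro!: E_L2 B_sub\<close>)
    also have "sqn (indicator A) = prob A" using AM by (simp add: ip_indicator)
    finally have "prob A = 0 \<or> prob A = 1" by simp
    then show "A \<in> bot"
    proof
      assume "prob A = 0"
      then have "A \<in> null_sets M" using AM by (simp add: null_sets_def emeasure_eq_measure)
      then show ?thesis by (simp add: field_bot_def)
    next
      assume "prob A = 1"
      then have "space M - A \<in> null_sets M" using AM by (auto simp: null_sets_def emeasure_eq_measure prob_compl)
      moreover have "A = space M - (space M - A)" using sets.sets_into_space[OF AM] by auto
      ultimately show ?thesis unfolding field_bot_def by blast
    qed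
  qed
qed

section \<open>Functions that live on infinite spectral sets vanish\<close>

text \<open>By \<open>vanish\<close>, the spectrum of \<open>f\<close> consists of infinite sets, and most of it meets even a sparse
  random union of the cells of a fine partition.  This contradicts \<open>f \<noteq> 0\<close> once infinitely many such
  unions are combined within the complete algebra.\<close>

lemma infinite_spectrum_trivial:
  assumes sep: "L2_separable M" and f: "f \<in> L2"
    and vanish: "\<And>\<epsilon> \<eta>. 0 < \<epsilon> \<Longrightarrow> \<epsilon> < 1 \<Longrightarrow> 0 < \<eta> \<Longrightarrow> \<exists>b. part b \<and> ip (noise_op \<epsilon> b f) f < \<eta>"
  shows "AE \<omega> in M. f \<omega> = 0"
proof -
  obtain D where D: "countable D" "D \<subseteq> L2" "\<And>h \<delta>. h \<in> L2 \<Longrightarrow> \<delta> > 0 \<Longrightarrow> \<exists>g\<in>D. L2_dist M h g < \<delta>"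
    using sep unfolding L2_separable_def by blast
  have "D \<noteq> {}" using D(3)[OF f, of 1] by auto
  define d where "d = from_nat_into D"
  have dD: "range d = D" unfolding d_def using D(1) \<open>D \<noteq> {}\<close> by (rule range_from_nat_into[rotated])
  have dL: "d j \<in> L2" for j using dD D(2) by auto
  \<comment> \<open>The pair \<open>p\<close> at stage \<open>n\<close> consists of the new element \<open>r\<^sub>n\<close> and of all joins
    \<open>r\<^sub>k \<squnion> \<dots> \<squnion> r\<^sub>n\<^sub>-\<^sub>1\<close> of consecutive earlier ones (the empty join is \<open>bot\<close>), which \<open>r\<^sub>n\<close> must hardly enlarge.\<close>
  define Good where "Good n p \<longleftrightarrow> finite (fst p) \<and> fst p \<subseteq> B \<and> bot \<in> fst p \<and> snd p \<in> B \<and>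
      sqn (E (cmp (snd p)) f) < (1/2) ^ n \<and>
      (\<forall>u\<in>fst p. \<forall>j\<le>n. sqn (E (u \<squnion>\<^sub>M snd p) (d j)) < sqn (E u (d j)) + (1/2) ^ n)"
    for n :: nat and p :: "'a set set set \<times> 'a set set"
  have pick: "\<exists>r. Good n (U, r)" if U: "finite U" "U \<subseteq> B" "bot \<in> U" for n U
  proof -
    have "finite (d ` {..n})" "d ` {..n} \<subseteq> L2" "(0::real) < (1/2) ^ n" using dL by auto
    then obtain r where "r \<in> B" "sqn (E (cmp r) f) < (1/2) ^ n"
      "\<And>u h. u \<in> U \<Longrightarrow> h \<in> d ` {..n} \<Longrightarrow> sqn (E (u \<squnion>\<^sub>M r) h) < sqn (E u h) + (1/2) ^ n"
      using small_element_exists[OF f vanish U(1,2)] by blast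
    then show ?thesis using U by (intro exI[of _ r]) (auto simp: Good_def)
  qed
  have "\<exists>p. \<forall>n. Good n (p n) \<and> fst (p (Suc n)) = insert bot ((\<lambda>u. u \<squnion>\<^sub>M snd (p n)) ` fst (p n))"
  proof (rule dependent_nat_choice)
    show "\<exists>p. Good 0 p" using pick[of "{bot}" 0] bot_B by auto
    fix p n assume p: "Good n p"
    have "\<exists>r. Good (Suc n) (insert bot ((\<lambda>u. u \<squnion>\<^sub>M snd p) ` fst p), r)"
      by (rule pick) (use p bot_B in \<open>auto simp: Good_def intro!: join_B\<close>)
    then show "\<exists>q. Good (Suc n) q \<and> fst q = insert bot ((\<lambda>u. u \<squnion>\<^sub>M snd p) ` fst p)" by auto
  qed
  then obtain p where "\<forall>n. Good n (p n) \<and> fst (p (Suc n)) = insert bot ((\<lambda>u. u \<squnion>\<^sub>M snd (p n)) ` fst (p n))"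
    by (rule exE)
  then have p: "Good n (p n)" "fst (p (Suc n)) = insert bot ((\<lambda>u. u \<squnion>\<^sub>M snd (p n)) ` fst (p n))" for n
    by simp_all
  define r where "r n = snd (p n)" for n
  define U where "U n = fst (p n)" for n
  have r: "r n \<in> B" "sqn (E (cmp (r n)) f) < (1/2) ^ n" for n
    using p(1)[of n] by (auto simp: Good_def r_def)
  have U: "bot \<in> U n" "U n \<subseteq> B" "\<And>u. u \<in> U n \<Longrightarrow> u \<squnion>\<^sub>M r n \<in> U (Suc n)"
    "\<And>u j. u \<in> U n \<Longrightarrow> j \<le> n \<Longrightarrow> sqn (E (u \<squnion>\<^sub>M r n) (d j)) < sqn (E u (d j)) + (1/2) ^ n" for n
    using p(1)[of n] p(2)[of n] by (auto simp: Good_def r_def U_def)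
  \<comment> \<open>the join of \<open>k\<close> consecutive elements, starting with \<open>r n\<close>\<close>
  define s where "s n k = rec_nat bot (\<lambda>k u. u \<squnion>\<^sub>M r (n + k)) k" for n k
  have s0: "s n 0 = bot" and sSuc: "s n (Suc k) = s n k \<squnion>\<^sub>M r (n + k)" for n k
    by (simp_all add: s_def)
  have sU: "s n k \<in> U (n + k)" for n k
    by (induction k) (auto simp: s0 sSuc U(1) intro: U(3))
  have sB: "s n k \<in> B" for n k using sU U(2) by blast
  have smono: "s n k \<subseteq> s n (Suc k)" for n k unfolding sSuc by (rule join_upper1)
  have s_bound: "sqn (E (s n k) (d j)) \<le> sqn (E bot (d j)) + 2 * (1/2) ^ n" if "j \<le> n" for n k j
  proof -
    have "sqn (E (s n k) (d j)) \<le> sqn (E bot (d j)) + (1/2) ^ n * (\<Sum>i<k. (1/2) ^ i)"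
    proof (induction k)
      case (Suc k)
      have "sqn (E (s n (Suc k)) (d j)) \<le> sqn (E (s n k) (d j)) + (1/2) ^ (n + k)"
        unfolding sSuc using U(4)[OF sU, of j n k] that by simp
      also have "\<dots> \<le> sqn (E bot (d j)) + (1/2) ^ n * (\<Sum>i<k. (1/2) ^ i) + (1/2) ^ (n + k)"
        using Suc by simp
      finally show ?case by (simp add: distrib_left power_add)
    qed (simp add: s0)
    also have "(\<Sum>i<k. (1/2::real) ^ i) \<le> 2" by (simp add: sum_gp_strict)
    then have "(1/2) ^ n * (\<Sum>i<k. (1/2::real) ^ i) \<le> (1/2) ^ n * 2" by (intro mult_left_mono) auto
    finally show ?thesis by simp
  qed
  define w where "w n = Join (range (s n))" for n
  have wB: "w n \<in> B" for n unfolding w_def using sB by (intro Join_B) auto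
  have s_w: "s n k \<subseteq> w n" for n k unfolding w_def using sB by (intro Join_upper) auto
  have r_w: "r m \<subseteq> w n" if "n \<le> m" for m n
  proof -
    have "r (n + (m - n)) \<subseteq> s n (Suc (m - n))" unfolding sSuc by (rule join_upper2)
    then show ?thesis using s_w[of n "Suc (m - n)"] that by simp
  qed
  have w_anti: "w (Suc n) \<subseteq> w n" for n
  proof -
    have "s (Suc n) k \<subseteq> w n" for k
    proof (induction k)
      case (Suc k)
      then show ?case unfolding sSuc using r_w[of n "Suc n + k"] by (intro join_least B_sub wB) auto
    qed (simp add: s0 bot_le wB)
    then show ?thesis unfolding w_def[of "Suc n"] using sB by (intro Join_least B_sub wB) auto
  qed
  define W where "W = field_Inf M (range w)"
  have WB: "W \<in> B" unfolding W_def using wB by (intro Inf_B) auto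
  have W_w: "W \<subseteq> w n" for n unfolding W_def by (auto simp: field_Inf_def)
  note sW = B_sub[OF WB] and sb = B_sub[OF bot_B]
  \<comment> \<open>The infimum lies below every \<open>w n\<close>, whose conditional expectations of \<open>d j\<close> are almost constant.\<close>
  have W_triv_d: "sqn (\<lambda>\<omega>. E W (d j) \<omega> - E bot (d j) \<omega>) = 0" for j
  proof -
    have "sqn (E W (d j)) - sqn (E bot (d j)) \<le> 4 * (1/2) ^ n" if "j \<le> n" for n
    proof -
      have "sqn (E W (d j)) \<le> sqn (E (w n) (d j))" by (rule sqn_E_mono[OF sW B_sub[OF wB] W_w dL])
      moreover have "sqn (\<lambda>\<omega>. E (w n) (d j) \<omega> - E bot (d j) \<omega>) \<le> 2 * (2 * (1/2) ^ n)"
        unfolding w_def by (rule sqn_E_limit_le[where s="s n", OF sB smono dL s_bound[OF that]])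
      ultimately show ?thesis using sqn_E_minus_bot[OF wB dL, of n j] by simp
    qed
    then have "\<forall>\<^sub>F n in sequentially. sqn (E W (d j)) - sqn (E bot (d j)) \<le> 4 * (1/2) ^ n"
      unfolding eventually_sequentially by blast
    moreover have "(\<lambda>n. 4 * (1/2::real) ^ n) \<longlonglongrightarrow> 4 * 0" by (intro tendsto_intros LIMSEQ_power_zero) simp
    ultimately have "sqn (E W (d j)) - sqn (E bot (d j)) \<le> 0"
      using tendsto_lowerbound[of _ "4 * 0" sequentially] by fastforce
    then show ?thesis
      using sqn_E_minus_bot[OF WB dL, of j] sqn_nonneg[of "\<lambda>\<omega>. E W (d j) \<omega> - E bot (d j) \<omega>"] by simp
  qed
  have "W = bot"
  proof (rule E_trivial_imp_bot[OF WB])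
    fix h assume h: "h \<in> L2"
    have "sqn (\<lambda>\<omega>. E W h \<omega> - E bot h \<omega>) \<le> \<delta>" if \<delta>: "\<delta> > 0" for \<delta>
    proof -
      obtain g where "g \<in> D" "L2_dist M h g < sqrt (\<delta> / 6)" using D(3)[OF h, of "sqrt (\<delta> / 6)"] \<delta> by auto
      then obtain j where "L2_dist M h (d j) < sqrt (\<delta> / 6)" using dD by auto
      then have hd: "sqn (\<lambda>\<omega>. h \<omega> - d j \<omega>) < \<delta> / 6"
        by (simp add: L2_dist_def ip_def power2_eq_square)
      note L = E_L2[OF sW h] E_L2[OF sW dL[of j]] E_L2[OF sb h] E_L2[OF sb dL[of j]]
      have "sqn (\<lambda>\<omega>. E W (d j) \<omega> - E bot h \<omega>) \<le>
          2 * sqn (\<lambda>\<omega>. E W (d j) \<omega> - E bot (d j) \<omega>) + 2 * sqn (\<lambda>\<omega>. E bot (d j) \<omega> - E bot h \<omega>)"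
        by (rule sqn_triangle[OF L(2,4,3)])
      moreover have "sqn (\<lambda>\<omega>. E bot (d j) \<omega> - E bot h \<omega>) \<le> sqn (\<lambda>\<omega>. h \<omega> - d j \<omega>)"
        using sqn_E_diff_le[OF sb dL h, of j] sqn_diff_commute[of h "d j"] by simp
      moreover have "sqn (\<lambda>\<omega>. E W h \<omega> - E bot h \<omega>) \<le>
          2 * sqn (\<lambda>\<omega>. E W h \<omega> - E W (d j) \<omega>) + 2 * sqn (\<lambda>\<omega>. E W (d j) \<omega> - E bot h \<omega>)"
        by (rule sqn_triangle[OF L(1,2,3)])
      moreover have "sqn (\<lambda>\<omega>. E W h \<omega> - E W (d j) \<omega>) \<le> sqn (\<lambda>\<omega>. h \<omega> - d j \<omega>)"
        by (rule sqn_E_diff_le[OF sW h dL])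
      ultimately show ?thesis using hd W_triv_d[of j] by linarith
    qed
    then have "sqn (\<lambda>\<omega>. E W h \<omega> - E bot h \<omega>) \<le> 0" by (rule dense_ge)
    then show "sqn (\<lambda>\<omega>. E W h \<omega> - E bot h \<omega>) = 0"
      using sqn_nonneg[of "\<lambda>\<omega>. E W h \<omega> - E bot h \<omega>"] by simp
  qed
  have cwB: "cmp (w n) \<in> B" for n by (rule cmp_B[OF wB])
  have cw_mono: "cmp (w n) \<subseteq> cmp (w (Suc n))" for n by (rule cmp_antimono[OF wB wB w_anti])
  \<comment> \<open>Here completeness enters: the supremum has a complement in the algebra, which lies below all \<open>w n\<close>.\<close>
  define V where "V = Join (range (\<lambda>n. cmp (w n)))"
  have VB: "V \<in> B" unfolding V_def using cwB by (intro Join_B) auto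
  have "cmp V \<subseteq> w n" for n
  proof -
    have "cmp (w n) \<subseteq> V" unfolding V_def using cwB by (intro Join_upper) auto
    then have "cmp V \<subseteq> cmp (cmp (w n))" by (rule cmp_antimono[OF cwB VB])
    then show ?thesis by (simp add: cmp_cmp[OF wB])
  qed
  then have "cmp V \<subseteq> W" unfolding W_def field_Inf_def using top_ge[OF cmp_B[OF VB]] by blast
  then have "cmp V = bot" using \<open>W = bot\<close> bot_le[OF cmp_B[OF VB]] by blast
  then have V: "V = sets M" using cmp_cmp[OF VB] cmp_bot by simp
  \<comment> \<open>The field \<open>cmp (w n)\<close> avoids \<open>r m\<close> for all \<open>m \<ge> n\<close>, and the spectrum of \<open>f\<close> does not.\<close>
  have null: "AE \<omega> in M. E (cmp (w n)) f \<omega> = 0" for n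
  proof -
    note sc = B_sub[OF cwB[of n]]
    have "sqn (E (cmp (w n)) f) \<le> (1/2) ^ m" if "n \<le> m" for m
    proof -
      have "cmp (w n) \<subseteq> cmp (r m)" by (rule cmp_antimono[OF r(1) wB r_w[OF that]])
      then have "sqn (E (cmp (w n)) f) \<le> sqn (E (cmp (r m)) f)"
        by (intro sqn_E_mono sc B_sub cmp_B r(1) f)
      then show ?thesis using r(2)[of m] by simp
    qed
    then have "\<forall>\<^sub>F m in sequentially. sqn (E (cmp (w n)) f) \<le> (1/2) ^ m"
      unfolding eventually_sequentially by blast
    moreover have "(\<lambda>m. (1/2::real) ^ m) \<longlonglongrightarrow> 0" by (intro LIMSEQ_power_zero) simp
    ultimately have "sqn (E (cmp (w n)) f) \<le> 0"
      using tendsto_lowerbound[of _ 0 sequentially] by fastforce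
    then have "sqn (E (cmp (w n)) f) = 0" using sqn_nonneg[of "E (cmp (w n)) f"] by simp
    then show ?thesis using sqn_eq_0_iff[OF E_L2[OF sc f]] by simp
  qed
  have zero: "ip f (indicator A) = ip (\<lambda>_. 0) (indicator A)" if A: "A \<in> cmp (w n)" for A n
  proof -
    have AM: "A \<in> sets M" using A top_ge[OF cwB] by blast
    have "ip f (indicator A) = ip (E (cmp (w n)) f) (indicator A)"
      by (rule ip_E_meas[symmetric]) (use A AM f cwB in \<open>auto intro!: B_sub L2_indicator meas_indicator\<close>)
    also have "\<dots> = ip (\<lambda>_. 0) (indicator A)"
      by (rule ip_cong_AE) (use null AM f cwB in \<open>auto intro!: B_sub E_L2 L2_indicator L2_const\<close>)
    finally show ?thesis .
  qed
  show ?thesis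
  proof (rule L2_eq_AE[OF f L2_const])
    fix A assume A: "A \<in> sets M"
    show "ip f (indicator A) = ip (\<lambda>_. 0) (indicator A)"
    proof (rule ip_eq_on_chain[where s="\<lambda>n. cmp (w n)"])
      show "A \<in> Join (range (\<lambda>n. cmp (w n)))" using A V by (simp add: V_def)
    qed (rule cwB cw_mono f L2_const zero | assumption)+
  qed
qed

text \<open>Sub-fields contain all null sets, so sets may be modified on them.\<close>

lemma sub_field_AE_closed:
  assumes x: "x \<in> sub_fields M" and A: "A \<in> sets M" and h: "h \<in> meas x"
    and eq: "AE \<omega> in M. indicator A \<omega> = (h \<omega> :: real)"
  shows "A \<in> x"
proof -
  interpret X: sigma_algebra "space M" x by (rule sub_field_sigma_algebra[OF x])
  define A' where "A' = {\<omega> \<in> space M. h \<omega> = 1}"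
  have A': "A' \<in> x"
    using measurable_sets[OF h, of "{1}"]
    by (simp add: A'_def sets_sub_field[OF x] space_measure_of_conv vimage_def Int_def conj_commute)
  then have A'M: "A' \<in> sets M" using sub_field_subset[OF x] by blast
  have ae: "AE \<omega> in M. \<omega> \<in> A \<longleftrightarrow> \<omega> \<in> A'"
    using eq AE_space by eventually_elim (auto simp: A'_def indicator_def split: if_splits)
  have "A - A' \<in> null_sets M" "A' - A \<in> null_sets M"
    using ae A A'M by (auto simp: AE_iff_null_sets[symmetric] intro!: AE_iff_null_sets[THEN iffD2] elim!: eventually_mono)
  then have "A - A' \<in> x" "A' - A \<in> x" using sub_field_null[OF x] by auto
  then have "(A' - (A' - A)) \<union> (A - A') \<in> x" using A' by auto
  moreover have "(A' - (A' - A)) \<union> (A - A') = A" by auto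
  ultimately show ?thesis by simp
qed

text \<open>The indicator of any event, minus its projection to the chaos field, is orthogonal to that field
  and therefore vanishes.\<close>

lemma chaos_field_top: 
  assumes "L2_separable M" shows "chaos_field (sets M) = sets M"
proof (rule antisym)
  let ?G = "chaos_field (sets M)"
  note G = chaos_field_sub[OF sets_sub_fields]
  show "?G \<subseteq> sets M" by (rule sub_field_subset[OF G])
  show "sets M \<subseteq> ?G"
  proof
    fix A assume A: "A \<in> sets M"
    note I = L2_indicator[OF A]
    define f where "f = (\<lambda>\<omega>. indicator A \<omega> - E ?G (indicator A) \<omega>)"
    have f: "f \<in> L2" unfolding f_def by (intro L2_diff I E_L2 G)
    have orth: "ip f h = 0" if h: "h \<in> L2" "AE \<omega> in M. E ?G h \<omega> = h \<omega>" for h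
    proof -
      have "ip f h = ip f (E ?G h)"
        by (rule ip_cong_AE) (use h f G in \<open>auto intro!: E_L2\<close>)
      also have "\<dots> = 0" unfolding f_def by (rule E_residual_orthogonal[OF G I E_L2[OF G h(1)] E_meas])
      finally show ?thesis .
    qed
    have "AE \<omega> in M. f \<omega> = 0"
      by (rule infinite_spectrum_trivial[OF assms f noise_op_vanishes[OF f orth]])
    then have "AE \<omega> in M. indicator A \<omega> = E ?G (indicator A) \<omega>"
      unfolding f_def by eventually_elim simp
    then show "A \<in> ?G" by (rule sub_field_AE_closed[OF G A E_meas])
  qed
qed

end

section \<open>Complete noise-type Boolean algebras are classical\<close>

theorem theorem1p4:
  fixes M :: "'a measure" and B :: "'a set set set"
  assumes "prob_space M"
    and "L2_separable M"
    and "noise_type_boolean_algebra M B"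
    and "complete_in_sub_fields M B"
  shows "classical M B"
proof -
  interpret prob_space M by fact
  interpret complete_noise M B
    by unfold_locales (fact assms)+
  have "h \<in> meas (sets M)" if "h \<in> first_chaos M B" for h
    using that by (auto simp: first_chaos_def L2_functions_def sets_sub_field[OF sets_sub_fields] cong: measurable_cong_sets)
  then have "{h -` S \<inter> space M | h S. h \<in> first_chaos M B \<and> h \<in> meas (sets M) \<and> S \<in> sets borel} =
    {f -` A \<inter> space M | f A. f \<in> first_chaos M B \<and> A \<in> sets borel}" by blast
  then show ?thesis
    using chaos_field_top[OF assms(2)] by (simp add: classical_def chaos_field_def)
qed

end
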